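(* Assume that $u_0\in L^1((0,1))\cap BV([0,1])$ with $\int_0^1u_0\,dx=0$, and that $f$ is locally bounded, $1$-periodic in $x$ and twice continuously differentiable. Let $u$ be the entropy solution of the periodic Ostrovsky-Hunter equation $u_t+f(x,u)_x=P[u]$ on $(0,T)\times(0,1)$ with initial data $u_0$, and let $u_{\Delta x}$ be the piecewise constant approximation generated by the finite volume scheme. Then $$\|u(T,\cdot)-u_{\Delta x}(T,\cdot)\|_{L^1((0,1))}\le C_T\sqrt{\Delta x},$$ where $C_T$ is a constant independent of $\Delta x$.
   Context: Equation. Let $T>0$. The problem is $$u_t+f(x,u)_x=P[u],\quad x\in(0,1),\ t\in(0,T);\qquad u(0,x)=u_0(x);\qquad u(t,0)=u(t,1),$$ with $P[u](t,x)=\int_0^x u(t,y)\,dy-\int_0^1\int_0^y u(t,z)\,dz\,dy$. Functions of $x\in[0,1]$ are extended $1$-periodically. $f_x(x,u)$ denotes the partial derivative with respect to the first variable. Entropy solution. Let $\Pi_T=[0,T]\times[0,1]$, $\operatorname{sign}(0)=0$, $\eta(u,k)=|u-k|$ and $q(x,u,k)=\operatorname{sign}(u-k)(f(x,u)-f(x,k))$. A function $u\in C([0,T];L^1((0,1)))\cap L^\infty(\Pi_T)$ with $u(0,\cdot)=u_0$ is an entropy solution if for all constants $k\in\mathbb{R}$ and all non-negative smooth test functions $\varphi(t,x)$ that are $1$-periodic in $x$, $$\int_{\Pi_T}\Big(\eta(u,k)\varphi_t+q(x,u,k)\varphi_x-\operatorname{sign}(u-k)f_x(x,k)\varphi+\operatorname{sign}(u-k)P[u]\varphi\Big)dx\,dt-\int_0^1\eta(u(t,x),k)\varphi(t,x)\,dx\Big|_{t=0}^{t=T}\ge0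 .$$ Scheme. Let $N,M$ be positive integers, $\Delta x=1/N$, $\Delta t=T/(M+1)$, $\lambda=\Delta t/\Delta x$, $x_{j+1/2}=j\Delta x$ ($j=0,\dots,N$), $t^n=n\Delta t$, $I_j=[x_{j-1/2},x_{j+1/2})$, $I^n=[t^n,t^{n+1})$, $I^n_j=I^n\times I_j$. Let $F(x,u,v)$ be a numerical flux, $1$-periodic in $x$, non-decreasing in $u$, non-increasing in $v$, consistent ($F(x,u,u)=f(x,u)$), differentiable in $x$, with $F$ and $F_x$ Lipschitz continuous in $u$ and $v$. For $n\ge0$, $j=1,\dots,N$, set $$u^{n+1}_j=u^n_j-\lambda\big(F^n_{j+1/2}-F^n_{j-1/2}\big)+\Delta t\,P^n_j,\qquad F^n_{j+1/2}=F(x_{j+1/2},u^n_j,u^n_{j+1}),$$ with $u^n_0=u^n_N$, $u^n_{N+1}=u^n_1$, $$P^n_j=\Delta x\Big(\sum_{i=1}^{j-1}u^n_i+\tfrac12u^n_j\Big)-(\Delta x)^2\sum_{\ell=1}^N\Big(\sum_{i=1}^{\ell-1}u^n_i+\tfrac12u^n_\ell\Big),\qquad u^0_j=\frac1{\Delta x}\int_{I_j}u_0(x)\,dx .$$ The CFL condition is in force: $\Delta t\le c_f\Delta x$, with $c_f$ a constant depending on $f$ (through $F$) such that every map $\Psi_j(u,v,w)=v-\lambda\big(F(x_{j+1/2},v,w)-F(x_{j-1/2},u,v)\big)$ is non-decreasing in each of its arguments. The approximation is $u_{\Delta x}(t,x)=u^n_j$ for $(t,x)\in I^n_j$. *)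

theory Defs
  imports "HOL-Analysis.Analysis"
begin

section \<open>Function classes\<close>

text \<open>A function on the plane is of class \<open>C\<^sup>k\<close> if all partial derivatives up to
  order \<open>k\<close> exist and are continuous. Continuity of the function itself and of the
  lower-order derivatives follows from continuity of those of the next order.\<close>

fun Ck :: "nat \<Rightarrow> (real \<Rightarrow> real \<Rightarrow> real) \<Rightarrow> bool" where
  "Ck 0 g \<longleftrightarrow> continuous_on UNIV (\<lambda>(x, y). g x y)"
| "Ck (Suc k) g \<longleftrightarrow> (\<exists>g1 g2.
      (\<forall>x y. ((\<lambda>s. g s y) has_real_derivative g1 x y) (at x)) \<and>
      (\<forall>x y. ((\<lambda>s. g x s) has_real_derivative g2 x y) (at y)) \<and>
      Ck k g1 \<and> Ck k g2)"

definition smooth2 :: "(real \<Rightarrow> real \<Rightarrow> real) \<Rightarrow> bool" where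
  "smooth2 g \<longleftrightarrow> (\<forall>k. Ck k g)"

definition bounded_variation :: "real \<Rightarrow> real \<Rightarrow> (real \<Rightarrow> real) \<Rightarrow> bool" where
  "bounded_variation a b g \<longleftrightarrow>
    (\<exists>B. \<forall>(p :: nat \<Rightarrow> real) n.
       (\<forall>i\<le>n. p i \<in> {a..b}) \<and> (\<forall>i<n. p i \<le> p (Suc i)) \<longrightarrow>
       (\<Sum>i<n. \<bar>g (p (Suc i)) - g (p i)\<bar>) \<le> B)"

text \<open>The intersection of \<open>L\<^sup>1((0,1))\<close> and \<open>BV([0,1])\<close>. As usual for \<open>L\<^sup>1\<close>
  functions, bounded variation is a property of the equivalence class: some a.e.-equal
  function has finite pointwise variation.\<close>

definition L1_BV :: "(real \<Rightarrow> real) \<Rightarrow> bool" where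
  "L1_BV g \<longleftrightarrow> set_integrable lborel {0<..<1} g \<and>
     (\<exists>h. bounded_variation 0 1 h \<and> (AE x in lborel. x \<in> {0<..<1} \<longrightarrow> g x = h x))"

definition L1_norm :: "(real \<Rightarrow> real) \<Rightarrow> real" where
  "L1_norm g = (LINT x:{0<..<1}|lborel. \<bar>g x\<bar>)"


section \<open>Entropy solutions\<close>

definition P_op :: "(real \<Rightarrow> real) \<Rightarrow> real \<Rightarrow> real" where
  "P_op w x = (LINT y:{0..x}|lborel. w y) - (LINT y:{0..1}|lborel. (LINT z:{0..y}|lborel. w z))"

text \<open>Membership in \<open>C([0,T]; L\<^sup>1((0,1)))\<close> and in \<open>L\<^sup>\<infinity>(\<Pi>\<^sub>T)\<close>, the latter with the joint
  measurability that makes the integrals over \<open>\<Pi>\<^sub>T\<close> meaningful.\<close>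

definition C_L1 :: "real \<Rightarrow> (real \<Rightarrow> real \<Rightarrow> real) \<Rightarrow> bool" where
  "C_L1 T u \<longleftrightarrow> (\<forall>t\<in>{0..T}. set_integrable lborel {0<..<1} (u t)) \<and>
     (\<forall>t\<in>{0..T}. ((\<lambda>s. L1_norm (\<lambda>x. u s x - u t x)) \<longlongrightarrow> 0) (at t within {0..T}))"

definition Linf_Pi :: "real \<Rightarrow> (real \<Rightarrow> real \<Rightarrow> real) \<Rightarrow> bool" where
  "Linf_Pi T u \<longleftrightarrow>
     set_borel_measurable lborel ({0..T} \<times> {0..1}) (\<lambda>(t, x). u t x) \<and>
     (\<exists>B. AE (t, x) in lborel. (t, x) \<in> {0..T} \<times> {0..1} \<longrightarrow> \<bar>u t x\<bar> \<le> B)"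

definition entropy_ineq ::
  "real \<Rightarrow> (real \<Rightarrow> real \<Rightarrow> real) \<Rightarrow> (real \<Rightarrow> real \<Rightarrow> real) \<Rightarrow> real \<Rightarrow> (real \<Rightarrow> real \<Rightarrow> real) \<Rightarrow> bool"
where
  "entropy_ineq T f u k \<phi> \<longleftrightarrow>
     (LINT p:{0..T} \<times> {0..1}|lborel. (case p of (t, x) \<Rightarrow>
          \<bar>u t x - k\<bar> * deriv (\<lambda>s. \<phi> s x) t
        + sgn (u t x - k) * (f x (u t x) - f x k) * deriv (\<lambda>y. \<phi> t y) x
        - sgn (u t x - k) * deriv (\<lambda>y. f y k) x * \<phi> t x
        + sgn (u t x - k) * P_op (u t) x * \<phi> t x))
     - ((LINT x:{0..1}|lborel. \<bar>u T x - k\<bar> * \<phi> T x)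
        - (LINT x:{0..1}|lborel. \<bar>u 0 x - k\<bar> * \<phi> 0 x)) \<ge> 0"

definition entropy_solution ::
  "real \<Rightarrow> (real \<Rightarrow> real \<Rightarrow> real) \<Rightarrow> (real \<Rightarrow> real) \<Rightarrow> (real \<Rightarrow> real \<Rightarrow> real) \<Rightarrow> bool"
where
  "entropy_solution T f u0 u \<longleftrightarrow>
     C_L1 T u \<and> Linf_Pi T u \<and>
     (AE x in lborel. x \<in> {0<..<1} \<longrightarrow> u 0 x = u0 x) \<and>
     (\<forall>k \<phi>. smooth2 \<phi> \<and> (\<forall>t x. \<phi> t x \<ge> 0) \<and> (\<forall>t x. \<phi> t (x + 1) = \<phi> t x)
        \<longrightarrow> entropy_ineq T f u k \<phi>)"


section \<open>The finite volume scheme\<close>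

definition numerical_flux ::
  "(real \<Rightarrow> real \<Rightarrow> real) \<Rightarrow> (real \<Rightarrow> real \<Rightarrow> real \<Rightarrow> real) \<Rightarrow> bool" where
  "numerical_flux f F \<longleftrightarrow>
     (\<forall>x v w. F (x + 1) v w = F x v w) \<and>
     (\<forall>x w. mono (\<lambda>v. F x v w)) \<and>
     (\<forall>x v. antimono (\<lambda>w. F x v w)) \<and>
     (\<forall>x v. F x v v = f x v) \<and>
     (\<forall>x v w. (\<lambda>y. F y v w) differentiable (at x)) \<and>
     (\<exists>L. \<forall>x. L-lipschitz_on UNIV (\<lambda>(v, w). F x v w)) \<and>
     (\<exists>L. \<forall>x. L-lipschitz_on UNIV (\<lambda>(v, w). deriv (\<lambda>y. F y v w) x))"

text \<open>The mesh sizes, and the cell interfaces \<open>iface N j\<close> for \<open>x\<^bsub>j+1/2\<^esub> = j \<Delta>x\<close>.\<close>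

definition dx :: "nat \<Rightarrow> real" where "dx N = 1 / real N"

definition dt :: "real \<Rightarrow> nat \<Rightarrow> real" where "dt T M = T / (real M + 1)"

definition lam :: "real \<Rightarrow> nat \<Rightarrow> nat \<Rightarrow> real" where "lam T N M = dt T M / dx N"

definition iface :: "nat \<Rightarrow> nat \<Rightarrow> real" where "iface N j = real j * dx N"

text \<open>Cell values are functions of the index \<open>j \<in> {1..N}\<close>; \<open>per N w\<close> supplies the
  periodic ghost values at \<open>0\<close> and \<open>N + 1\<close>.\<close>

definition per :: "nat \<Rightarrow> (nat \<Rightarrow> real) \<Rightarrow> nat \<Rightarrow> real" where
  "per N w j = (if j = 0 then w N else if j = N + 1 then w 1 else w j)"

definition P_disc :: "nat \<Rightarrow> (nat \<Rightarrow> real) \<Rightarrow> nat \<Rightarrow> real" where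
  "P_disc N w j =
     dx N * ((\<Sum>i\<in>{1..<j}. w i) + w j / 2)
     - (dx N)\<^sup>2 * (\<Sum>l\<in>{1..N}. (\<Sum>i\<in>{1..<l}. w i) + w l / 2)"

definition fv_step ::
  "(real \<Rightarrow> real \<Rightarrow> real \<Rightarrow> real) \<Rightarrow> real \<Rightarrow> nat \<Rightarrow> nat \<Rightarrow> (nat \<Rightarrow> real) \<Rightarrow> nat \<Rightarrow> real"
where
  "fv_step F T N M w j =
     w j - lam T N M * (F (iface N j) (per N w j) (per N w (j + 1))
                        - F (iface N (j - 1)) (per N w (j - 1)) (per N w j))
     + dt T M * P_disc N w j"

fun fv :: "(real \<Rightarrow> real \<Rightarrow> real \<Rightarrow> real) \<Rightarrow> (real \<Rightarrow> real) \<Rightarrow> real \<Rightarrow> nat \<Rightarrow> nat \<Rightarrow> nat \<Rightarrow> nat \<Rightarrow> real"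
where
  "fv F u0 T N M 0 j = (LINT x:{iface N (j - 1)..<iface N j}|lborel. u0 x) / dx N"
| "fv F u0 T N M (Suc n) j = fv_step F T N M (fv F u0 T N M n) j"

text \<open>For \<open>t \<ge> 0\<close> and \<open>x \<in> [0,1)\<close>, the point \<open>(t, x)\<close> lies in \<open>I\<^sup>n \<times> I\<^sub>j\<close> exactly for
  \<open>n = \<lfloor>t / \<Delta>t\<rfloor>\<close> and \<open>j = \<lfloor>x / \<Delta>x\<rfloor> + 1\<close>. In particular \<open>n = M + 1\<close> at time \<open>t = T\<close>.\<close>

definition fv_approx ::
  "(real \<Rightarrow> real \<Rightarrow> real \<Rightarrow> real) \<Rightarrow> (real \<Rightarrow> real) \<Rightarrow> real \<Rightarrow> nat \<Rightarrow> nat \<Rightarrow> real \<Rightarrow> real \<Rightarrow> real"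
where
  "fv_approx F u0 T N M t x =
     fv F u0 T N M (nat \<lfloor>t / dt T M\<rfloor>) (nat \<lfloor>x / dx N\<rfloor> + 1)"

definition Psi ::
  "(real \<Rightarrow> real \<Rightarrow> real \<Rightarrow> real) \<Rightarrow> real \<Rightarrow> nat \<Rightarrow> nat \<Rightarrow> nat \<Rightarrow> real \<Rightarrow> real \<Rightarrow> real \<Rightarrow> real"
where
  "Psi F T N M j a b c =
     b - lam T N M * (F (iface N j) b c - F (iface N (j - 1)) a b)"

text \<open>\<open>cf\<close> is an admissible constant in the CFL condition \<open>\<Delta>t \<le> cf \<Delta>x\<close>: on every mesh
  satisfying this condition, the scheme without source term is monotone.\<close>

definition CFL_const :: "(real \<Rightarrow> real \<Rightarrow> real \<Rightarrow> real) \<Rightarrow> real \<Rightarrow> real \<Rightarrow> bool" where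
  "CFL_const F T cf \<longleftrightarrow>
     (\<forall>N M. N > 0 \<and> M > 0 \<and> dt T M \<le> cf * dx N \<longrightarrow>
        (\<forall>j\<in>{1..N}.
           (\<forall>b c. mono (\<lambda>a. Psi F T N M j a b c)) \<and>
           (\<forall>a c. mono (\<lambda>b. Psi F T N M j a b c)) \<and>
           (\<forall>a b. mono (\<lambda>c. Psi F T N M j a b c))))"

end

theory Submission
  imports Defs
begin

text \<open>
  The entropy solution \<open>u\<close> and the scheme are compared by Kruzkov's doubling of variables in
  Kuznetsov's quantitative form. The quantity that is estimated is
  \<open>Phi a w = (\<Sum>j. \<integral> \<bar>w y - a j\<bar> W j y dy)\<close> with \<open>w = u(t, _)\<close> and \<open>a = v\<^sup>n\<close>, where \<open>W j y\<close> is the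
  mass that a smooth periodic kernel of width \<open>\<epsilon> = sqrt \<Delta>x\<close> centred at \<open>y\<close> gives to the cell \<open>j\<close>.
  Replacing the \<open>L\<^sup>1\<close> distance by \<open>Phi\<close> costs \<open>\<epsilon>\<close> times the total variation of \<open>a\<close> (\<open>Phi_L1\<close>). Only
  the variation of the numerical solution enters, so no regularity of \<open>u\<close> in space or in time is
  called for.

  Every \<open>W j\<close> is an admissible test function. The entropy inequality of \<open>u\<close> is therefore used with
  \<open>k = v\<^sup>n\<^sub>j\<close> and the test function \<open>exp (- c t) hat\<^sub>n(t) W j y\<close>, where \<open>hat\<^sub>n\<close> is the piecewise linear hat
  at \<open>t\<^sup>n\<close>. The scheme satisfies a discrete entropy inequality for every constant (\<open>cell_entropy\<close>),
  which is used with \<open>k = u(t, y)\<close>. After summation over cells and time levels, the slopes of the hats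
  produce exactly the increments \<open>(Phi v\<^sup>n\<^sup>+\<^sup>1 - Phi v\<^sup>n) / \<Delta>t\<close> that the scheme controls. The fluxes cancel
  up to terms of order \<open>\<Delta>x / \<epsilon> = \<epsilon>\<close> and up to multiples of \<open>Phi\<close> (\<open>integrated_step\<close>). The factor
  \<open>exp (- c t)\<close> absorbs the latter and thus does the work of Gronwall's lemma inside the test function.

  One obstruction remains. The source terms of the scheme carry the sign of \<open>v\<^sup>n\<^sup>+\<^sup>1\<^sub>j - u\<close>, those of the
  entropy inequality of \<open>u\<close> the signs of both \<open>v\<^sup>n\<^sub>j - u\<close> and \<open>v\<^sup>n\<^sup>+\<^sup>1\<^sub>j - u\<close>. The difference of two signs is
  not small, but its contribution has the form \<open>Z v\<^sup>n\<^sup>+\<^sup>1 - Z v\<^sup>n\<close> with a bounded functional \<open>Z\<close>. The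
  comparison is therefore made with \<open>K\<close> copies of the scheme that are shifted by \<open>0, ..., K - 1\<close> time
  steps. In the average over the copies these differences telescope and leave \<open>O(1 / K)\<close>, whereas a
  shift by at most \<open>K\<close> steps costs \<open>O(K \<Delta>t)\<close>, because the scheme is Lipschitz in time with values in
  \<open>L\<^sup>1\<close>. With \<open>K\<close> of the order \<open>1 / sqrt \<Delta>t\<close> both errors are \<open>O(sqrt \<Delta>x)\<close> (\<open>kuznetsov_estimate\<close>).

  The bounds on the scheme are those of monotone schemes: a maximum principle (\<open>growth_bound\<close>), a bound
  on the total variation (\<open>growth_TV\<close>), since a monotone conservative map contracts \<open>\<ell>\<^sup>1\<close> and
  may be applied to the solution and its translate, and the Lipschitz bound in time (\<open>step_time\<close>). Initial
  data of bounded variation are a difference of two monotone functions, for which cell averages lie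
  between the values at the cell interfaces.
\<close>

section \<open>Smooth functions of one variable\<close>

text \<open>The one-variable counterpart of \<open>Ck\<close>. Test functions are products \<open>h t * w y\<close>, and partial
  derivatives of such a product are again products, so that smoothness in two variables reduces
  to this predicate (\<open>Ck_product\<close>).\<close>

fun Ck1 :: "nat \<Rightarrow> (real \<Rightarrow> real) \<Rightarrow> bool" where
  "Ck1 0 g \<longleftrightarrow> continuous_on UNIV g"
| "Ck1 (Suc k) g \<longleftrightarrow> (\<exists>g'. (\<forall>x. (g has_real_derivative g' x) (at x)) \<and> Ck1 k g')"

lemma Ck1_cont: "Ck1 k g \<Longrightarrow> continuous_on UNIV g"
  by (cases k) (auto intro!: continuous_at_imp_continuous_on intro: DERIV_isCont)

lemma Ck1_Suc: "Ck1 (Suc k) g \<Longrightarrow> Ck1 k g"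
proof (induction k arbitrary: g)
  case 0
  then show ?case using Ck1_cont[of 1 g] by simp
next
  case (Suc k)
  then show ?case by (metis Ck1.simps(2))
qed

lemma Ck1_const: "Ck1 k (\<lambda>x. c)"
  by (induction k arbitrary: c) (auto intro!: continuous_intros exI[of _ "\<lambda>x. 0"] derivative_eq_intros)

lemma Ck1_affine: "Ck1 k (\<lambda>x. a * x + b)"
  by (cases k) (auto intro!: continuous_intros exI[of _ "\<lambda>x. a"] Ck1_const derivative_eq_intros)

lemma Ck1_add: "Ck1 k f \<Longrightarrow> Ck1 k g \<Longrightarrow> Ck1 k (\<lambda>x. f x + g x)"
proof (induction k arbitrary: f g)
  case 0
  then show ?case by (auto intro!: continuous_intros)
next
  case (Suc k)
  then obtain f' g' where "\<forall>x. (f has_real_derivative f' x) (at x)" "Ck1 k f'"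
    "\<forall>x. (g has_real_derivative g' x) (at x)" "Ck1 k g'" by auto
  with Suc.IH show ?case
    by (auto intro!: exI[of _ "\<lambda>x. f' x + g' x"] derivative_intros)
qed

lemma Ck1_mult: "Ck1 k f \<Longrightarrow> Ck1 k g \<Longrightarrow> Ck1 k (\<lambda>x. f x * g x)"
proof (induction k arbitrary: f g)
  case 0
  then show ?case by (auto intro!: continuous_intros)
next
  case (Suc k)
  then obtain f' g' where *: "\<forall>x. (f has_real_derivative f' x) (at x)" "Ck1 k f'"
    "\<forall>x. (g has_real_derivative g' x) (at x)" "Ck1 k g'" by auto
  have "Ck1 k f" "Ck1 k g" using Suc.prems Ck1_Suc by auto
  with Suc.IH * have "Ck1 k (\<lambda>x. f' x * g x + g' x * f x)" by (intro Ck1_add) auto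
  with * show ?case
    by (auto intro!: exI[of _ "\<lambda>x. f' x * g x + g' x * f x"] derivative_intros)
qed

lemma Ck1_cmult: "Ck1 k f \<Longrightarrow> Ck1 k (\<lambda>x. c * f x)"
  by (intro Ck1_mult Ck1_const)

lemma Ck1_diff: "Ck1 k f \<Longrightarrow> Ck1 k g \<Longrightarrow> Ck1 k (\<lambda>x. f x - g x)"
  using Ck1_add[OF _ Ck1_cmult[of k g "-1"], of f] by simp

lemma Ck1_affine_arg: "Ck1 k f \<Longrightarrow> Ck1 k (\<lambda>x. f (a * x + b))"
proof (induction k arbitrary: f)
  case 0
  then show ?case by (auto intro!: continuous_on_compose2[of UNIV f] continuous_intros)
next
  case (Suc k)
  then obtain f' where *: "\<forall>x. (f has_real_derivative f' x) (at x)" "Ck1 k f'" by auto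
  have "((\<lambda>x. f (a * x + b)) has_real_derivative a * f' (a * x + b)) (at x)" for x
    by (rule DERIV_cong[OF DERIV_chain2[OF *(1)[rule_format] DERIV_add[OF DERIV_cmult_Id DERIV_const]]]) simp
  with * Suc.IH show ?case by (auto intro!: exI[of _ "\<lambda>x. a * f' (a * x + b)"] Ck1_cmult)
qed

text \<open>Every derivative of \<open>inverse f\<close> is a product of derivatives of \<open>f\<close> and powers of
  \<open>inverse f\<close>; the induction needs the same function at a lower order only.\<close>

lemma Ck1_inverse: "Ck1 k f \<Longrightarrow> (\<And>x. f x \<noteq> 0) \<Longrightarrow> Ck1 k (\<lambda>x. inverse (f x))"
proof (induction k arbitrary: f)
  case 0
  then show ?case by (auto intro!: continuous_intros)
next
  case (Suc k)
  then obtain f' where *: "\<forall>x. (f has_real_derivative f' x) (at x)" "Ck1 k f'" by auto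
  have k: "Ck1 k (\<lambda>x. inverse (f x))" using Suc Ck1_Suc by blast
  have "((\<lambda>x. inverse (f x)) has_real_derivative (-1) * f' x * (inverse (f x) * inverse (f x))) (at x)" for x
    using * Suc.prems(2)[of x] by (auto intro!: derivative_eq_intros simp: divide_simps power2_eq_square)
  with * k show ?case
    by (auto intro!: exI[of _ "\<lambda>x. (-1) * f' x * (inverse (f x) * inverse (f x))"] Ck1_mult Ck1_const simp del: mult_minus_left mult_1_left)
qed

lemma Ck1_sqrt: "Ck1 k f \<Longrightarrow> (\<And>x. f x > 0) \<Longrightarrow> Ck1 k (\<lambda>x. sqrt (f x))"
proof (induction k arbitrary: f)
  case 0
  then show ?case by (auto intro!: continuous_intros)
next
  case (Suc k)
  then obtain f' where *: "\<forall>x. (f has_real_derivative f' x) (at x)" "Ck1 k f'" by auto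
  have k: "Ck1 k (\<lambda>x. sqrt (f x))" using Suc Ck1_Suc by blast
  then have i: "Ck1 k (\<lambda>x. inverse (sqrt (f x)))"
    by (rule Ck1_inverse) (use Suc.prems(2) in \<open>auto simp: less_imp_neq[symmetric]\<close>)
  have "((\<lambda>x. sqrt (f x)) has_real_derivative 1/2 * f' x * inverse (sqrt (f x))) (at x)" for x
    using * Suc.prems(2)[of x] by (auto intro!: derivative_eq_intros simp: divide_simps)
  with * i show ?case
    by (auto intro!: exI[of _ "\<lambda>x. 1/2 * f' x * inverse (sqrt (f x))"] Ck1_mult Ck1_const
        simp del: times_divide_eq_left mult_1_left)
qed

lemma Ck1_exp: "Ck1 k f \<Longrightarrow> Ck1 k (\<lambda>x. exp (f x))"
proof (induction k arbitrary: f)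
  case 0
  then show ?case by (auto intro!: continuous_intros)
next
  case (Suc k)
  then obtain f' where *: "\<forall>x. (f has_real_derivative f' x) (at x)" "Ck1 k f'" by auto
  have k: "Ck1 k (\<lambda>x. exp (f x))" using Suc Ck1_Suc by blast
  have "((\<lambda>x. exp (f x)) has_real_derivative exp (f x) * f' x) (at x)" for x
    using * by (auto intro!: derivative_eq_intros)
  with * k show ?case by (auto intro!: exI[of _ "\<lambda>x. exp (f x) * f' x"] Ck1_mult)
qed

lemma Ck1_sin_cos: "Ck1 k sin \<and> Ck1 k cos"
proof (induction k)
  case 0
  then show ?case by (auto intro!: continuous_intros)
next
  case (Suc k)
  then have "Ck1 k (\<lambda>x. - sin x)" using Ck1_cmult[of k sin "-1"] by simp
  with Suc show ?case unfolding Ck1.simps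
    by (intro conjI exI[of _ cos] exI[of _ "\<lambda>x. - sin x"]) (auto intro!: derivative_eq_intros)
qed

lemma Ck_product: "(\<And>k. Ck1 k h) \<Longrightarrow> (\<And>k. Ck1 k w) \<Longrightarrow> Ck k (\<lambda>t y. h t * w y)"
proof (induction k arbitrary: h w)
  case 0
  have "continuous_on UNIV h" "continuous_on UNIV w" using 0 Ck1_cont by blast+
  then show ?case
    by (auto simp: split_beta intro!: continuous_intros continuous_on_compose2[of UNIV h] continuous_on_compose2[of UNIV w])
next
  case (Suc k)
  have D: "\<exists>g'. (\<forall>x. (g has_real_derivative g' x) (at x)) \<and> (\<forall>k. Ck1 k g')"
    if g: "\<And>k. Ck1 k g" for g
  proof (intro exI conjI allI)
    show d: "(g has_real_derivative deriv g x) (at x)" for x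
    proof -
      obtain g' where "\<forall>x. (g has_real_derivative g' x) (at x)" using g[of "Suc 0"] by auto
      then show ?thesis by (metis DERIV_imp_deriv)
    qed
    show "Ck1 k (deriv g)" for k
    proof -
      obtain g' where "\<forall>x. (g has_real_derivative g' x) (at x)" "Ck1 k g'" using g[of "Suc k"] by auto
      moreover from this have "g' = deriv g" by (metis DERIV_imp_deriv ext)
      ultimately show ?thesis by simp
    qed
  qed
  obtain h' where h': "\<forall>x. (h has_real_derivative h' x) (at x)" "\<forall>k. Ck1 k h'" using D Suc.prems(1) by blast
  obtain w' where w': "\<forall>x. (w has_real_derivative w' x) (at x)" "\<forall>k. Ck1 k w'" using D Suc.prems(2) by blast
  show ?case unfolding Ck.simps
  proof (intro exI conjI allI)
    show "((\<lambda>s. h s * w y) has_real_derivative h' x * w y) (at x)" for x y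
      using h' by (auto intro!: derivative_eq_intros)
    show "((\<lambda>s. h x * w s) has_real_derivative h x * w' y) (at y)" for x y
      using w' by (auto intro!: derivative_eq_intros)
    show "Ck k (\<lambda>t y. h' t * w y)" "Ck k (\<lambda>t y. h t * w' y)"
      using Suc.IH h' w' Suc.prems by auto
  qed
qed

section \<open>A smooth periodic kernel\<close>

lemma continuous_has_antiderivative:
  fixes g :: "real \<Rightarrow> real"
  assumes "continuous_on UNIV g"
  shows "\<exists>A. \<forall>x. (A has_real_derivative g x) (at x)"
  using einterval_antiderivative[of "-\<infinity>" \<infinity> g] assms
  by (auto simp: continuous_on_eq_continuous_at has_real_derivative_iff_has_vector_derivative)

lemma set_integral_antiderivative:
  assumes "\<And>x. (A has_real_derivative g x) (at x)" "continuous_on UNIV g" "a \<le> b"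
  shows "(LINT x:{a..b}|lborel. g x) = A b - A a"
  unfolding set_lebesgue_integral_def
  using assms
  by (intro integral_FTC_Icc) (auto simp: has_real_derivative_iff_has_vector_derivative[symmetric]
      intro: has_field_derivative_at_within continuous_on_subset)

lemma continuous_set_integrable:
  fixes g :: "real \<Rightarrow> real"
  assumes "continuous_on UNIV g"
  shows "set_integrable lborel {a..b} g"
  by (rule borel_integrable_atLeastAtMost') (rule continuous_on_subset[OF assms], simp)

text \<open>Increments of antiderivatives replace integrals here: a pointwise comparison of the
  derivatives is all that is needed.\<close>

lemma deriv_mono_diff:
  fixes A R :: "real \<Rightarrow> real"
  assumes "a \<le> b" "\<And>x. (A has_real_derivative g x) (at x)" "\<And>x. (R has_real_derivative r x) (at x)"
    "\<And>x. a \<le> x \<Longrightarrow> x \<le> b \<Longrightarrow> g x \<le> r x"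
  shows "A b - A a \<le> R b - R a"
proof -
  have "(\<lambda>x. R x - A x) a \<le> (\<lambda>x. R x - A x) b"
  proof (rule DERIV_nonneg_imp_nondecreasing[OF assms(1)])
    fix x assume "a \<le> x" "x \<le> b"
    then show "\<exists>y. ((\<lambda>x. R x - A x) has_real_derivative y) (at x) \<and> 0 \<le> y"
      using assms(4)[of x] by (intro exI[of _ "r x - g x"] conjI DERIV_diff assms) auto
  qed
  then show ?thesis by simp
qed

lemma periodic_integral:
  fixes g :: "real \<Rightarrow> real"
  assumes c: "continuous_on UNIV g" and p: "\<And>z. g (z + 1) = g z"
  shows "(LINT y:{0..1}|lborel. g (c - y)) = (LINT y:{0..1}|lborel. g y)"
proof -
  obtain A where A: "\<And>x. (A has_real_derivative g x) (at x)"
    using continuous_has_antiderivative[OF c] by auto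
  have "((\<lambda>x. A (x + 1) - A x) has_real_derivative 0) (at x)" for x
    by (rule DERIV_cong[OF DERIV_diff[OF DERIV_chain2[OF A DERIV_add[OF DERIV_ident DERIV_const]] A]])
       (simp add: p)
  then have "(\<lambda>x. A (x + 1) - A x) (c - 1) = (\<lambda>x. A (x + 1) - A x) 0"
    using DERIV_isconst_all[of "\<lambda>x. A (x + 1) - A x"] by blast
  moreover have "(LINT y:{0..1}|lborel. g y) = A 1 - A 0"
    by (rule set_integral_antiderivative[OF A c]) simp
  moreover have "(LINT y:{0..1}|lborel. g (c - y)) = (- A (c - 1)) - (- A (c - 0))"
  proof (rule set_integral_antiderivative)
    show "((\<lambda>y. - A (c - y)) has_real_derivative g (c - x)) (at x)" for x
      by (rule DERIV_cong[OF DERIV_minus[OF DERIV_chain2[OF A DERIV_diff[OF DERIV_const DERIV_ident]]]]) simp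
    show "continuous_on UNIV (\<lambda>y. g (c - y))"
      by (intro continuous_on_compose2[OF c] continuous_intros) auto
  qed simp
  ultimately show ?thesis by simp
qed

lemma two_le_sin_pi:
  assumes "0 \<le> z" "z \<le> 1 / 2"
  shows "2 * z \<le> sin (pi * z)"
proof -
  have "convex_on {0..pi} (\<lambda>x. - sin x)"
  proof (rule f''_ge0_imp_convex)
    show "((\<lambda>x. - sin x) has_real_derivative - cos x) (at x)" for x :: real
      by (auto intro!: derivative_eq_intros)
    show "((\<lambda>x. - cos x) has_real_derivative sin x) (at x)" for x :: real
      by (auto intro!: derivative_eq_intros)
  qed (auto simp: sin_ge_zero)
  then have "- sin ((1 - 2 * z) *\<^sub>R 0 + (2 * z) *\<^sub>R (pi / 2)) \<le> (1 - 2 * z) * - sin 0 + (2 * z) * - sin (pi / 2)"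
    by (rule convex_onD) (use assms in auto)
  then show ?thesis by (simp add: mult.commute)
qed

lemma min_le_sin_pi:
  assumes "0 \<le> z" "z \<le> 1"
  shows "2 * min z (1 - z) \<le> \<bar>sin (pi * z)\<bar>"
proof (cases "z \<le> 1 / 2")
  case True
  then show ?thesis using two_le_sin_pi[of z] assms by (auto simp: min_def)
next
  case False
  have "sin (pi * (1 - z)) = sin (pi * z)"
    by (simp add: algebra_simps sin_diff)
  then show ?thesis using two_le_sin_pi[of "1 - z"] assms False by (auto simp: min_def)
qed

text \<open>A bound on the logarithmic derivative makes the values at nearby points comparable. For
  the kernel below, with \<open>C\<close> of order \<open>1 / \<epsilon>\<close>, this covers all points at distance \<open>\<Delta>x = \<epsilon>\<^sup>2\<close>,
  which is why averages over a cell can be replaced by point values.\<close>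

lemma log_lipschitz_ratio:
  fixes g :: "real \<Rightarrow> real"
  assumes "\<And>x. (g has_real_derivative g' x) (at x)" "\<And>x. g x > 0" "\<And>x. \<bar>g' x\<bar> \<le> C * g x"
  shows "g x \<le> exp (C * \<bar>x - y\<bar>) * g y"
proof -
  have d: "((\<lambda>x. ln (g x)) has_real_derivative g' x / g x) (at x)" for x
    using assms(1,2) by (auto intro!: derivative_eq_intros)
  have "norm (ln (g x) - ln (g y)) \<le> C * norm (x - y)"
    by (rule field_differentiable_bound[of UNIV "\<lambda>x. ln (g x)" "\<lambda>x. g' x / g x"])
       (use d assms(2,3) less_imp_le[OF assms(2)] in \<open>auto simp: pos_divide_le_eq abs_divide abs_of_pos\<close>)
  then have "ln (g x) \<le> C * \<bar>x - y\<bar> + ln (g y)" by auto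
  then have "exp (ln (g x)) \<le> exp (C * \<bar>x - y\<bar> + ln (g y))" by simp
  then show ?thesis using assms(2) by (simp add: exp_add)
qed

text \<open>A periodic version of \<open>1 / (1 + \<kappa> z\<^sup>2)\<close>, of width \<open>1 / sqrt \<kappa>\<close>. The kernel is the
  normalised square of this function. The choice is made for the identity
  \<open>(1 + \<kappa> sin\<^sup>2(\<pi> z)) * bump\<^sup>2 = bump\<close>: it turns second moments of the kernel into integrals of
  \<open>bump\<close>.\<close>

definition bump :: "real \<Rightarrow> real \<Rightarrow> real" where
  "bump \<kappa> z = inverse (1 + \<kappa> * (sin (pi * z))\<^sup>2)"

lemma one_plus_pos: "\<kappa> \<ge> 0 \<Longrightarrow> 1 + \<kappa> * (x::real)\<^sup>2 > 0"
  by (simp add: add_pos_nonneg)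

lemma bump_pos: "\<kappa> \<ge> 0 \<Longrightarrow> bump \<kappa> z > 0"
  unfolding bump_def by (simp add: one_plus_pos)

lemma bump_periodic: "bump \<kappa> (z + 1) = bump \<kappa> z"
  by (simp add: bump_def algebra_simps sin_add)

lemma bump_even: "bump \<kappa> (- z) = bump \<kappa> z"
  by (simp add: bump_def)

lemma bump_smooth: assumes "\<kappa> \<ge> 0" shows "Ck1 k (bump \<kappa>)"
proof -
  have 1: "Ck1 k (\<lambda>z. sin (pi * z + 0))" using Ck1_sin_cos by (intro Ck1_affine_arg) auto
  have "Ck1 k (\<lambda>z. inverse (1 + \<kappa> * (sin (pi * z + 0) * sin (pi * z + 0))))"
    using one_plus_pos[OF assms]
    by (intro Ck1_inverse Ck1_add Ck1_const Ck1_mult 1) (metis less_irrefl power2_eq_square)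
  then show ?thesis by (simp add: bump_def[abs_def] power2_eq_square)
qed

lemma bump_deriv:
  assumes "\<kappa> \<ge> 0"
  shows "(bump \<kappa> has_real_derivative - 2 * \<kappa> * pi * sin (pi * z) * cos (pi * z) * (bump \<kappa> z)\<^sup>2) (at z)"
  unfolding bump_def[abs_def] using one_plus_pos[OF assms, of "sin (pi * z)"]
  by (auto intro!: derivative_eq_intros simp: divide_simps power2_eq_square)

text \<open>With \<open>s = \<bar>sin (\<pi> z)\<bar>\<close> the derivative is at most \<open>2 \<pi> \<kappa> s bump\<^sup>2\<close>, and
  \<open>2 sqrt \<kappa> s \<le> 1 + \<kappa> s\<^sup>2\<close> cancels one factor \<open>bump\<close>.\<close>

lemma bump_log_deriv:
  assumes "\<kappa> \<ge> 0"
  shows "\<bar>- 2 * \<kappa> * pi * sin (pi * z) * cos (pi * z) * (bump \<kappa> z)\<^sup>2\<bar> \<le> pi * sqrt \<kappa> * bump \<kappa> z"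
proof -
  define s where "s = \<bar>sin (pi * z)\<bar>"
  have q: "bump \<kappa> z > 0" "bump \<kappa> z * (1 + \<kappa> * s\<^sup>2) = 1"
    using bump_pos[OF assms] one_plus_pos[OF assms, of "sin (pi * z)"] unfolding bump_def s_def
    by (auto intro!: left_inverse simp: less_imp_neq[symmetric])
  have "0 \<le> (1 - sqrt \<kappa> * s)\<^sup>2" by simp
  then have "2 * (sqrt \<kappa> * s) \<le> 1 + \<kappa> * s\<^sup>2"
    using assms by (simp add: power2_diff power_mult_distrib)
  then have "bump \<kappa> z * (2 * (sqrt \<kappa> * s)) \<le> 1"
    using mult_left_mono[of "2 * (sqrt \<kappa> * s)" "1 + \<kappa> * s\<^sup>2" "bump \<kappa> z"] q by simp
  then have *: "pi * sqrt \<kappa> * bump \<kappa> z * (bump \<kappa> z * (2 * (sqrt \<kappa> * s))) \<le> pi * sqrt \<kappa> * bump \<kappa> z * 1"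
    using q assms by (intro mult_left_mono) auto
  have "\<bar>- 2 * \<kappa> * pi * sin (pi * z) * cos (pi * z) * (bump \<kappa> z)\<^sup>2\<bar>
     = (2 * \<kappa> * pi * s * (bump \<kappa> z)\<^sup>2) * \<bar>cos (pi * z)\<bar>"
    using assms by (simp add: abs_mult s_def)
  also have "\<dots> \<le> (2 * \<kappa> * pi * s * (bump \<kappa> z)\<^sup>2) * 1"
    using assms by (intro mult_left_mono) (auto simp: s_def)
  also have "\<dots> = pi * sqrt \<kappa> * bump \<kappa> z * (bump \<kappa> z * (2 * (sqrt \<kappa> * s)))"
    using assms by (simp add: power2_eq_square)
  also have "\<dots> \<le> pi * sqrt \<kappa> * bump \<kappa> z" using * by linarith
  finally show ?thesis .
qed

text \<open>Since \<open>\<bar>sin (\<pi> z)\<bar>\<close> is at least twice the distance of \<open>z\<close> to the integers, the function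
  lies below the sum of two Cauchy profiles, one at each end of the period; these have an
  arctangent as antiderivative.\<close>

lemma bump_integral_upper:
  assumes k: "\<kappa> \<ge> 1"
  shows "(LINT z:{0..1}|lborel. bump \<kappa> z) \<le> pi / (2 * sqrt \<kappa>)"
proof -
  have c: "continuous_on UNIV (bump \<kappa>)" using Ck1_cont[OF bump_smooth] k by simp
  obtain A where A: "\<And>x. (A has_real_derivative bump \<kappa> x) (at x)"
    using continuous_has_antiderivative[OF c] by auto
  define r where "r = (\<lambda>z. inverse (1 + (2 * sqrt \<kappa> * z)\<^sup>2))"
  define R where "R = (\<lambda>z. (arctan (2 * sqrt \<kappa> * z) - arctan (2 * sqrt \<kappa> * (1 - z))) / (2 * sqrt \<kappa>))"
  have sk: "sqrt \<kappa> > 0" using k by simp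
  have a: "((\<lambda>z. arctan (2 * sqrt \<kappa> * z)) has_real_derivative r z * (2 * sqrt \<kappa>)) (at z)" for z
    unfolding r_def
    by (rule DERIV_cong[OF DERIV_chain2[OF DERIV_arctan DERIV_cmult_Id]]) simp
  have b: "((\<lambda>z. arctan (2 * sqrt \<kappa> * (1 - z))) has_real_derivative r (1 - z) * (2 * sqrt \<kappa>) * (0 - 1)) (at z)" for z
    by (rule DERIV_chain2[OF a DERIV_diff[OF DERIV_const DERIV_ident]])
  have R: "(R has_real_derivative r x + r (1 - x)) (at x)" for x
    unfolding R_def
    by (rule DERIV_cong[OF DERIV_cdivide[OF DERIV_diff[OF a b]]]) (use sk in \<open>simp add: field_simps\<close>)
  have rpos: "r x \<ge> 0" for x by (simp add: r_def)
  have bound: "bump \<kappa> x \<le> r m" if "0 \<le> m" "2 * m \<le> \<bar>sin (pi * x)\<bar>" for x m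
  proof -
    have "(2 * m)\<^sup>2 \<le> (sin (pi * x))\<^sup>2" using that abs_le_square_iff[of "2 * m" "sin (pi * x)"] by simp
    then have "\<kappa> * (2 * m)\<^sup>2 \<le> \<kappa> * (sin (pi * x))\<^sup>2" using k by (intro mult_left_mono) auto
    moreover have "(2 * sqrt \<kappa> * m)\<^sup>2 = \<kappa> * (2 * m)\<^sup>2" using k by (simp add: power_mult_distrib)
    ultimately have "1 + (2 * sqrt \<kappa> * m)\<^sup>2 \<le> 1 + \<kappa> * (sin (pi * x))\<^sup>2" by simp
    then show ?thesis unfolding bump_def r_def
      by (intro le_imp_inverse_le) (auto simp: add_pos_nonneg)
  qed
  have "A 1 - A 0 \<le> R 1 - R 0"
  proof (rule deriv_mono_diff[OF _ A R])
    fix x :: real assume x: "0 \<le> x" "x \<le> 1"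
    show "bump \<kappa> x \<le> r x + r (1 - x)"
    proof (cases "x \<le> 1 - x")
      case True
      then show ?thesis using bound[of x x] min_le_sin_pi[OF x] x rpos[of "1 - x"] by (simp add: min_def)
    next
      case False
      then show ?thesis using bound[of "1 - x" x] min_le_sin_pi[OF x] x rpos[of x] by (simp add: min_def)
    qed
  qed simp
  also have "R 1 - R 0 = 2 * arctan (2 * sqrt \<kappa>) / (2 * sqrt \<kappa>)"
    by (simp add: R_def diff_divide_distrib)
  also have "\<dots> \<le> pi / (2 * sqrt \<kappa>)"
    using arctan_ubound[of "2 * sqrt \<kappa>"] sk by (intro divide_right_mono) auto
  finally show ?thesis using set_integral_antiderivative[OF A c, of 0 1] by simp
qed

text \<open>On an interval of length \<open>1 / sqrt \<kappa>\<close> the function is bounded below by a constant.\<close>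

lemma bump_sq_integral_lower:
  assumes k: "\<kappa> \<ge> 1"
  shows "(LINT z:{0..1}|lborel. (bump \<kappa> z)\<^sup>2) \<ge> (inverse (1 + pi\<^sup>2))\<^sup>2 / sqrt \<kappa>"
proof -
  have c: "continuous_on UNIV (\<lambda>z. (bump \<kappa> z)\<^sup>2)"
    using Ck1_cont[OF bump_smooth] k by (intro continuous_intros) auto
  obtain A where A: "\<And>x. (A has_real_derivative (bump \<kappa> x)\<^sup>2) (at x)"
    using continuous_has_antiderivative[OF c] by auto
  define e where "e = 1 / sqrt \<kappa>"
  have e: "0 < e" "e \<le> 1" "\<kappa> * e\<^sup>2 = 1" using k by (auto simp: e_def divide_simps power_divide)
  define m where "m = (inverse (1 + pi\<^sup>2))\<^sup>2"
  have "(\<lambda>x. m * x) e - (\<lambda>x. m * x) 0 \<le> A e - A 0"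
  proof (rule deriv_mono_diff[OF _ _ A])
    show "((*) m has_real_derivative m) (at x)" for x by (auto intro!: derivative_eq_intros)
    fix x assume x: "0 \<le> x" "x \<le> e"
    have "\<bar>sin (pi * x)\<bar> \<le> \<bar>pi * x\<bar>" by (rule abs_sin_x_le_abs_x)
    then have "(sin (pi * x))\<^sup>2 \<le> (pi * x)\<^sup>2" by (simp add: abs_le_square_iff)
    also have "\<dots> \<le> (pi * e)\<^sup>2" using x by (intro power_mono mult_left_mono) auto
    finally have "\<kappa> * (sin (pi * x))\<^sup>2 \<le> \<kappa> * (pi * e)\<^sup>2" using k by (intro mult_left_mono) auto
    also have "\<dots> = pi\<^sup>2" using e(3) by (simp add: power_mult_distrib)
    finally have "inverse (1 + pi\<^sup>2) \<le> bump \<kappa> x" unfolding bump_def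
      using k by (intro le_imp_inverse_le one_plus_pos) auto
    then show "m \<le> (bump \<kappa> x)\<^sup>2" unfolding m_def by (intro power_mono) (auto simp: add_nonneg_nonneg)
  qed (use e in auto)
  also have "A e \<le> A 1"
    using deriv_mono_diff[of e 1 "\<lambda>x. 0" "\<lambda>x. 0" A, OF e(2) _ A] by simp
  finally show ?thesis using set_integral_antiderivative[OF A c, of 0 1]
    by (simp add: m_def e_def)
qed

text \<open>The kernel \<open>\<omega>\<close> together with an antiderivative \<open>\<Omega>\<close>, the derivative \<open>\<omega>\<^sup>\<prime>\<close> and the heavier
  kernel \<open>\<rho>\<close>, which is \<open>\<omega>\<close> with a second moment built in. With width \<open>\<epsilon> = 1 / sqrt N\<close>, \<open>\<rho>\<close>
  dominates \<open>\<omega>\<close> and its moments, so that its integral controls the error terms of the doubling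
  argument. The relation \<open>\<Omega> (z + 1) = \<Omega> z + 1\<close> says that \<open>\<omega>\<close> has integral one over a period.\<close>

definition kernel_pair :: "nat \<Rightarrow> real \<Rightarrow> (real \<Rightarrow> real) \<Rightarrow> (real \<Rightarrow> real) \<Rightarrow> (real \<Rightarrow> real) \<Rightarrow> (real \<Rightarrow> real) \<Rightarrow> bool" where
  "kernel_pair N G \<Omega> \<omega> \<omega>' \<rho> \<longleftrightarrow>
     (\<forall>k. Ck1 k \<Omega>) \<and> (\<forall>x. (\<Omega> has_real_derivative \<omega> x) (at x)) \<and> (\<forall>x. (\<omega> has_real_derivative \<omega>' x) (at x)) \<and>
     (\<forall>z. \<omega> z > 0) \<and> (\<forall>z. \<omega> (z + 1) = \<omega> z) \<and> (\<forall>z. \<omega> (- z) = \<omega> z) \<and> (\<forall>z. \<Omega> (z + 1) = \<Omega> z + 1) \<and>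
     (\<forall>z. \<bar>\<omega>' z\<bar> \<le> G * sqrt N * \<omega> z) \<and> 
     (\<forall>x y. \<bar>x - y\<bar> \<le> 1 / N \<longrightarrow> \<omega> x \<le> G * \<omega> y \<and> \<rho> x \<le> G * \<rho> y) \<and>
     continuous_on UNIV \<rho> \<and> (\<forall>z. \<rho> (z + 1) = \<rho> z) \<and> (\<forall>z. \<rho> z = (1 + N * (sin (pi * z))\<^sup>2) * \<omega> z) \<and>
     (LINT z:{0..1}|lborel. \<rho> z) \<le> G"

text \<open>The constant does not depend on \<open>N\<close>: the normalising integral and the integral of \<open>bump\<close>
  are both of the order \<open>1 / sqrt N\<close>.\<close>

lemma kernel_exists:
  "\<exists>G\<ge>1. \<forall>N>0. \<exists>\<Omega> \<omega> \<omega>' \<rho>. kernel_pair N G \<Omega> \<omega> \<omega>' \<rho>"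
proof -
  \<comment> \<open>the first entry serves the comparison at distance \<open>1 / N\<close>, the second the integral of \<open>\<rho>\<close>\<close>
  define G where "G = max (exp (2 * pi)) ((pi / 2) * (1 + pi\<^sup>2)\<^sup>2)"
  have expge: "exp (2 * pi) \<ge> 1 + 2 * pi" by (rule exp_ge_add_one_self)
  have G: "G \<ge> exp (2 * pi)" "G \<ge> 2 * pi" "G \<ge> 1" "G \<ge> (pi / 2) * (1 + pi\<^sup>2)\<^sup>2"
    using expge pi_gt_zero unfolding G_def by linarith+
  have "\<exists>\<Omega> \<omega> \<omega>' \<rho>. kernel_pair N G \<Omega> \<omega> \<omega>' \<rho>" if N: "N > 0" for N :: nat
  proof -
    define \<kappa> where "\<kappa> = real N"
    have k: "\<kappa> \<ge> 1" "\<kappa> \<ge> 0" "\<kappa> > 0" using N by (auto simp: \<kappa>_def)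
    let ?q = "bump \<kappa>"
    define q' where "q' = (\<lambda>z. - 2 * \<kappa> * pi * sin (pi * z) * cos (pi * z) * (bump \<kappa> z)\<^sup>2)"
    have dq: "(?q has_real_derivative q' z) (at z)" for z unfolding q'_def using bump_deriv[OF k(2)] .
    have q'b: "\<bar>q' z\<bar> \<le> pi * sqrt \<kappa> * ?q z" for z unfolding q'_def using bump_log_deriv[OF k(2)] .
    have qp: "?q z > 0" for z using bump_pos k by simp
    have qc: "continuous_on UNIV ?q" using Ck1_cont[OF bump_smooth] k by simp
    define Z where "Z = (LINT z:{0..1}|lborel. (?q z)\<^sup>2)"
    have Zl: "Z \<ge> (inverse (1 + pi\<^sup>2))\<^sup>2 / sqrt \<kappa>" unfolding Z_def using bump_sq_integral_lower[OF k(1)] .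
    have pp: "1 + pi\<^sup>2 > 0" by (simp add: add_pos_nonneg)
    then have "(inverse (1 + pi\<^sup>2))\<^sup>2 / sqrt \<kappa> > 0" using k(3) by simp
    then have Zp: "Z > 0" using Zl by linarith
    define \<omega> where "\<omega> = (\<lambda>z. (?q z)\<^sup>2 / Z)"
    define \<omega>' where "\<omega>' = (\<lambda>z. 2 * ?q z * q' z / Z)"
    define \<rho> where "\<rho> = (\<lambda>z. ?q z / Z)"
    have c: "continuous_on UNIV \<omega>" unfolding \<omega>_def using qc Zp by (intro continuous_intros) auto
    obtain \<Omega> where O: "\<And>x. (\<Omega> has_real_derivative \<omega> x) (at x)"
      using continuous_has_antiderivative[OF c] by auto
    have dw: "(\<omega> has_real_derivative \<omega>' x) (at x)" for x
      unfolding \<omega>_def \<omega>'_def using Zp dq by (auto intro!: derivative_eq_intros)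
    have wp: "\<omega> z > 0" for z unfolding \<omega>_def using qp[of z] Zp by simp
    have per: "\<omega> (z + 1) = \<omega> z" "\<rho> (z + 1) = \<rho> z" for z by (auto simp: \<omega>_def \<rho>_def bump_periodic)
    have sm: "Ck1 k \<omega>" for k
    proof -
      have "Ck1 k (\<lambda>z. inverse Z * (?q z * ?q z))" using k by (intro Ck1_cmult Ck1_mult bump_smooth)
      then show ?thesis by (simp add: \<omega>_def power2_eq_square divide_inverse mult.commute)
    qed
    have smO: "Ck1 k \<Omega>" for k using sm[of k] O Ck1_Suc[of k \<Omega>] by auto
    have "(LINT z:{0..1}|lborel. \<omega> z) = (LINT z:{0..1}|lborel. (?q z)\<^sup>2) / Z"
      unfolding \<omega>_def by simp
    also have "\<dots> = 1" using Zp by (simp add: Z_def)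
    finally have O1: "\<Omega> 1 - \<Omega> 0 = 1" using set_integral_antiderivative[OF O c, of 0 1] by simp
    have "((\<lambda>x. \<Omega> (x + 1) - \<Omega> x) has_real_derivative 0) (at x)" for x
      by (rule DERIV_cong[OF DERIV_diff[OF DERIV_chain2[OF O DERIV_add[OF DERIV_ident DERIV_const]] O]])
         (simp add: per)
    then have "(\<lambda>x. \<Omega> (x + 1) - \<Omega> x) z = (\<lambda>x. \<Omega> (x + 1) - \<Omega> x) 0" for z
      using DERIV_isconst_all[of "\<lambda>x. \<Omega> (x + 1) - \<Omega> x"] by blast
    then have Oper: "\<Omega> (z + 1) = \<Omega> z + 1" for z using O1 by smt
    have wb: "\<bar>\<omega>' z\<bar> \<le> (2 * pi * sqrt \<kappa>) * \<omega> z" for z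
    proof -
      have "\<bar>\<omega>' z\<bar> = 2 * ?q z / Z * \<bar>q' z\<bar>" using Zp qp[of z] by (simp add: \<omega>'_def abs_mult)
      also have "\<dots> \<le> 2 * ?q z / Z * (pi * sqrt \<kappa> * ?q z)"
        using Zp qp[of z] q'b[of z] by (intro mult_left_mono) auto
      also have "\<dots> = (2 * pi * sqrt \<kappa>) * \<omega> z" by (simp add: \<omega>_def power2_eq_square)
      finally show ?thesis .
    qed
    have dr: "(\<rho> has_real_derivative q' x / Z) (at x)" for x
      unfolding \<rho>_def using dq Zp by (auto intro!: derivative_eq_intros)
    have rp: "\<rho> z > 0" for z unfolding \<rho>_def using qp[of z] Zp by simp
    have rb: "\<bar>q' z / Z\<bar> \<le> (2 * pi * sqrt \<kappa>) * \<rho> z" for z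
    proof -
      have "\<bar>q' z / Z\<bar> \<le> (pi * sqrt \<kappa>) * \<rho> z"
        using q'b[of z] Zp by (simp add: \<rho>_def divide_right_mono)
      also have "\<dots> \<le> (2 * pi * sqrt \<kappa>) * \<rho> z"
        using rp[of z] k by (intro mult_right_mono) auto
      finally show ?thesis .
    qed
    have ex: "exp ((2 * pi * sqrt \<kappa>) * \<bar>x - y\<bar>) \<le> G" if "\<bar>x - y\<bar> \<le> 1 / N" for x y
    proof -
      have "sqrt \<kappa> * \<bar>x - y\<bar> \<le> sqrt \<kappa> * (1 / \<kappa>)" using that k by (intro mult_left_mono) (auto simp: \<kappa>_def)
      also have "\<dots> = 1 / sqrt \<kappa>" using k by (simp add: field_simps)
      also have "\<dots> \<le> 1" using k by simp
      finally have "2 * pi * (sqrt \<kappa> * \<bar>x - y\<bar>) \<le> 2 * pi * 1" by (intro mult_left_mono) auto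
      then have "exp ((2 * pi * sqrt \<kappa>) * \<bar>x - y\<bar>) \<le> exp (2 * pi)" by (simp add: mult.assoc)
      then show ?thesis using G by linarith
    qed
    have nb: "\<omega> x \<le> G * \<omega> y \<and> \<rho> x \<le> G * \<rho> y" if "\<bar>x - y\<bar> \<le> 1 / N" for x y
    proof
      show "\<omega> x \<le> G * \<omega> y"
        by (rule order_trans[OF log_lipschitz_ratio[OF dw wp wb] mult_right_mono[OF ex[OF that]]])
           (rule less_imp_le[OF wp])
      show "\<rho> x \<le> G * \<rho> y"
        by (rule order_trans[OF log_lipschitz_ratio[OF dr rp rb] mult_right_mono[OF ex[OF that]]])
           (rule less_imp_le[OF rp])
    qed
    have rw: "\<rho> z = (1 + N * (sin (pi * z))\<^sup>2) * \<omega> z" for z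
    proof -
      have "?q z * (1 + N * (sin (pi * z))\<^sup>2) = 1"
        using one_plus_pos[OF k(2), of "sin (pi * z)"] by (simp add: bump_def \<kappa>_def)
      then show ?thesis unfolding \<rho>_def \<omega>_def power2_eq_square by (simp add: mult_ac)
    qed
    have "(LINT z:{0..1}|lborel. \<rho> z) = (LINT z:{0..1}|lborel. ?q z) / Z"
      unfolding \<rho>_def by simp
    also have "\<dots> \<le> (pi / (2 * sqrt \<kappa>)) / Z"
      using bump_integral_upper[OF k(1)] Zp by (intro divide_right_mono) auto
    also have "\<dots> \<le> (pi / (2 * sqrt \<kappa>)) / ((inverse (1 + pi\<^sup>2))\<^sup>2 / sqrt \<kappa>)"
      using Zl Zp k pp by (intro divide_left_mono) auto
    also have "\<dots> = (pi / 2) * (1 + pi\<^sup>2)\<^sup>2"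
    proof -
      have "(pi / (2 * r)) / ((inverse p)\<^sup>2 / r) = (pi / 2) * p\<^sup>2" if "p > 0" "r > 0" for p r :: real
        using that by (simp add: field_simps power2_eq_square)
      from this[OF pp, of "sqrt \<kappa>"] show ?thesis using k by simp
    qed
    also have "\<dots> \<le> G" by (rule G)
    finally have ri: "(LINT z:{0..1}|lborel. \<rho> z) \<le> G" .
    have wb': "\<bar>\<omega>' z\<bar> \<le> G * sqrt N * \<omega> z" for z
    proof -
      have "(2 * pi * sqrt \<kappa>) * \<omega> z \<le> (G * sqrt \<kappa>) * \<omega> z"
        using G wp[of z] k by (intro mult_right_mono) auto
      then show ?thesis using wb[of z] by (simp add: \<kappa>_def)
    qed
    have rc: "continuous_on UNIV \<rho>" unfolding \<rho>_def using qc Zp by (intro continuous_intros) auto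
    have ev: "\<omega> (- z) = \<omega> z" for z by (simp add: \<omega>_def bump_even)
    have "kernel_pair N G \<Omega> \<omega> \<omega>' \<rho>" unfolding kernel_pair_def
      by (intro conjI allI impI; (fact smO O dw wp per Oper wb' rc rw ri ev | erule nb[THEN conjunct1] | erule nb[THEN conjunct2]))
    then show ?thesis by blast
  qed
  with G(3) show ?thesis by blast
qed

section \<open>The monotone scheme\<close>

lemma MVT_between:
  fixes g :: "real \<Rightarrow> real"
  assumes "\<And>x. (g has_real_derivative g' x) (at x)"
  obtains \<xi> where "min a b \<le> \<xi>" "\<xi> \<le> max a b" "g b - g a = (b - a) * g' \<xi>"
proof (cases a b rule: linorder_cases)
  case less
  then obtain z where "a < z" "z < b" "g b - g a = (b - a) * g' z" using MVT2[of a b g g'] assms by auto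
  then show ?thesis using that[of z] by auto
next
  case equal
  then show ?thesis using that[of a] by auto
next
  case greater
  then obtain z where "b < z" "z < a" "g a - g b = (a - b) * g' z" using MVT2[of b a g g'] assms by auto
  then show ?thesis using that[of z] by (auto simp: algebra_simps)
qed

lemma sum_linear:
  "(\<Sum>j\<in>S. A j + l * (p * B j + q * C j + c) + t * D j)
    = sum A S + l * (p * sum B S + q * sum C S + real (card S) * c) + t * (sum D S :: real)"
  by (simp only: sum.distrib sum_distrib_left[symmetric] sum_constant)

lemma abs_le3: "x = - A - C + D \<Longrightarrow> \<bar>A\<bar> \<le> p \<Longrightarrow> \<bar>C\<bar> \<le> q \<Longrightarrow> \<bar>D\<bar> \<le> r \<Longrightarrow> \<bar>x\<bar> \<le> p + q + (r::real)"
  by linarith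

lemma abs_le3': "\<bar>A\<bar> \<le> p \<Longrightarrow> \<bar>D\<bar> = r \<Longrightarrow> \<bar>x - A + D\<bar> \<le> \<bar>x\<bar> + p + (r::real)"
  by linarith

text \<open>The structural properties of the flux with one common constant \<open>L\<close>. The mixed condition
  \<open>F_xlip\<close> expresses that \<open>F\<^sub>x\<close> is Lipschitz in the states.\<close>

locale flux_setting =
  fixes F :: "real \<Rightarrow> real \<Rightarrow> real \<Rightarrow> real" and f fx :: "real \<Rightarrow> real \<Rightarrow> real" and L T cf :: real
  assumes L1: "L \<ge> 1" and T_pos: "T > 0" and cf_pos: "cf > 0"
    and F_per: "\<And>x v w. F (x + 1) v w = F x v w"
    and F_cons: "\<And>x v. F x v v = f x v"
    and F_lip: "\<And>x v w v' w'. \<bar>F x v w - F x v' w'\<bar> \<le> L * (\<bar>v - v'\<bar> + \<bar>w - w'\<bar>)"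
    and F_xlip: "\<And>x y v w v' w'. \<bar>(F x v w - F y v w) - (F x v' w' - F y v' w')\<bar>
        \<le> L * \<bar>x - y\<bar> * (\<bar>v - v'\<bar> + \<bar>w - w'\<bar>)"
    and f_dx: "\<And>x v. ((\<lambda>s. f s v) has_real_derivative fx x v) (at x)"
    and fx_bound: "\<And>x v. \<bar>fx x v\<bar> \<le> L * (1 + \<bar>v\<bar>)"
    and fx_lip: "\<And>x v v'. \<bar>fx x v - fx x v'\<bar> \<le> L * \<bar>v - v'\<bar>"
    and f_cont: "continuous_on UNIV (\<lambda>p. f (fst p) (snd p))"
    and fx_cont: "continuous_on UNIV (\<lambda>p. fx (fst p) (snd p))"
    and CFL: "CFL_const F T cf"
begin

lemma f_lip: "\<bar>f x v - f x v'\<bar> \<le> 2 * L * \<bar>v - v'\<bar>"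
  using F_lip[of x v v v' v'] by (simp add: F_cons)

lemma f_per: "f (x + 1) v = f x v"
  using F_per[of x v v] by (simp add: F_cons)

end

locale mesh = flux_setting +
  fixes N M :: nat
  assumes N_pos: "N > 0" and M_pos: "M > 0" and dt_le: "dt T M \<le> cf * dx N"
begin

abbreviation "h \<equiv> dx N"
abbreviation "\<tau> \<equiv> dt T M"
abbreviation "X \<equiv> iface N"

lemma h_pos: "h > 0" using N_pos by (simp add: dx_def)
lemma h_le1: "h \<le> 1" using N_pos by (simp add: dx_def)
lemma N_h: "real N * h = 1" using N_pos by (simp add: dx_def)
lemma tau_pos: "\<tau> > 0" using T_pos by (simp add: dt_def)
lemma lam_h: "lam T N M * h = \<tau>" using h_pos by (simp add: lam_def)
lemma lam_pos: "lam T N M > 0" using h_pos tau_pos by (simp add: lam_def)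
lemma X_Suc: "X (Suc j) = X j + h" by (simp add: iface_def algebra_simps)
lemma X_0: "X 0 = 0" by (simp add: iface_def)
lemma X_N: "X N = 1" using N_h by (simp add: iface_def)
lemma X_pred: "j \<ge> 1 \<Longrightarrow> X (j - 1) = X j - h" by (cases j) (auto simp: X_Suc)

lemma per_in: "j \<in> {1..N} \<Longrightarrow> per N v j = v j" by (auto simp: per_def)
lemma per_0: "per N v 0 = v N" by (simp add: per_def)
lemma per_1: "per N v (Suc 0) = v 1" using N_pos by (simp add: per_def)
lemma per_SucN: "per N v (Suc N) = v 1" by (simp add: per_def)

definition right :: "nat \<Rightarrow> nat" where "right j = (if j = N then 1 else Suc j)"

lemma sum_right: "(\<Sum>j\<in>{1..N}. g (right j)) = (\<Sum>j\<in>{1..N}. g j)" for g :: "nat \<Rightarrow> real"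
proof (rule sum.reindex_bij_betw)
  show "bij_betw right {1..N} {1..N}"
    by (rule bij_betw_byWitness[where f' = "\<lambda>j. if j = 1 then N else j - 1"])
      (use N_pos in \<open>auto simp: right_def split: if_splits\<close>)
qed

lemma per_right: "j \<in> {1..N} \<Longrightarrow> per N v (Suc j) = v (right j)"
  by (auto simp: per_def right_def)

lemma right_in: "j \<in> {1..N} \<Longrightarrow> right j \<in> {1..N}" using N_pos by (auto simp: right_def)

lemma sum_diff_pred: "(\<Sum>j\<in>{1..N}. g j - g (j - 1)) = g N - g 0" for g :: "nat \<Rightarrow> real"
  by (induction N) auto

definition TV :: "(nat \<Rightarrow> real) \<Rightarrow> real" where
  "TV v = (\<Sum>j\<in>{1..N}. \<bar>v (right j) - v j\<bar>)"

lemma TV_nonneg: "TV v \<ge> 0" by (simp add: TV_def sum_nonneg)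

text \<open>The numerical Kruzkov entropy flux: the difference of the fluxes at the maximum and at the
  minimum of the two states.\<close>

definition eflux_at :: "real \<Rightarrow> real \<Rightarrow> real \<Rightarrow> real \<Rightarrow> real \<Rightarrow> real" where
  "eflux_at x b c b' c' = F x (max b b') (max c c') - F x (min b b') (min c c')"

abbreviation "Psij \<equiv> Psi F T N M"

lemma Psi_mono:
  assumes "j \<in> {1..N}" "a \<le> a'" "b \<le> b'" "c \<le> c'"
  shows "Psij j a b c \<le> Psij j a' b' c'"
proof -
  have "\<forall>j\<in>{1..N}. (\<forall>b c. mono (\<lambda>a. Psij j a b c)) \<and> (\<forall>a c. mono (\<lambda>b. Psij j a b c)) \<and> (\<forall>a b. mono (\<lambda>c. Psij j a b c))"
    using CFL[unfolded CFL_const_def, rule_format, of N M] N_pos M_pos dt_le by simp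
  from bspec[OF this assms(1)]
  have *: "mono (\<lambda>a. Psij j a b c)" "mono (\<lambda>b. Psij j a b c)" "mono (\<lambda>c. Psij j a b c)" for a b c
    by simp_all
  have "Psij j a b c \<le> Psij j a' b c" using monoD[OF *(1) assms(2)] .
  also have "\<dots> \<le> Psij j a' b' c" using monoD[OF *(2) assms(3)] .
  also have "\<dots> \<le> Psij j a' b' c'" using monoD[OF *(3) assms(4)] .
  finally show ?thesis .
qed

text \<open>Monotonicity bounds the distance of two images by the difference of the images of the
  maximum and the minimum; that difference is explicit. Taking constant second arguments gives
  the entropy inequality of the scheme, taking another solution gives the contraction property.\<close>

lemma Psi_compare:
  assumes "j \<in> {1..N}"
  shows "\<bar>Psij j a b c - Psij j a' b' c'\<bar>
    \<le> \<bar>b - b'\<bar> - lam T N M * (eflux_at (X j) b c b' c' - eflux_at (X (j - 1)) a b a' b')"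
proof -
  let ?P = "Psij j (max a a') (max b b') (max c c')" and ?p = "Psij j (min a a') (min b b') (min c c')"
  have "Psij j a b c \<le> ?P" "Psij j a' b' c' \<le> ?P" "?p \<le> Psij j a b c" "?p \<le> Psij j a' b' c'"
    using assms by (auto intro!: Psi_mono)
  then have "\<bar>Psij j a b c - Psij j a' b' c'\<bar> \<le> ?P - ?p" by linarith
  also have "\<dots> = (max b b' - min b b') - lam T N M * (eflux_at (X j) b c b' c' - eflux_at (X (j - 1)) a b a' b')"
    by (simp add: Psi_def eflux_at_def algebra_simps)
  also have "max b b' - min b b' = \<bar>b - b'\<bar>" by (auto simp: max_def min_def)
  finally show ?thesis .
qed

lemma Psi_const: "Psij j k k k = k - lam T N M * (f (X j) k - f (X (j - 1)) k)"
  by (simp add: Psi_def F_cons)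

abbreviation "step \<equiv> fv_step F T N M"

lemma step_Psi:
  assumes "j \<in> {1..N}"
  shows "step v j = Psij j (per N v (j - 1)) (v j) (v (right j)) + \<tau> * P_disc N v j"
  using assms per_in[OF assms] by (simp add: fv_step_def Psi_def per_right)

definition eflux :: "(nat \<Rightarrow> real) \<Rightarrow> (nat \<Rightarrow> real) \<Rightarrow> nat \<Rightarrow> real" where
  "eflux v v' j = eflux_at (X j) (per N v j) (per N v (Suc j)) (per N v' j) (per N v' (Suc j))"

lemma F_X_N: "F (X N) a b = F (X 0) a b" using F_per[of 0] by (simp add: X_N X_0)

lemma eflux_N: "eflux v v' N = eflux v v' 0"
  using per_in[of N] N_pos by (simp add: eflux_def eflux_at_def F_X_N per_0 per_1 per_SucN)

lemma Psi_compare_vec: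
  assumes "j \<in> {1..N}"
  shows "\<bar>Psij j (per N v (j - 1)) (v j) (v (right j)) - Psij j (per N v' (j - 1)) (v' j) (v' (right j))\<bar>
    \<le> \<bar>v j - v' j\<bar> - lam T N M * (eflux v v' j - eflux v v' (j - 1))"
proof -
  have "eflux v v' (j - 1) = eflux_at (X (j - 1)) (per N v (j - 1)) (v j) (per N v' (j - 1)) (v' j)"
    using assms by (cases j) (auto simp: eflux_def per_def)
  moreover have "eflux v v' j = eflux_at (X j) (v j) (v (right j)) (v' j) (v' (right j))"
    unfolding eflux_def using per_in[OF assms] per_right[OF assms] by simp
  ultimately show ?thesis
    using Psi_compare[OF assms, of "per N v (j - 1)" "v j" "v (right j)" "per N v' (j - 1)" "v' j" "v' (right j)"]
    by simp
qed

text \<open>The entropy fluxes telescope over the periodic grid.\<close>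

lemma Psi_contraction:
  "(\<Sum>j\<in>{1..N}. \<bar>Psij j (per N v (j - 1)) (v j) (v (right j)) - Psij j (per N v' (j - 1)) (v' j) (v' (right j))\<bar>)
    \<le> (\<Sum>j\<in>{1..N}. \<bar>v j - v' j\<bar>)"
proof -
  have "(\<Sum>j\<in>{1..N}. \<bar>Psij j (per N v (j - 1)) (v j) (v (right j)) - Psij j (per N v' (j - 1)) (v' j) (v' (right j))\<bar>)
    \<le> (\<Sum>j\<in>{1..N}. \<bar>v j - v' j\<bar> - lam T N M * (eflux v v' j - eflux v v' (j - 1)))"
    by (intro sum_mono Psi_compare_vec)
  also have "\<dots> = (\<Sum>j\<in>{1..N}. \<bar>v j - v' j\<bar>) - lam T N M * (\<Sum>j\<in>{1..N}. eflux v v' j - eflux v v' (j - 1))"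
    by (simp only: sum_subtractf sum_distrib_left[symmetric])
  finally show ?thesis unfolding sum_diff_pred by (simp add: eflux_N)
qed

text \<open>Both the source and the defect of the constant state, which is not stationary because \<open>f\<close>
  depends on \<open>x\<close>, enter with the sign of the new value \<open>step v j - k\<close>. The sign of the old value
  would not do; this asymmetry is what later forces the averaging over time shifts.\<close>

lemma cell_entropy:
  assumes "j \<in> {1..N}"
  shows "\<bar>step v j - k\<bar> \<le> \<bar>v j - k\<bar> - lam T N M * (eflux v (\<lambda>_. k) j - eflux v (\<lambda>_. k) (j - 1))
     + sgn (step v j - k) * (\<tau> * P_disc N v j - lam T N M * (f (X j) k - f (X (j - 1)) k))"
proof -
  have pk: "per N (\<lambda>_. k) i = k" for i by (simp add: per_def)
  let ?A = "Psij j (per N v (j - 1)) (v j) (v (right j)) - Psij j k k k"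
  let ?c = "\<tau> * P_disc N v j - lam T N M * (f (X j) k - f (X (j - 1)) k)"
  let ?s = "sgn (step v j - k)"
  have e: "step v j - k = ?A + ?c" by (simp add: step_Psi[OF assms] Psi_const)
  have "\<bar>step v j - k\<bar> = ?s * (step v j - k)" by (simp add: abs_sgn mult.commute)
  then have 1: "\<bar>step v j - k\<bar> = ?s * ?A + ?s * ?c" by (simp only: e distrib_left)
  have 2: "?s * ?A \<le> \<bar>?A\<bar>" by (auto simp: sgn_if)
  have 3: "\<bar>?A\<bar> \<le> \<bar>v j - k\<bar> - lam T N M * (eflux v (\<lambda>_. k) j - eflux v (\<lambda>_. k) (j - 1))"
    using Psi_compare_vec[OF assms, of v "\<lambda>_. k"] by (simp add: pk)
  show ?thesis using 1 2 3 by linarith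
qed

lemma f_diff_bound: "\<bar>f x v - f y v\<bar> \<le> L * (1 + \<bar>v\<bar>) * \<bar>x - y\<bar>"
proof -
  obtain z where "f x v - f y v = (x - y) * fx z v"
    using MVT_between[of "\<lambda>s. f s v" "\<lambda>s. fx s v" y x] f_dx by metis
  then have "\<bar>f x v - f y v\<bar> = \<bar>fx z v\<bar> * \<bar>x - y\<bar>" by (simp add: abs_mult mult.commute)
  also have "\<dots> \<le> L * (1 + \<bar>v\<bar>) * \<bar>x - y\<bar>" by (intro mult_right_mono fx_bound) auto
  finally show ?thesis .
qed

lemma partial_sum_bound:
  assumes "\<And>j. j \<in> {1..N} \<Longrightarrow> \<bar>v j\<bar> \<le> m" "j \<in> {1..N}"
  shows "\<bar>(\<Sum>i\<in>{1..<j}. v i) + v j / 2\<bar> \<le> real N * m"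
proof -
  have m: "m \<ge> 0" using assms(1)[OF assms(2)] by linarith
  have "\<bar>\<Sum>i\<in>{1..<j}. v i\<bar> \<le> (\<Sum>i\<in>{1..<j}. m)"
    by (rule order_trans[OF sum_abs sum_mono]) (use assms in auto)
  also have "\<dots> = (real j - 1) * m" using assms(2) by (auto simp: of_nat_diff)
  finally have "\<bar>\<Sum>i\<in>{1..<j}. v i\<bar> \<le> (real j - 1) * m" .
  moreover have "\<bar>v j / 2\<bar> \<le> m" using assms(1)[OF assms(2)] by simp
  ultimately have "\<bar>(\<Sum>i\<in>{1..<j}. v i) + v j / 2\<bar> \<le> (real j - 1) * m + m" by linarith
  also have "\<dots> = real j * m" by (simp add: algebra_simps)
  also have "\<dots> \<le> real N * m" using assms(2) m by (intro mult_right_mono) auto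
  finally show ?thesis .
qed

lemma P_disc_bound:
  assumes "\<And>j. j \<in> {1..N} \<Longrightarrow> \<bar>v j\<bar> \<le> m" "j \<in> {1..N}"
  shows "\<bar>P_disc N v j\<bar> \<le> 2 * m"
proof -
  let ?S = "\<lambda>j. (\<Sum>i\<in>{1..<j}. v i) + v j / 2"
  have *: "\<bar>h * ?S j\<bar> \<le> m" if "j \<in> {1..N}" for j
  proof -
    have "\<bar>h * ?S j\<bar> = h * \<bar>?S j\<bar>" using h_pos by (simp add: abs_mult)
    also have "\<dots> \<le> h * (real N * m)"
      by (intro mult_left_mono partial_sum_bound[OF assms(1) that] less_imp_le[OF h_pos])
    also have "\<dots> = (real N * h) * m" by simp
    also have "\<dots> = m" unfolding N_h by simp
    finally show ?thesis .
  qed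
  have "\<bar>h\<^sup>2 * (\<Sum>l\<in>{1..N}. ?S l)\<bar> = h * \<bar>\<Sum>l\<in>{1..N}. h * ?S l\<bar>"
    using h_pos by (simp add: sum_distrib_left[symmetric] abs_mult power2_eq_square)
  also have "\<dots> \<le> h * (\<Sum>l\<in>{1..N}. m)"
    using h_pos by (intro mult_left_mono order_trans[OF sum_abs sum_mono] *) auto
  also have "\<dots> = (real N * h) * m" by simp
  also have "\<dots> = m" unfolding N_h by simp
  finally have "\<bar>h\<^sup>2 * (\<Sum>l\<in>{1..N}. ?S l)\<bar> \<le> m" .
  then show ?thesis using *[OF assms(2)] unfolding P_disc_def by linarith
qed

lemma f_X_diff: "j \<ge> 1 \<Longrightarrow> \<bar>v\<bar> \<le> m \<Longrightarrow> \<bar>lam T N M * (f (X j) v - f (X (j - 1)) v)\<bar> \<le> \<tau> * (L * (1 + m))"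
proof -
  assume j: "j \<ge> 1" and v: "\<bar>v\<bar> \<le> m"
  have "\<bar>f (X j) v - f (X (j - 1)) v\<bar> \<le> L * (1 + \<bar>v\<bar>) * \<bar>X j - X (j - 1)\<bar>" by (rule f_diff_bound)
  also have "\<dots> \<le> L * (1 + m) * h" using v L1 h_pos
    by (intro mult_mono) (auto simp: X_pred[OF j] simp del: One_nat_def)
  finally have "lam T N M * \<bar>f (X j) v - f (X (j - 1)) v\<bar> \<le> lam T N M * (L * (1 + m) * h)"
    using lam_pos by (intro mult_left_mono) auto
  also have "\<dots> = (lam T N M * h) * (L * (1 + m))" by (simp add: mult_ac)
  finally show ?thesis using lam_pos by (simp add: lam_h abs_mult)
qed

text \<open>The scheme maps the constants \<open>\<plusminus> m\<close> to values within \<open>m + O(\<Delta>t (1 + m))\<close>, and monotonicity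
  confines all other values between them.\<close>

lemma step_bound:
  assumes "\<And>j. j \<in> {1..N} \<Longrightarrow> \<bar>v j\<bar> \<le> m" "j \<in> {1..N}"
  shows "1 + \<bar>step v j\<bar> \<le> (1 + 3 * L * \<tau>) * (1 + m)"
proof -
  have m: "m \<ge> 0" using assms(1)[OF assms(2)] by linarith
  have "per N v (j - 1) = v (if j = 1 then N else j - 1)" "(if j = 1 then N else j - 1) \<in> {1..N}"
    using assms(2) by (auto simp: per_def)
  then have pv: "\<bar>per N v (j - 1)\<bar> \<le> m" "\<bar>v (right j)\<bar> \<le> m" "\<bar>v j\<bar> \<le> m"
    using assms(1) assms(2) right_in[OF assms(2)] by metis+
  have "Psij j (per N v (j - 1)) (v j) (v (right j)) \<le> Psij j m m m"
    using assms(2) pv by (intro Psi_mono) auto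
  moreover have "Psij j (- m) (- m) (- m) \<le> Psij j (per N v (j - 1)) (v j) (v (right j))"
    using assms(2) pv by (intro Psi_mono) auto
  moreover have "\<bar>lam T N M * (f (X j) m - f (X (j - 1)) m)\<bar> \<le> \<tau> * (L * (1 + m))"
    "\<bar>lam T N M * (f (X j) (- m) - f (X (j - 1)) (- m))\<bar> \<le> \<tau> * (L * (1 + m))"
    using assms(2) m f_X_diff[of j m m] f_X_diff[of j "- m" m] by auto
  moreover have "\<bar>\<tau> * P_disc N v j\<bar> \<le> \<tau> * (2 * L * (1 + m))"
  proof -
    have "1 * m \<le> L * (1 + m)" using L1 m by (intro mult_mono) auto
    then have "\<bar>P_disc N v j\<bar> \<le> 2 * L * (1 + m)" using P_disc_bound[of v m j, OF assms] by linarith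
    then show ?thesis using tau_pos by (simp add: abs_mult mult.assoc)
  qed
  ultimately have "\<bar>step v j\<bar> \<le> m + \<tau> * (L * (1 + m)) + \<tau> * (2 * L * (1 + m))"
    unfolding step_Psi[OF assms(2)] Psi_const by linarith
  also have "1 + \<dots> = (1 + 3 * L * \<tau>) * (1 + m)" by (simp add: algebra_simps)
  finally show ?thesis by simp
qed

lemma P_disc_right_sum:
  assumes "\<And>j. j \<in> {1..N} \<Longrightarrow> \<bar>v j\<bar> \<le> B"
  shows "(\<Sum>j\<in>{1..N}. \<bar>P_disc N v (right j) - P_disc N v j\<bar>) \<le> 5 * B"
proof -
  have B: "B \<ge> 0" using assms[of 1] N_pos by force
  have in1: "\<bar>P_disc N v (right j) - P_disc N v j\<bar> \<le> h * B" if "j \<in> {1..<N}" for j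
  proof -
    have "{1..<Suc j} = insert j {1..<j}" using that by auto
    then have "P_disc N v (right j) - P_disc N v j = h * (v j / 2 + v (Suc j) / 2)"
      using that by (simp add: P_disc_def right_def algebra_simps add_divide_distrib)
    moreover have "\<bar>v j / 2 + v (Suc j) / 2\<bar> \<le> B" using assms[of j] assms[of "Suc j"] that by (auto simp: abs_le_iff)
    ultimately show ?thesis using h_pos by (simp add: abs_mult)
  qed
  have "{1..N} = insert N {1..<N}" using N_pos by auto
  then have "(\<Sum>j\<in>{1..N}. \<bar>P_disc N v (right j) - P_disc N v j\<bar>)
    = \<bar>P_disc N v (right N) - P_disc N v N\<bar> + (\<Sum>j\<in>{1..<N}. \<bar>P_disc N v (right j) - P_disc N v j\<bar>)" by simp
  also have "\<dots> \<le> 4 * B + (\<Sum>j\<in>{1..<N}. h * B)"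
  proof (intro add_mono sum_mono in1)
    show "\<bar>P_disc N v (right N) - P_disc N v N\<bar> \<le> 4 * B"
      using P_disc_bound[of v B "right N", OF assms] P_disc_bound[of v B N, OF assms] right_in[of N] N_pos by force
  qed
  also have "(\<Sum>j\<in>{1..<N}. h * B) \<le> (\<Sum>j\<in>{1..N}. h * B)"
    using h_pos B by (intro sum_mono2) auto
  also have "\<dots> = (real N * h) * B" by simp
  finally show ?thesis by (simp add: N_h)
qed

text \<open>Both differences are values of \<open>fx\<close> at points at distance at most \<open>2 \<Delta>x\<close>. Regularity of
  \<open>fx\<close> in \<open>x\<close> enters the bound on the total variation here.\<close>

lemma f_second_difference:
  assumes "\<And>x y. \<bar>fx x v - fx y v\<bar> \<le> L2 * \<bar>x - y\<bar>" "L2 \<ge> 0" "j \<ge> 1"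
  shows "\<bar>f (X (Suc j)) v - 2 * f (X j) v + f (X (j - 1)) v\<bar> \<le> 2 * L2 * h\<^sup>2"
proof -
  define g where "g = (\<lambda>s. f (s + h) v - f s v)"
  have dg: "(g has_real_derivative fx (s + h) v - fx s v) (at s)" for s
    unfolding g_def
    by (rule DERIV_cong[OF DERIV_diff[OF DERIV_chain2[OF f_dx DERIV_add[OF DERIV_ident DERIV_const]] f_dx]]) simp
  obtain z where z: "g (X j) - g (X (j - 1)) = (X j - X (j - 1)) * (fx (z + h) v - fx z v)"
    using MVT_between[of g "\<lambda>s. fx (s + h) v - fx s v" "X (j - 1)" "X j"] dg by metis
  have e: "X (j - 1) + h = X j" "X j - X (j - 1) = h" using X_pred[OF assms(3)] by auto
  then have "f (X (Suc j)) v - 2 * f (X j) v + f (X (j - 1)) v = h * (fx (z + h) v - fx z v)"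
    using z unfolding g_def X_Suc e by linarith
  also have "\<bar>\<dots>\<bar> = h * \<bar>fx (z + h) v - fx z v\<bar>" using h_pos by (simp add: abs_mult)
  also have "\<dots> \<le> h * (L2 * \<bar>z + h - z\<bar>)" using h_pos by (intro mult_left_mono assms(1)) auto
  also have "\<dots> \<le> 2 * L2 * h\<^sup>2" using h_pos assms(2) by (simp add: power2_eq_square)
  finally show ?thesis .
qed

text \<open>The translate of the solution by one cell is compared with the solution by the contraction
  property. The translate solves the scheme with shifted coefficients; exchanging the
  coefficients costs \<open>\<Delta>t\<close> times the total variation, from the Lipschitz bound on \<open>F\<^sub>x\<close>, plus a
  second difference of \<open>f\<close> in \<open>x\<close>.\<close>

lemma step_TV:
  assumes B: "\<And>j. j \<in> {1..N} \<Longrightarrow> \<bar>v j\<bar> \<le> B"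
    and L2: "\<And>x y w. \<bar>w\<bar> \<le> B \<Longrightarrow> \<bar>fx x w - fx y w\<bar> \<le> L2 * \<bar>x - y\<bar>" "L2 \<ge> 0"
  shows "TV (step v) \<le> (1 + 2 * L * \<tau>) * TV v + \<tau> * (2 * L2 + 5 * B)"
proof -
  define s where "s j = v (right j)" for j
  have sper: "per N s (j - 1) = v j" if "j \<in> {1..N}" for j
    using that N_pos by (auto simp: per_def s_def right_def)
  \<comment> \<open>the error of exchanging the coefficients of neighbouring cells\<close>
  define E where "E j = (F (X (Suc j)) (s j) (s (right j)) - F (X j) (s j) (s (right j)))
      - (F (X j) (v j) (s j) - F (X (j - 1)) (v j) (s j))" for j
  have FSN: "F (X (Suc N)) a b = F (X 1) a b" "F (X N) a b = F (X 0) a b" for a b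
    using F_per[of h a b] F_X_N by (auto simp: X_Suc X_N X_0 add.commute)
  have eq: "step v (right j) - step v j =
      (Psij j (per N s (j - 1)) (s j) (s (right j)) - Psij j (per N v (j - 1)) (v j) (v (right j)))
      - lam T N M * E j + \<tau> * (P_disc N v (right j) - P_disc N v j)" if j: "j \<in> {1..N}" for j
  proof -
    have pn: "per N v (right j - 1) = v j" using j N_pos by (auto simp: right_def per_def)
    have "Psij (right j) (v j) (s j) (s (right j)) = Psij (Suc j) (v j) (s j) (s (right j))"
      using j by (auto simp: right_def Psi_def FSN)
    moreover have "step v (right j) = Psij (right j) (v j) (s j) (s (right j)) + \<tau> * P_disc N v (right j)"
      using step_Psi[OF right_in[OF j]] pn by (simp add: s_def)
    moreover have "Psij (Suc j) (v j) (s j) (s (right j)) = Psij j (v j) (s j) (s (right j)) - lam T N M * E j"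
      by (simp add: Psi_def E_def algebra_simps)
    moreover have "step v j = Psij j (per N v (j - 1)) (v j) (v (right j)) + \<tau> * P_disc N v j" by (rule step_Psi[OF j])
    moreover have "per N s (j - 1) = v j" by (rule sper[OF j])
    ultimately show ?thesis by (simp add: right_diff_distrib)
  qed
  have Eb: "\<bar>E j\<bar> \<le> L * h * \<bar>s (right j) - s j\<bar> + L * h * \<bar>s j - v j\<bar> + 2 * L2 * h\<^sup>2" if j: "j \<in> {1..N}" for j
  proof -
    have sb: "\<bar>s j\<bar> \<le> B" using B[OF right_in[OF j]] by (simp add: s_def)
    have j1: "j \<ge> 1" using j by auto
    have 1: "\<bar>(F (X (Suc j)) (s j) (s (right j)) - F (X j) (s j) (s (right j)))
       - (F (X (Suc j)) (s j) (s j) - F (X j) (s j) (s j))\<bar> \<le> L * h * \<bar>s (right j) - s j\<bar>"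
      using F_xlip[of "X (Suc j)" "s j" "s (right j)" "X j" "s j" "s j"] h_pos by (simp add: X_Suc)
    have 2: "\<bar>(F (X j) (v j) (s j) - F (X (j - 1)) (v j) (s j))
       - (F (X j) (s j) (s j) - F (X (j - 1)) (s j) (s j))\<bar> \<le> L * h * \<bar>s j - v j\<bar>"
      using F_xlip[of "X j" "v j" "s j" "X (j - 1)" "s j" "s j"] h_pos X_pred[OF j1]
      by (simp add: abs_minus_commute)
    have 3: "\<bar>f (X (Suc j)) (s j) - 2 * f (X j) (s j) + f (X (j - 1)) (s j)\<bar> \<le> 2 * L2 * h\<^sup>2"
      using f_second_difference[OF L2(1)[OF sb] L2(2) j1] .
    show ?thesis using 1 2 3 unfolding E_def F_cons by linarith
  qed
  have "TV (step v) \<le> (\<Sum>j\<in>{1..N}. 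
      \<bar>Psij j (per N s (j - 1)) (s j) (s (right j)) - Psij j (per N v (j - 1)) (v j) (v (right j))\<bar>
      + lam T N M * (L * h * \<bar>s (right j) - s j\<bar> + L * h * \<bar>s j - v j\<bar> + 2 * L2 * h\<^sup>2)
      + \<tau> * \<bar>P_disc N v (right j) - P_disc N v j\<bar>)"
    unfolding TV_def
  proof (rule sum_mono)
    fix j assume j: "j \<in> {1..N}"
    have "\<bar>lam T N M * E j\<bar> \<le> lam T N M * (L * h * \<bar>s (right j) - s j\<bar> + L * h * \<bar>s j - v j\<bar> + 2 * L2 * h\<^sup>2)"
      using Eb[OF j] lam_pos by (simp add: abs_mult)
    moreover have "\<bar>\<tau> * (P_disc N v (right j) - P_disc N v j)\<bar> = \<tau> * \<bar>P_disc N v (right j) - P_disc N v j\<bar>"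
      using tau_pos by (simp add: abs_mult)
    ultimately show "\<bar>step v (right j) - step v j\<bar> \<le>
      \<bar>Psij j (per N s (j - 1)) (s j) (s (right j)) - Psij j (per N v (j - 1)) (v j) (v (right j))\<bar>
      + lam T N M * (L * h * \<bar>s (right j) - s j\<bar> + L * h * \<bar>s j - v j\<bar> + 2 * L2 * h\<^sup>2)
      + \<tau> * \<bar>P_disc N v (right j) - P_disc N v j\<bar>" unfolding eq[OF j] by (rule abs_le3')
  qed
  also have "\<dots> = (\<Sum>j\<in>{1..N}.
      \<bar>Psij j (per N s (j - 1)) (s j) (s (right j)) - Psij j (per N v (j - 1)) (v j) (v (right j))\<bar>)
      + lam T N M * (L * h * (\<Sum>j\<in>{1..N}. \<bar>s (right j) - s j\<bar>) + L * h * (\<Sum>j\<in>{1..N}. \<bar>s j - v j\<bar>) + real N * (2 * L2 * h\<^sup>2))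
      + \<tau> * (\<Sum>j\<in>{1..N}. \<bar>P_disc N v (right j) - P_disc N v j\<bar>)"
    unfolding sum_linear card_atLeastAtMost diff_Suc_1 by (rule refl)
  also have "(\<Sum>j\<in>{1..N}. \<bar>s (right j) - s j\<bar>) = TV v"
    unfolding s_def TV_def by (rule sum_right[of "\<lambda>j. \<bar>v (right j) - v j\<bar>"])
  also have "(\<Sum>j\<in>{1..N}. \<bar>s j - v j\<bar>) = TV v" by (simp add: s_def TV_def)
  also have "real N * (2 * L2 * h\<^sup>2) = 2 * L2 * h" using N_h by (simp add: power2_eq_square)
  also have "lam T N M * (L * h * TV v + L * h * TV v + 2 * L2 * h) = (lam T N M * h) * (2 * L * TV v + 2 * L2)"
    by (simp add: algebra_simps)
  also have "(\<Sum>j\<in>{1..N}. \<bar>Psij j (per N s (j - 1)) (s j) (s (right j)) - Psij j (per N v (j - 1)) (v j) (v (right j))\<bar>) 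
      + (lam T N M * h) * (2 * L * TV v + 2 * L2) + \<tau> * (\<Sum>j\<in>{1..N}. \<bar>P_disc N v (right j) - P_disc N v j\<bar>)
     \<le> TV v + (lam T N M * h) * (2 * L * TV v + 2 * L2) + \<tau> * (5 * B)"
  proof (intro add_mono order_refl)
    show "(\<Sum>j\<in>{1..N}. \<bar>Psij j (per N s (j - 1)) (s j) (s (right j)) - Psij j (per N v (j - 1)) (v j) (v (right j))\<bar>) \<le> TV v"
      using Psi_contraction[of s v] by (simp add: TV_def s_def)
    show "\<tau> * (\<Sum>j\<in>{1..N}. \<bar>P_disc N v (right j) - P_disc N v j\<bar>) \<le> \<tau> * (5 * B)"
      using tau_pos P_disc_right_sum[OF B] by (intro mult_left_mono) auto
  qed
  finally show ?thesis unfolding lam_h by (simp add: algebra_simps)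
qed

lemma sum_pred: "(\<Sum>j\<in>{1..N}. \<bar>v j - per N v (j - 1)\<bar>) = TV v"
proof -
  have "TV v = (\<Sum>j\<in>{1..N}. \<bar>v (right j) - per N v (right j - 1)\<bar>)"
    unfolding TV_def using N_pos by (intro sum.cong) (auto simp: right_def per_def)
  also have "\<dots> = (\<Sum>j\<in>{1..N}. \<bar>v j - per N v (j - 1)\<bar>)" by (rule sum_right)
  finally show ?thesis by simp
qed

lemma step_time:
  assumes B: "\<And>j. j \<in> {1..N} \<Longrightarrow> \<bar>v j\<bar> \<le> B"
  shows "h * (\<Sum>j\<in>{1..N}. \<bar>step v j - v j\<bar>) \<le> \<tau> * (2 * L * TV v + L * (1 + B) + 2 * B)"
proof -
  have 1: "\<bar>step v j - v j\<bar> \<le> lam T N M * (L * \<bar>v (right j) - v j\<bar> + L * \<bar>v j - per N v (j - 1)\<bar>) + \<tau> * (L * (1 + B) + 2 * B)"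
    if j: "j \<in> {1..N}" for j
  proof -
    have j1: "j \<ge> 1" using j by auto
    let ?p = "per N v (j - 1)"
    have a: "\<bar>F (X j) (v j) (v (right j)) - F (X j) (v j) (v j)\<bar> \<le> L * \<bar>v (right j) - v j\<bar>"
      using F_lip[of "X j" "v j" "v (right j)" "v j" "v j"] by simp
    have b: "\<bar>F (X (j - 1)) (v j) (v j) - F (X (j - 1)) ?p (v j)\<bar> \<le> L * \<bar>v j - ?p\<bar>"
      using F_lip[of "X (j - 1)" "v j" "v j" ?p "v j"] by simp
    have c: "\<bar>lam T N M * (F (X j) (v j) (v j) - F (X (j - 1)) (v j) (v j))\<bar> \<le> \<tau> * (L * (1 + B))"
      unfolding F_cons by (rule f_X_diff[OF j1 B[OF j]])
    have "\<bar>(F (X j) (v j) (v (right j)) - F (X j) (v j) (v j)) + (F (X (j - 1)) (v j) (v j) - F (X (j - 1)) ?p (v j))\<bar>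
      \<le> L * \<bar>v (right j) - v j\<bar> + L * \<bar>v j - ?p\<bar>" using a b by linarith
    then have ab: "\<bar>lam T N M * ((F (X j) (v j) (v (right j)) - F (X j) (v j) (v j)) + (F (X (j - 1)) (v j) (v j) - F (X (j - 1)) ?p (v j)))\<bar>
      \<le> lam T N M * (L * \<bar>v (right j) - v j\<bar> + L * \<bar>v j - ?p\<bar>)" using lam_pos by (simp add: abs_mult)
    have d: "\<bar>\<tau> * P_disc N v j\<bar> \<le> \<tau> * (2 * B)" using P_disc_bound[OF B j] tau_pos by (simp add: abs_mult)
    have "step v j - v j = - (lam T N M * ((F (X j) (v j) (v (right j)) - F (X j) (v j) (v j)) + (F (X (j - 1)) (v j) (v j) - F (X (j - 1)) ?p (v j))))
       - lam T N M * (F (X j) (v j) (v j) - F (X (j - 1)) (v j) (v j)) + \<tau> * P_disc N v j"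
      unfolding step_Psi[OF j] Psi_def by (simp add: algebra_simps)
    from abs_le3[OF this ab c d] show ?thesis unfolding distrib_left[of \<tau>] by (simp only: add.assoc)
  qed
  have "(\<Sum>j\<in>{1..N}. \<bar>step v j - v j\<bar>) \<le> (\<Sum>j\<in>{1..N}. lam T N M * (L * \<bar>v (right j) - v j\<bar> + L * \<bar>v j - per N v (j - 1)\<bar>) + \<tau> * (L * (1 + B) + 2 * B))"
    by (intro sum_mono 1)
  also have "\<dots> = lam T N M * (L * TV v + L * (\<Sum>j\<in>{1..N}. \<bar>v j - per N v (j - 1)\<bar>)) + real N * (\<tau> * (L * (1 + B) + 2 * B))"
    unfolding TV_def using sum_linear[of "\<lambda>_. 0" "lam T N M" L "\<lambda>j. \<bar>v (right j) - v j\<bar>" L "\<lambda>j. \<bar>v j - per N v (j - 1)\<bar>" 0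
      "\<tau> * (L * (1 + B) + 2 * B)" "\<lambda>_. 1" "{1..N}"] by simp
  also have "\<dots> = lam T N M * (2 * L * TV v) + real N * (\<tau> * (L * (1 + B) + 2 * B))"
    unfolding sum_pred by simp
  finally have "h * (\<Sum>j\<in>{1..N}. \<bar>step v j - v j\<bar>) \<le> h * (lam T N M * (2 * L * TV v) + real N * (\<tau> * (L * (1 + B) + 2 * B)))"
    using h_pos by (intro mult_left_mono) auto
  also have "\<dots> = (lam T N M * h) * (2 * L * TV v) + (real N * h) * (\<tau> * (L * (1 + B) + 2 * B))"
    by (simp add: algebra_simps)
  finally show ?thesis unfolding lam_h N_h by (simp add: algebra_simps)
qed

end

section \<open>Bounded Borel functions\<close>

text \<open>Borel measurable on the whole space and bounded on \<open>S\<close>. All integrands are of this kind on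
  a compact set, and closure under the arithmetic operations settles their integrability by
  introduction rules.\<close>

definition bm :: "'a::euclidean_space set \<Rightarrow> ('a \<Rightarrow> real) \<Rightarrow> bool" where
  "bm S g \<longleftrightarrow> g \<in> borel_measurable borel \<and> (\<exists>C. \<forall>x\<in>S. \<bar>g x\<bar> \<le> C)"

lemma bm_measurable: "bm S g \<Longrightarrow> g \<in> borel_measurable borel"
  by (simp add: bm_def)

lemma bm_const: "bm S (\<lambda>x. c)" by (auto simp: bm_def)

lemma bm_add: assumes "bm S f" "bm S g" shows "bm S (\<lambda>x. f x + g x)"
proof -
  obtain C D where "\<forall>x\<in>S. \<bar>f x\<bar> \<le> C" "\<forall>x\<in>S. \<bar>g x\<bar> \<le> D" using assms by (auto simp: bm_def)
  then have "\<forall>x\<in>S. \<bar>f x + g x\<bar> \<le> C + D" by (auto intro!: order_trans[OF abs_triangle_ineq] add_mono)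
  then show ?thesis using assms by (auto simp: bm_def)
qed

lemma bm_mult: assumes "bm S f" "bm S g" shows "bm S (\<lambda>x. f x * g x)"
proof -
  obtain C D where "\<forall>x\<in>S. \<bar>f x\<bar> \<le> C" "\<forall>x\<in>S. \<bar>g x\<bar> \<le> D" using assms by (auto simp: bm_def)
  then have "\<forall>x\<in>S. \<bar>f x * g x\<bar> \<le> C * D" unfolding abs_mult
    by (intro ballI mult_mono) (auto intro: order_trans[OF abs_ge_zero])
  then show ?thesis using assms by (auto simp: bm_def)
qed

lemma bm_cmult: "bm S g \<Longrightarrow> bm S (\<lambda>x. c * g x)" by (intro bm_mult bm_const)

lemma bm_diff: assumes "bm S f" "bm S g" shows "bm S (\<lambda>x. f x - g x)"
  using bm_add[OF assms(1) bm_cmult[OF assms(2), of "-1"]] by simp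

lemma bm_divide: assumes "bm S f" shows "bm S (\<lambda>x. f x / c)"
  using bm_cmult[OF assms(1), of "1 / c"] by simp

lemma bm_abs: "bm S f \<Longrightarrow> bm S (\<lambda>x. \<bar>f x\<bar>)" by (auto simp: bm_def)

lemma bm_sgn: "bm S f \<Longrightarrow> bm S (\<lambda>x. sgn (f x))"
  by (auto simp: bm_def sgn_if intro!: exI[of _ 1])

lemma bm_sum: "(\<And>i. i \<in> I \<Longrightarrow> bm S (g i)) \<Longrightarrow> bm S (\<lambda>x. \<Sum>i\<in>I. g i x)"
  by (induction I rule: infinite_finite_induct) (auto intro: bm_const bm_add)

lemma bm_continuous:
  assumes "continuous_on UNIV g" "compact S"
  shows "bm S g"
proof -
  have "bounded (g ` S)"
    by (intro compact_imp_bounded compact_continuous_image continuous_on_subset[OF assms(1)] assms(2)) simp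
  then show ?thesis using assms by (auto simp: bm_def bounded_iff intro: borel_measurable_continuous_onI)
qed

lemma bm_compose2:
  assumes c: "continuous_on UNIV (\<lambda>p. g (fst p) (snd p))" and a: "bm S a" and b: "bm S b"
  shows "bm S (\<lambda>x. g (a x) (b x) :: real)"
proof -
  obtain C D where C: "\<forall>x\<in>S. \<bar>a x\<bar> \<le> C" and D: "\<forall>x\<in>S. \<bar>b x\<bar> \<le> D" using a b by (auto simp: bm_def)
  have "compact ({-C..C} \<times> {-D..D})" by (intro compact_Times compact_Icc)
  then have "bounded ((\<lambda>p. g (fst p) (snd p)) ` ({-C..C} \<times> {-D..D}))"
    by (intro compact_imp_bounded compact_continuous_image continuous_on_subset[OF c]) auto
  then obtain E where E: "\<And>v w. v \<in> {-C..C} \<Longrightarrow> w \<in> {-D..D} \<Longrightarrow> \<bar>g v w\<bar> \<le> E"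
  proof -
    from \<open>bounded _\<close> obtain E where "\<forall>x\<in>(\<lambda>p. g (fst p) (snd p)) ` ({-C..C} \<times> {-D..D}). norm x \<le> E"
      unfolding bounded_iff by blast
    then have "\<bar>g v w\<bar> \<le> E" if "v \<in> {-C..C}" "w \<in> {-D..D}" for v w
      using that by force
    then show ?thesis by (rule that)
  qed
  have "\<bar>g (a x) (b x)\<bar> \<le> E" if "x \<in> S" for x
  proof (rule E)
    show "a x \<in> {-C..C}" "b x \<in> {-D..D}" using C D that by (auto simp: abs_le_iff)
  qed
  moreover have "(\<lambda>x. g (a x) (b x)) \<in> borel_measurable borel"
  proof -
    have "(\<lambda>x. (a x, b x)) \<in> borel_measurable borel"
      using a b unfolding bm_def by (intro borel_measurable_Pair) auto
    from borel_measurable_continuous_on[OF c this] show ?thesis by simp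
  qed
  ultimately show ?thesis by (auto simp: bm_def)
qed

lemma bm_integrable:
  assumes "bm S g" "S \<in> sets borel" "emeasure lborel S < \<infinity>"
  shows "set_integrable lborel S g"
proof -
  obtain C where C: "\<forall>x\<in>S. \<bar>g x\<bar> \<le> C" using assms(1) by (auto simp: bm_def)
  have "set_integrable lborel S (\<lambda>x. C)"
    unfolding set_integrable_def using assms by (intro integrable_scaleR_left) auto
  then show ?thesis
  proof (rule set_integrable_bound)
    show "set_borel_measurable lborel S g" using assms by (auto simp: set_borel_measurable_def bm_def)
    show "AE x in lborel. x \<in> S \<longrightarrow> norm (g x) \<le> norm C"
      using C by (intro AE_I2) (auto intro: order_trans[OF _ abs_ge_self])
  qed
qed

lemma bm_integrable_Icc: "bm {a..b} g \<Longrightarrow> set_integrable lborel {a..b::real} g"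
  by (rule bm_integrable) (auto simp: emeasure_compact_finite[unfolded infinity_ennreal_def])

lemma set_integrable_sum':
  fixes f :: "'i \<Rightarrow> 'a \<Rightarrow> real"
  assumes "\<And>i. i \<in> I \<Longrightarrow> set_integrable M A (f i)"
  shows "set_integrable M A (\<lambda>x. \<Sum>i\<in>I. f i x)"
  using assms
proof (induction I rule: infinite_finite_induct)
  case (insert i I)
  then show ?case using set_integral_add(1)[of M A "f i" "\<lambda>x. \<Sum>i\<in>I. f i x"] by simp
qed (simp_all add: set_integrable_def)

lemma set_integral_sum':
  fixes f :: "'i \<Rightarrow> 'a \<Rightarrow> real"
  assumes "\<And>i. i \<in> I \<Longrightarrow> set_integrable M A (f i)"
  shows "(LINT x:A|M. \<Sum>i\<in>I. f i x) = (\<Sum>i\<in>I. LINT x:A|M. f i x)"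
  using assms
  by (induction I rule: infinite_finite_induct)
     (auto simp: set_integral_add set_integrable_sum')

section \<open>Translation estimates for step functions\<close>

lemma card_nat_interval:
  assumes "S \<subseteq> {j::nat. p \<le> real j \<and> real j \<le> q}" "q - p + 1 \<ge> 0"
  shows "real (card S) \<le> q - p + 1"
proof (cases "S = {}")
  case False
  have fin: "finite S"
    by (rule finite_subset[of _ "{..nat \<lfloor>q\<rfloor>}"]) (use assms(1) in \<open>auto simp: le_nat_floor\<close>)
  have "S \<subseteq> {Min S..Max S}" using fin by auto
  then have "card S \<le> card {Min S..Max S}" by (rule card_mono[rotated]) simp
  moreover have "Min S \<le> Max S" using fin False by (simp add: Min_le_iff)
  ultimately have "real (card S) \<le> real (Max S) - real (Min S) + 1" by (simp add: of_nat_diff)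
  moreover have "Max S \<in> S" "Min S \<in> S" using fin False by auto
  ultimately show ?thesis using assms(1) by (smt (verit) mem_Collect_eq subset_eq)
qed (use assms in auto)

lemma periodic_lipschitz:
  fixes g :: "real \<Rightarrow> real"
  assumes p: "\<And>x. g (x + 1) = g x" and l: "\<And>x y. \<bar>g x - g y\<bar> \<le> K * \<bar>x - y\<bar>"
    and xy: "x \<in> {0..1}" "y \<in> {0..1}"
  shows "\<bar>g x - g y\<bar> \<le> K * \<bar>sin (pi * (x - y))\<bar>"
proof -
  have K: "K \<ge> 0" using l[of 0 1] by (smt (verit) abs_ge_zero mult_cancel_left1 mult_minus_right)
  have *: "\<bar>g x - g y\<bar> \<le> K * \<bar>sin (pi * (x - y))\<bar>" if "x \<le> y" "x \<in> {0..1}" "y \<in> {0..1}" for x y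
  proof -
    have "\<bar>g x - g y\<bar> \<le> K * (y - x)" using l[of x y] that by simp
    moreover have "\<bar>g x - g y\<bar> \<le> K * (1 - (y - x))" using l[of "x + 1" y] that p[of x] by (simp add: algebra_simps)
    ultimately have "\<bar>g x - g y\<bar> \<le> K * min (y - x) (1 - (y - x))" by (auto simp: min_def)
    also have "\<dots> \<le> K * \<bar>sin (pi * (y - x))\<bar>"
    proof (rule mult_left_mono[OF _ K])
      have "min (y - x) (1 - (y - x)) \<ge> 0" using that by auto
      moreover have "2 * min (y - x) (1 - (y - x)) \<le> \<bar>sin (pi * (y - x))\<bar>"
        by (rule min_le_sin_pi) (use that in auto)
      moreover have "m \<le> t" if "0 \<le> m" "2 * m \<le> t" for m t :: real using that by linarith
      ultimately show "min (y - x) (1 - (y - x)) \<le> \<bar>sin (pi * (y - x))\<bar>" by blast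
    qed
    also have "\<bar>sin (pi * (y - x))\<bar> = \<bar>sin (pi * (x - y))\<bar>"
      using sin_minus[of "pi * (x - y)"] by (simp add: algebra_simps)
    finally show ?thesis .
  qed
  show ?thesis
  proof (cases "x \<le> y")
    case True then show ?thesis using * xy by blast
  next
    case False
    then have "\<bar>g y - g x\<bar> \<le> K * \<bar>sin (pi * (y - x))\<bar>" using * xy by auto
    moreover have "\<bar>sin (pi * (y - x))\<bar> = \<bar>sin (pi * (x - y))\<bar>"
      using sin_minus[of "pi * (x - y)"] by (simp add: algebra_simps)
    ultimately show ?thesis by (simp add: abs_minus_commute)
  qed
qed

context mesh
begin

text \<open>The minimum puts the end point \<open>y = 1\<close> into the last cell, so that every point of the
  closed interval has a cell.\<close>

definition cell :: "real \<Rightarrow> nat" where "cell y = min N (nat \<lfloor>y / h\<rfloor> + 1)"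

lemma cell_bounds:
  assumes "y \<in> {0..1}"
  shows "cell y \<in> {1..N}" "X (cell y - 1) \<le> y" "y \<le> X (cell y)"
proof -
  show "cell y \<in> {1..N}" using N_pos by (auto simp: cell_def)
  have y: "y / h \<ge> 0" "y = (y / h) * h" using assms h_pos by auto
  have f: "real (nat \<lfloor>y / h\<rfloor>) \<le> y / h" "y / h < real (nat \<lfloor>y / h\<rfloor> + 1)"
    using y(1) by linarith+
  have "real (cell y - 1) \<le> y / h" using f by (auto simp: cell_def min_def split: if_splits)
  then have "real (cell y - 1) * h \<le> (y / h) * h" using h_pos by (intro mult_right_mono) auto
  then show "X (cell y - 1) \<le> y" unfolding iface_def using y by linarith
  show "y \<le> X (cell y)"
  proof (cases "nat \<lfloor>y / h\<rfloor> + 1 \<le> N")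
    case True
    then have "(y / h) * h \<le> real (cell y) * h" using f h_pos by (intro mult_right_mono) (auto simp: cell_def)
    then show ?thesis unfolding iface_def using y by linarith
  next
    case False
    then have "cell y = N" by (simp add: cell_def)
    then show ?thesis using X_N assms by simp
  qed
qed

lemma cell_eq:
  assumes "j \<in> {1..N}" "X (j - 1) \<le> y" "y < X j"
  shows "cell y = j"
proof -
  have "real (j - 1) * h \<le> y" "y < real j * h" using assms by (auto simp: iface_def)
  then have "real (j - 1) \<le> y / h" "y / h < real j" using h_pos by (auto simp: field_simps)
  then have "\<lfloor>y / h\<rfloor> = int (j - 1)" using assms(1) by (intro floor_unique) auto
  then show ?thesis using assms(1) by (auto simp: cell_def)
qed

lemma cell_measurable: "(\<lambda>y. c (cell y)) \<in> borel_measurable borel" for c :: "nat \<Rightarrow> real"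
  unfolding cell_def by measurable

lemma bm_cell: "bm {0..1} (\<lambda>y. c (cell y))" for c :: "nat \<Rightarrow> real"
proof -
  have "\<bar>c (cell y)\<bar> \<le> (\<Sum>j\<in>{1..N}. \<bar>c j\<bar>)" if "y \<in> {0..1}" for y
    using cell_bounds(1)[OF that] by (intro member_le_sum[of _ _ "\<lambda>j. \<bar>c j\<bar>"]) auto
  then show ?thesis using cell_measurable[of c] unfolding bm_def by blast
qed

lemma X_mono: "i \<le> j \<Longrightarrow> X i \<le> X j"
  using h_pos by (auto simp: iface_def intro: mult_right_mono)

lemma X_01: "j \<le> N \<Longrightarrow> X j \<in> {0..1}"
  using X_mono[of 0 j] X_mono[of j N] X_0 X_N by auto

text \<open>Each interface between \<open>y\<close> and the cell \<open>j\<close> contributes its jump. The path stays inside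
  \<open>[0, 1]\<close> even if the periodic distance is shorter; the weights in \<open>translation_estimate\<close> make
  up for this.\<close>

lemma path_bound:
  fixes c :: "nat \<Rightarrow> real"
  assumes y: "y \<in> {0..1}" and j: "j \<in> {1..N}"
  shows "\<bar>c (cell y) - c j\<bar> \<le> (\<Sum>i\<in>{1..<N}. \<bar>c (Suc i) - c i\<bar> *
     (if j \<le> i then indicator {X i..1} y else indicator {0..X i} y))"
proof -
  let ?g = "\<lambda>i. \<bar>c (Suc i) - c i\<bar> * (if j \<le> i then indicator {X i..1} y else indicator {0..X i} y)"
  have tele: "\<bar>c b - c a\<bar> \<le> (\<Sum>i\<in>{a..<b}. \<bar>c (Suc i) - c i\<bar>)" if "a \<le> b" for a b
  proof -
    have "c b - c a = (\<Sum>i\<in>{a..<b}. c (Suc i) - c i)" using that sum_Suc_diff'[of a b c] by simp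
    then show ?thesis by (simp add: sum_abs)
  qed
  have ge: "y \<ge> X i" if "i < cell y" for i
    using cell_bounds[OF y] X_mono[of i "cell y - 1"] that by linarith
  have le: "y \<le> X i" if "cell y \<le> i" for i
    using cell_bounds[OF y] X_mono[of "cell y" i] that by linarith
  have cN: "cell y \<in> {1..N}" using cell_bounds[OF y] by simp
  show ?thesis
  proof (cases "j \<le> cell y")
    case True
    have "\<bar>c (cell y) - c j\<bar> \<le> (\<Sum>i\<in>{j..<cell y}. \<bar>c (Suc i) - c i\<bar>)" by (rule tele[OF True])
    also have "\<dots> = (\<Sum>i\<in>{j..<cell y}. ?g i)"
      by (intro sum.cong refl) (use ge y in auto)
    also have "\<dots> \<le> (\<Sum>i\<in>{1..<N}. ?g i)"
      by (rule sum_mono2) (use cN j in auto)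
    finally show ?thesis .
  next
    case False
    then have "\<bar>c j - c (cell y)\<bar> \<le> (\<Sum>i\<in>{cell y..<j}. \<bar>c (Suc i) - c i\<bar>)" by (intro tele) auto
    also have "\<dots> = (\<Sum>i\<in>{cell y..<j}. ?g i)"
      by (intro sum.cong refl) (use le y in auto)
    also have "\<dots> \<le> (\<Sum>i\<in>{1..<N}. ?g i)"
      by (rule sum_mono2) (use cN j in auto)
    finally show ?thesis by (simp add: abs_minus_commute)
  qed
qed

lemma even_kernel_integral:
  fixes k :: "real \<Rightarrow> real"
  assumes c: "continuous_on UNIV k" and even: "\<And>z. k (- z) = k z" and ab: "a \<le> b"
  shows "(LINT y:{a..b}|lborel. k (c - y)) = (LINT z:{a - c..b - c}|lborel. k z)"
    and "(LINT y:{a..b}|lborel. k (c - y)) = (LINT z:{c - b..c - a}|lborel. k z)"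
proof -
  obtain A where A: "\<And>x. (A has_real_derivative k x) (at x)"
    using continuous_has_antiderivative[OF c] by auto
  have kc: "continuous_on UNIV (\<lambda>y. k (c - y))"
    by (intro continuous_on_compose2[OF c] continuous_intros) auto
  have "(LINT y:{a..b}|lborel. k (c - y)) = A (b - c) - A (a - c)"
  proof (rule set_integral_antiderivative[OF _ kc ab])
    show "((\<lambda>y. A (y - c)) has_real_derivative k (c - y)) (at y)" for y
      by (rule DERIV_cong[OF DERIV_chain2[OF A DERIV_diff[OF DERIV_ident DERIV_const]]])
         (use even[of "y - c"] in simp)
  qed
  also have "\<dots> = (LINT z:{a - c..b - c}|lborel. k z)"
    using ab by (intro set_integral_antiderivative[symmetric] A assms) auto
  finally show "(LINT y:{a..b}|lborel. k (c - y)) = (LINT z:{a - c..b - c}|lborel. k z)" .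
  have "(LINT y:{a..b}|lborel. k (c - y)) = (- A (c - b)) - (- A (c - a))"
  proof (rule set_integral_antiderivative[OF _ kc ab])
    show "((\<lambda>y. - A (c - y)) has_real_derivative k (c - y)) (at y)" for y
      by (rule DERIV_cong[OF DERIV_minus[OF DERIV_chain2[OF A DERIV_diff[OF DERIV_const DERIV_ident]]]]) simp
  qed
  also have "\<dots> = (LINT z:{c - b..c - a}|lborel. k z)"
    using set_integral_antiderivative[OF A c, of "c - b" "c - a"] ab by simp
  finally show "(LINT y:{a..b}|lborel. k (c - y)) = (LINT z:{c - b..c - a}|lborel. k z)" .
qed

text \<open>Exchanging sum and integral leaves, at each distance \<open>z\<close>, the number of admissible cells.\<close>

lemma set_integral_sum_indicator:
  fixes k :: "real \<Rightarrow> real" and l u :: "nat \<Rightarrow> real"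
  assumes c: "continuous_on UNIV k" and k0: "\<And>z. k z \<ge> 0" and J: "finite J"
    and sub: "\<And>j. j \<in> J \<Longrightarrow> 0 \<le> l j \<and> u j \<le> 1"
    and count: "\<And>z. z \<in> {0..1} \<Longrightarrow> real (card {j \<in> J. l j \<le> z \<and> z \<le> u j}) * h \<le> min z (1 - z) + h"
  shows "(\<Sum>j\<in>J. h * (LINT z:{l j..u j}|lborel. k z)) \<le> (LINT z:{0..1}|lborel. k z * (min z (1 - z) + h))"
proof -
  have e: "(LINT z:{l j..u j}|lborel. k z) = (LINT z:{0..1}|lborel. indicator {l j..u j} z * k z)" if "j \<in> J" for j
    unfolding set_lebesgue_integral_def
    by (rule Bochner_Integration.integral_cong) (use sub[OF that] in \<open>auto simp: indicator_def\<close>)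
  have i: "set_integrable lborel {0..1} (\<lambda>z. indicator {l j..u j} z * k z)" for j
  proof -
    have "set_integrable lborel {max (l j) 0..min (u j) 1} k"
      by (rule continuous_set_integrable[OF c])
    moreover have "(\<lambda>z. indicator {max (l j) 0..min (u j) 1} z *\<^sub>R k z) = (\<lambda>z. indicator {0..1} z *\<^sub>R (indicator {l j..u j} z * k z))"
      by (auto simp: fun_eq_iff indicator_def)
    ultimately show ?thesis unfolding set_integrable_def by simp
  qed
  have mc: "continuous_on UNIV (\<lambda>z::real. k z * (min z (1 - z) + h))"
    by (intro continuous_intros c)
  have "(\<Sum>j\<in>J. h * (LINT z:{l j..u j}|lborel. k z))
     = (\<Sum>j\<in>J. (LINT z:{0..1}|lborel. h * (indicator {l j..u j} z * k z)))"
    by (simp add: e)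
  also have "\<dots> = (LINT z:{0..1}|lborel. (\<Sum>j\<in>J. h * (indicator {l j..u j} z * k z)))"
    by (rule set_integral_sum'[symmetric]) (intro set_integrable_mult_right i)
  also have "\<dots> \<le> (LINT z:{0..1}|lborel. k z * (min z (1 - z) + h))"
  proof (rule set_integral_mono)
    show "set_integrable lborel {0..1} (\<lambda>z. \<Sum>j\<in>J. h * (indicator {l j..u j} z * k z))"
      by (intro set_integrable_sum' set_integrable_mult_right i)
    show "set_integrable lborel {0..1} (\<lambda>z. k z * (min z (1 - z) + h))"
      by (rule continuous_set_integrable[OF mc])
    fix z :: real assume z: "z \<in> {0..1}"
    have "(\<Sum>j\<in>J. h * (indicator {l j..u j} z * k z)) = k z * ((\<Sum>j\<in>J. indicator {l j..u j} z) * h)"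
      by (simp add: sum_distrib_left sum_distrib_right mult_ac)
    also have "(\<Sum>j\<in>J. indicator {l j..u j} z :: real) = real (card {j \<in> J. l j \<le> z \<and> z \<le> u j})"
    proof -
      have "(\<Sum>j\<in>J. indicator {l j..u j} z :: real) = (\<Sum>j\<in>J. if l j \<le> z \<and> z \<le> u j then 1 else 0)"
        by (intro sum.cong) (auto simp: indicator_def)
      also have "\<dots> = real (card {j \<in> J. l j \<le> z \<and> z \<le> u j})"
        using J by (simp add: sum.If_cases Int_def)
      finally show ?thesis .
    qed
    also have "k z * (real (card {j \<in> J. l j \<le> z \<and> z \<le> u j}) * h) \<le> k z * (min z (1 - z) + h)"
      using count[OF z] k0 by (intro mult_left_mono) auto
    finally show "(\<Sum>j\<in>J. h * (indicator {l j..u j} z * k z)) \<le> k z * (min z (1 - z) + h)" .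
  qed
  finally show ?thesis .
qed

text \<open>A jump at the interface \<open>i\<close> is seen from the pairs of a cell \<open>j\<close> and a point \<open>y\<close> on
  different sides of it. For a given distance \<open>z\<close> of the pair there are about \<open>z / \<Delta>x\<close> such
  cells, but also at most about \<open>(1 - z) / \<Delta>x\<close>, because both members lie in \<open>[0, 1]\<close>. Hence the
  minimum of the two, which is the periodic distance.\<close>

lemma translation_estimate:
  fixes k :: "real \<Rightarrow> real" and c :: "nat \<Rightarrow> real"
  assumes kc: "continuous_on UNIV k" and even: "\<And>z. k (- z) = k z" and k0: "\<And>z. k z \<ge> 0"
  shows "(LINT y:{0..1}|lborel. (\<Sum>j\<in>{1..N}. h * k (X j - y) * \<bar>c (cell y) - c j\<bar>))
    \<le> (\<Sum>i\<in>{1..<N}. \<bar>c (Suc i) - c i\<bar>) * (2 * (LINT z:{0..1}|lborel. k z * (min z (1 - z) + h)))"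
proof -
  let ?K = "LINT z:{0..1}|lborel. k z * (min z (1 - z) + h)"
  let ?ind = "\<lambda>i j y. (if j \<le> i then indicator {X i..1} y else indicator {0..X i} y) :: real"
  have kcj: "continuous_on UNIV (\<lambda>y. k (a - y))" for a
    by (intro continuous_on_compose2[OF kc] continuous_intros) auto
  have bmk: "bm {0..1} (\<lambda>y. k (a - y))" for a by (rule bm_continuous[OF kcj compact_Icc])
  have bmi: "bm {0..1} (\<lambda>y. ?ind i j y)" for i j
    by (auto simp: bm_def indicator_def intro!: exI[of _ 1])
  have int1: "bm {0..1} (\<lambda>y. h * k (X j - y) * (\<bar>c (Suc i) - c i\<bar> * ?ind i j y))" for i j
    by (intro bm_mult bm_const bmk bmi)
  have "(LINT y:{0..1}|lborel. (\<Sum>j\<in>{1..N}. h * k (X j - y) * \<bar>c (cell y) - c j\<bar>))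
     \<le> (LINT y:{0..1}|lborel. (\<Sum>j\<in>{1..N}. (\<Sum>i\<in>{1..<N}. h * k (X j - y) * (\<bar>c (Suc i) - c i\<bar> * ?ind i j y))))"
  proof (rule set_integral_mono)
    show "set_integrable lborel {0..1} (\<lambda>y. \<Sum>j\<in>{1..N}. h * k (X j - y) * \<bar>c (cell y) - c j\<bar>)"
      by (intro bm_integrable_Icc bm_sum bm_mult bm_const bmk bm_abs bm_diff bm_cell)
    show "set_integrable lborel {0..1} (\<lambda>y. \<Sum>j\<in>{1..N}. (\<Sum>i\<in>{1..<N}. h * k (X j - y) * (\<bar>c (Suc i) - c i\<bar> * ?ind i j y)))"
      by (intro bm_integrable_Icc bm_sum int1)
    fix y :: real assume y: "y \<in> {0..1}"
    show "(\<Sum>j\<in>{1..N}. h * k (X j - y) * \<bar>c (cell y) - c j\<bar>)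
      \<le> (\<Sum>j\<in>{1..N}. (\<Sum>i\<in>{1..<N}. h * k (X j - y) * (\<bar>c (Suc i) - c i\<bar> * ?ind i j y)))"
      unfolding sum_distrib_left[symmetric]
      by (intro sum_mono mult_left_mono path_bound y mult_nonneg_nonneg k0 less_imp_le[OF h_pos]) auto
  qed
  also have "\<dots> = (\<Sum>j\<in>{1..N}. \<Sum>i\<in>{1..<N}. (LINT y:{0..1}|lborel. h * k (X j - y) * (\<bar>c (Suc i) - c i\<bar> * ?ind i j y)))"
  proof -
    have i: "set_integrable lborel {0..1} (\<lambda>y. h * k (X j - y) * (\<bar>c (Suc i) - c i\<bar> * ?ind i j y))" for i j
      by (intro bm_integrable_Icc int1)
    show ?thesis by (subst set_integral_sum', (intro set_integrable_sum' i), intro sum.cong refl set_integral_sum' i)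
  qed
  also have "\<dots> = (\<Sum>i\<in>{1..<N}. \<bar>c (Suc i) - c i\<bar> * (\<Sum>j\<in>{1..N}. h * (LINT y:{0..1}|lborel. k (X j - y) * ?ind i j y)))"
    unfolding sum_distrib_left
    by (subst sum.swap, intro sum.cong refl)
       (simp add: set_lebesgue_integral_def mult_ac flip: Bochner_Integration.integral_mult_right_zero)
  also have "\<dots> \<le> (\<Sum>i\<in>{1..<N}. \<bar>c (Suc i) - c i\<bar> * (2 * ?K))"
  proof (intro sum_mono mult_left_mono)
    fix i assume i: "i \<in> {1..<N}"
    have Xi: "X i \<in> {0..1}" using i by (intro X_01) auto
    have sp: "{1..N} = {1..i} \<union> {Suc i..N}" "{1..i} \<inter> {Suc i..N} = {}" using i by auto
    have "(\<Sum>j\<in>{1..N}. h * (LINT y:{0..1}|lborel. k (X j - y) * ?ind i j y))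
       = (\<Sum>j\<in>{1..i}. h * (LINT y:{0..1}|lborel. k (X j - y) * ?ind i j y))
       + (\<Sum>j\<in>{Suc i..N}. h * (LINT y:{0..1}|lborel. k (X j - y) * ?ind i j y))"
      unfolding sp(1) by (rule sum.union_disjoint) (use sp(2) in auto)
    also have "(\<Sum>j\<in>{1..i}. h * (LINT y:{0..1}|lborel. k (X j - y) * ?ind i j y))
       = (\<Sum>j\<in>{1..i}. h * (LINT z:{X i - X j..1 - X j}|lborel. k z))"
    proof (intro sum.cong refl arg_cong[of _ _ "\<lambda>x. h * x"])
      fix j assume "j \<in> {1..i}"
      then have "(LINT y:{0..1}|lborel. k (X j - y) * ?ind i j y) = (LINT y:{X i..1}|lborel. k (X j - y))"
        unfolding set_lebesgue_integral_def
        by (intro Bochner_Integration.integral_cong) (use Xi in \<open>auto simp: indicator_def\<close>)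
      also have "\<dots> = (LINT z:{X i - X j..1 - X j}|lborel. k z)"
        by (rule even_kernel_integral(1)[OF kc even]) (use Xi in auto)
      finally show "(LINT y:{0..1}|lborel. k (X j - y) * ?ind i j y) = (LINT z:{X i - X j..1 - X j}|lborel. k z)" .
    qed
    also have "(\<Sum>j\<in>{Suc i..N}. h * (LINT y:{0..1}|lborel. k (X j - y) * ?ind i j y))
       = (\<Sum>j\<in>{Suc i..N}. h * (LINT z:{X j - X i..X j - 0}|lborel. k z))"
    proof (intro sum.cong refl arg_cong[of _ _ "\<lambda>x. h * x"])
      fix j assume "j \<in> {Suc i..N}"
      then have "(LINT y:{0..1}|lborel. k (X j - y) * ?ind i j y) = (LINT y:{0..X i}|lborel. k (X j - y))"
        unfolding set_lebesgue_integral_def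
        by (intro Bochner_Integration.integral_cong) (use Xi in \<open>auto simp: indicator_def\<close>)
      also have "\<dots> = (LINT z:{X j - X i..X j - 0}|lborel. k z)"
        by (rule even_kernel_integral(2)[OF kc even]) (use Xi in auto)
      finally show "(LINT y:{0..1}|lborel. k (X j - y) * ?ind i j y) = (LINT z:{X j - X i..X j - 0}|lborel. k z)" .
    qed
    also have "(\<Sum>j\<in>{1..i}. h * (LINT z:{X i - X j..1 - X j}|lborel. k z)) \<le> ?K"
    proof (rule set_integral_sum_indicator[OF kc k0])
      fix j assume "j \<in> {1..i}"
      then show "0 \<le> X i - X j \<and> 1 - X j \<le> 1" using X_mono[of j i] X_mono[of 0 j] X_0 by auto
    next
      fix z :: real assume z: "z \<in> {0..1}"
      let ?S = "{j \<in> {1..i}. X i - X j \<le> z \<and> z \<le> 1 - X j}"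
      have conv: "X i - X j \<le> z \<longleftrightarrow> real i - z / h \<le> real j" "z \<le> 1 - X j \<longleftrightarrow> real j \<le> (1 - z) / h" for j
        using h_pos by (auto simp: iface_def field_simps)
      have z': "z / h \<ge> 0" "(1 - z) / h \<ge> 0" using z h_pos by auto
      have "real (card ?S) \<le> real i - (real i - z / h) + 1"
        by (rule card_nat_interval) (use conv z' in auto)
      then have a: "real (card ?S) * h \<le> (z / h + 1) * h" using h_pos by (intro mult_right_mono) auto
      have "real (card ?S) \<le> (1 - z) / h - 1 + 1"
        by (rule card_nat_interval) (use conv z' in auto)
      then have b: "real (card ?S) * h \<le> ((1 - z) / h) * h" using h_pos by (intro mult_right_mono) auto
      show "real (card ?S) * h \<le> min z (1 - z) + h"
        using a b h_pos by (auto simp: distrib_right)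
    qed auto
    also have "(\<Sum>j\<in>{Suc i..N}. h * (LINT z:{X j - X i..X j - 0}|lborel. k z)) \<le> ?K"
    proof (rule set_integral_sum_indicator[OF kc k0])
      fix j assume "j \<in> {Suc i..N}"
      then show "0 \<le> X j - X i \<and> X j - 0 \<le> 1" using X_mono[of i j] X_01[of j] by auto
    next
      fix z :: real assume z: "z \<in> {0..1}"
      let ?S = "{j \<in> {Suc i..N}. X j - X i \<le> z \<and> z \<le> X j - 0}"
      have conv: "X j - X i \<le> z \<longleftrightarrow> real j \<le> real i + z / h" "z \<le> X j - 0 \<longleftrightarrow> z / h \<le> real j" for j
        using h_pos by (auto simp: iface_def field_simps)
      have z': "z / h \<ge> 0" "(1 - z) / h \<ge> 0" "z / h \<le> real N" using z h_pos N_h by (auto simp: field_simps)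
      have Nz: "real N - z / h = (1 - z) / h" using N_h h_pos by (simp add: field_simps)
      have "real (card ?S) \<le> (real i + z / h) - (real i + 1) + 1"
        by (rule card_nat_interval) (use conv z' in auto)
      then have a: "real (card ?S) * h \<le> (z / h) * h" using h_pos by (intro mult_right_mono) auto
      have "real (card ?S) \<le> real N - z / h + 1"
        by (rule card_nat_interval) (use conv z' in auto)
      then have b: "real (card ?S) * h \<le> ((1 - z) / h + 1) * h" unfolding Nz using h_pos by (intro mult_right_mono) auto
      show "real (card ?S) * h \<le> min z (1 - z) + h"
        using a b h_pos by (auto simp: distrib_right)
    qed auto
    finally show "(\<Sum>j\<in>{1..N}. h * (LINT y:{0..1}|lborel. k (X j - y) * ?ind i j y)) \<le> 2 * ?K" by simp
  qed auto
  finally show ?thesis by (simp add: sum_distrib_right)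
qed

end

section \<open>One step of the scheme against a fixed state\<close>

lemma abs_diff_le: "\<bar>A - A'\<bar> \<le> p \<Longrightarrow> \<bar>B - B'\<bar> \<le> q \<Longrightarrow> p + q \<le> r \<Longrightarrow> \<bar>(A - B) - (A' - B')\<bar> \<le> (r::real)"
  by linarith

locale kernel_mesh = mesh +
  fixes G :: real and \<Omega> \<omega> \<omega>' \<rho> :: "real \<Rightarrow> real"
  assumes G1: "G \<ge> 1" and kp: "kernel_pair N G \<Omega> \<omega> \<omega>' \<rho>"
begin

text \<open>The width of the kernel.\<close>

definition \<epsilon> :: real where "\<epsilon> = sqrt h"

lemma eps_pos: "\<epsilon> > 0" using h_pos by (simp add: \<epsilon>_def)
lemma eps_sq: "\<epsilon> * \<epsilon> = h" using h_pos by (simp add: \<epsilon>_def)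
lemma eps_le1: "\<epsilon> \<le> 1" using h_le1 by (simp add: \<epsilon>_def)
lemma h_le_eps: "h \<le> \<epsilon>" using eps_sq eps_pos eps_le1 mult_left_mono[of \<epsilon> 1 \<epsilon>] by simp
lemma sqrtN: "sqrt N = 1 / \<epsilon>" by (simp add: \<epsilon>_def dx_def real_sqrt_divide)
lemma h_inv: "1 / real N = h" by (simp add: dx_def)
lemma N_eps: "real N * (\<epsilon> * \<epsilon>) = 1" using N_h eps_sq by simp

lemma smooth_Om: "Ck1 k \<Omega>" and d_Om: "(\<Omega> has_real_derivative \<omega> x) (at x)"
  and d_om: "(\<omega> has_real_derivative \<omega>' x) (at x)" and om_pos: "\<omega> z > 0"
  and om_per: "\<omega> (z + 1) = \<omega> z" and om_even: "\<omega> (- z) = \<omega> z" and Om_per: "\<Omega> (z + 1) = \<Omega> z + 1"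
  and om'_bound: "\<bar>\<omega>' z\<bar> \<le> G / \<epsilon> * \<omega> z"
  and om_near: "\<bar>x - y\<bar> \<le> h \<Longrightarrow> \<omega> x \<le> G * \<omega> y"
  and rho_near: "\<bar>x - y\<bar> \<le> h \<Longrightarrow> \<rho> x \<le> G * \<rho> y"
  and rho_cont: "continuous_on UNIV \<rho>" and rho_per: "\<rho> (z + 1) = \<rho> z"
  and rho_eq: "\<rho> z = (1 + N * (sin (pi * z))\<^sup>2) * \<omega> z"
  and rho_int: "(LINT z:{0..1}|lborel. \<rho> z) \<le> G"
  using kp unfolding kernel_pair_def sqrtN h_inv times_divide_eq_right mult_1_right by blast+

lemma om_cont: "continuous_on UNIV \<omega>"
  using d_om by (auto intro!: continuous_at_imp_continuous_on intro: DERIV_isCont)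

lemma Om_cont: "continuous_on UNIV \<Omega>"
  using d_Om by (auto intro!: continuous_at_imp_continuous_on intro: DERIV_isCont)

definition s :: "real \<Rightarrow> real" where "s z = \<bar>sin (pi * z)\<bar>"

lemma s_nonneg: "s z \<ge> 0" by (simp add: s_def)

lemma square_bounds: "(1 + x)\<^sup>2 \<le> 2 * (1 + x\<^sup>2)" "4 * x \<le> (1 + x)\<^sup>2" for x :: real
  using zero_le_power2[of "1 - x"] unfolding power2_eq_square by (simp_all add: algebra_simps)

text \<open>Zeroth, first and second moments of \<open>\<omega>\<close> at the scale \<open>\<epsilon>\<close> are all dominated by \<open>\<rho>\<close>.\<close>

lemma kernel_dominated: "\<omega> z * (1 + s z / \<epsilon>)\<^sup>2 \<le> 2 * \<rho> z"
proof -
  have "N * (s z)\<^sup>2 = (s z / \<epsilon>)\<^sup>2" using N_eps eps_pos by (simp add: power2_eq_square field_simps)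
  then have r: "\<rho> z = (1 + (s z / \<epsilon>)\<^sup>2) * \<omega> z" by (simp add: rho_eq s_def)
  have "\<omega> z * (1 + s z / \<epsilon>)\<^sup>2 \<le> \<omega> z * (2 * (1 + (s z / \<epsilon>)\<^sup>2))"
    using om_pos[of z] by (intro mult_left_mono square_bounds) auto
  then show ?thesis unfolding r by (simp add: mult_ac)
qed

lemma rho_nonneg: "\<rho> z \<ge> 0" using om_pos[of z] by (simp add: rho_eq)

lemma om_s_rho: "\<omega> z * (s z / \<epsilon>) \<le> \<rho> z"
proof -
  have "\<omega> z * (4 * (s z / \<epsilon>)) \<le> \<omega> z * (1 + s z / \<epsilon>)\<^sup>2"
    by (intro mult_left_mono less_imp_le[OF om_pos] square_bounds)
  also have "\<dots> \<le> 2 * \<rho> z" by (rule kernel_dominated)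
  finally have "4 * (\<omega> z * (s z / \<epsilon>)) \<le> 2 * \<rho> z" by (simp add: mult_ac)
  then show ?thesis using rho_nonneg[of z] by linarith
qed

text \<open>The weights form a smooth partition of unity in the index \<open>j\<close>: the mass of the cell \<open>j\<close>
  under the kernel centred at \<open>y\<close>. The function \<open>w'\<close> is the derivative in \<open>y\<close>.\<close>

definition W :: "nat \<Rightarrow> real \<Rightarrow> real" where "W j y = \<Omega> (X j - y) - \<Omega> (X (j - 1) - y)"
definition w' :: "nat \<Rightarrow> real \<Rightarrow> real" where "w' j y = \<omega> (X (j - 1) - y) - \<omega> (X j - y)"

lemma W_deriv: "(W j has_real_derivative w' j y) (at y)"
proof -
  have "((\<lambda>y. \<Omega> (a - y)) has_real_derivative - \<omega> (a - y)) (at y)" for a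
    by (rule DERIV_cong[OF DERIV_chain2[OF d_Om DERIV_diff[OF DERIV_const DERIV_ident]]]) simp
  from DERIV_diff[OF this[of "X j"] this[of "X (j - 1)"]] show ?thesis
    by (simp add: W_def[abs_def] w'_def)
qed

lemma W_smooth: "Ck1 k (W j)"
  using Ck1_diff[OF Ck1_affine_arg[OF smooth_Om, of k "-1" "X j"] Ck1_affine_arg[OF smooth_Om, of k "-1" "X (j - 1)"]]
  by (simp add: W_def[abs_def])

lemma W_per: "W j (y + 1) = W j y"
  using Om_per[of "X j - y - 1"] Om_per[of "X (j - 1) - y - 1"] by (simp add: W_def algebra_simps)

lemma W_mean:
  assumes "j \<ge> 1"
  obtains \<xi> where "X (j - 1) - y \<le> \<xi>" "\<xi> \<le> X j - y" "W j y = h * \<omega> \<xi>"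
proof -
  obtain \<xi> where "min (X (j - 1) - y) (X j - y) \<le> \<xi>" "\<xi> \<le> max (X (j - 1) - y) (X j - y)"
     "\<Omega> (X j - y) - \<Omega> (X (j - 1) - y) = ((X j - y) - (X (j - 1) - y)) * \<omega> \<xi>"
    using MVT_between[of \<Omega> \<omega> "X (j - 1) - y" "X j - y"] d_Om by metis
  then show ?thesis using that[of \<xi>] X_pred[OF assms] h_pos unfolding W_def by (auto simp: min_def max_def split: if_splits)
qed

lemma W_pos: "j \<ge> 1 \<Longrightarrow> W j y > 0"
  using W_mean[of j y] om_pos h_pos by (metis mult_pos_pos)

lemma W_le: assumes "j \<ge> 1" shows "W j y \<le> G * (h * \<omega> (X j - y))"
proof -
  obtain \<xi> where \<xi>: "X (j - 1) - y \<le> \<xi>" "\<xi> \<le> X j - y" "W j y = h * \<omega> \<xi>" using W_mean[OF assms] .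
  have "\<omega> \<xi> \<le> G * \<omega> (X j - y)" using \<xi> X_pred[OF assms] by (intro om_near) auto
  then have "h * \<omega> \<xi> \<le> h * (G * \<omega> (X j - y))" using h_pos by (intro mult_left_mono) auto
  then show ?thesis using \<xi> by (simp add: mult_ac)
qed

lemma om'_near: assumes "\<bar>x - z\<bar> \<le> h" shows "\<bar>\<omega>' x\<bar> \<le> G\<^sup>2 / \<epsilon> * \<omega> z"
proof -
  have "\<bar>\<omega>' x\<bar> \<le> G / \<epsilon> * \<omega> x" by (rule om'_bound)
  also have "\<dots> \<le> G / \<epsilon> * (G * \<omega> z)" using om_near[OF assms] G1 eps_pos by (intro mult_left_mono) auto
  finally show ?thesis by (simp add: power2_eq_square)
qed

lemma om_diff: assumes "\<bar>x - z\<bar> \<le> h" shows "\<bar>\<omega> x - \<omega> z\<bar> \<le> h * (G\<^sup>2 / \<epsilon> * \<omega> z)"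
proof -
  obtain \<xi> where \<xi>: "min z x \<le> \<xi>" "\<xi> \<le> max z x" "\<omega> x - \<omega> z = (x - z) * \<omega>' \<xi>"
    using MVT_between[of \<omega> \<omega>' z x] d_om by metis
  have "\<bar>\<omega> x - \<omega> z\<bar> = \<bar>x - z\<bar> * \<bar>\<omega>' \<xi>\<bar>" using \<xi> by (simp add: abs_mult)
  also have "\<dots> \<le> h * (G\<^sup>2 / \<epsilon> * \<omega> z)"
    using assms \<xi> h_pos by (intro mult_mono om'_near) (auto simp: min_def max_def split: if_splits)
  finally show ?thesis .
qed

lemma w'_bound: "j \<ge> 1 \<Longrightarrow> \<bar>w' j y\<bar> \<le> G\<^sup>2 * (h / \<epsilon>) * \<omega> (X j - y)"
  using om_diff[of "X (j - 1) - y" "X j - y"] h_pos X_pred[of j] by (simp add: w'_def mult_ac)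

lemma W_Suc_om: "\<bar>\<omega> (X j - y) - W (Suc j) y / h\<bar> \<le> G\<^sup>2 * (h / \<epsilon>) * \<omega> (X j - y)"
proof -
  obtain \<xi> where \<xi>: "X j - y \<le> \<xi>" "\<xi> \<le> X (Suc j) - y" "W (Suc j) y = h * \<omega> \<xi>" using W_mean[of "Suc j" y] by auto
  then have "\<bar>\<omega> \<xi> - \<omega> (X j - y)\<bar> \<le> h * (G\<^sup>2 / \<epsilon> * \<omega> (X j - y))"
    by (intro om_diff) (auto simp: X_Suc)
  then show ?thesis using \<xi> h_pos by (simp add: abs_minus_commute mult_ac)
qed

text \<open>A second difference of \<open>\<Omega>\<close> with step \<open>\<Delta>x\<close> is \<open>\<Delta>x\<^sup>2\<close> times a value of the derivative of \<open>\<omega>\<close>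
  at distance at most \<open>\<Delta>x\<close>.\<close>

lemma W_diff: assumes "j \<ge> 1"
  shows "\<bar>W (Suc j) y - W j y\<bar> / h \<le> G\<^sup>2 * (h / \<epsilon>) * \<omega> (X j - y)"
proof -
  define g where "g = (\<lambda>z. \<Omega> (z + h) - \<Omega> z)"
  have dg: "(g has_real_derivative \<omega> (z + h) - \<omega> z) (at z)" for z
    unfolding g_def
    by (rule DERIV_cong[OF DERIV_diff[OF DERIV_chain2[OF d_Om DERIV_add[OF DERIV_ident DERIV_const]] d_Om]]) simp
  obtain \<xi> where \<xi>: "min (X (j - 1) - y) (X j - y) \<le> \<xi>" "\<xi> \<le> max (X (j - 1) - y) (X j - y)"
    "g (X j - y) - g (X (j - 1) - y) = ((X j - y) - (X (j - 1) - y)) * (\<omega> (\<xi> + h) - \<omega> \<xi>)"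
    using MVT_between[of g "\<lambda>z. \<omega> (z + h) - \<omega> z" "X (j - 1) - y" "X j - y"] dg by metis
  obtain \<zeta> where \<zeta>: "min \<xi> (\<xi> + h) \<le> \<zeta>" "\<zeta> \<le> max \<xi> (\<xi> + h)" "\<omega> (\<xi> + h) - \<omega> \<xi> = ((\<xi> + h) - \<xi>) * \<omega>' \<zeta>"
    using MVT_between[of \<omega> \<omega>' \<xi> "\<xi> + h"] d_om by metis
  have Xj: "X j - X (j - 1) = h" using X_pred[OF assms] by simp
  have "W (Suc j) y - W j y = g (X j - y) - g (X (j - 1) - y)"
  proof -
    have "X j - y + h = X (Suc j) - y" "X (j - 1) - y + h = X j - y" using Xj by (auto simp: X_Suc)
    then show ?thesis unfolding W_def g_def by (simp only: diff_Suc_1)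
  qed
  also have "\<dots> = h * (h * \<omega>' \<zeta>)" using \<xi>(3) \<zeta>(3) Xj by simp
  finally have "\<bar>W (Suc j) y - W j y\<bar> / h = h * \<bar>\<omega>' \<zeta>\<bar>" using h_pos by (simp add: abs_mult)
  also have "\<dots> \<le> h * (G\<^sup>2 / \<epsilon> * \<omega> (X j - y))"
  proof (intro mult_left_mono om'_near)
    show "\<bar>\<zeta> - (X j - y)\<bar> \<le> h" using \<xi>(1,2) \<zeta>(1,2) Xj h_pos by (auto simp: min_def max_def split: if_splits)
  qed (use h_pos in auto)
  finally show ?thesis by (simp add: mult_ac)
qed

lemma W_right: "j \<in> {1..N} \<Longrightarrow> W (right j) y = W (Suc j) y"
  using Om_per[of "h - y"] Om_per[of "0 - y"]
  by (auto simp: right_def W_def X_Suc X_N X_0 algebra_simps)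

lemma sum_W: "(\<Sum>j\<in>{1..N}. W j y) = 1"
proof -
  have "(\<Sum>j\<in>{1..N}. W j y) = \<Omega> (X N - y) - \<Omega> (X 0 - y)"
    unfolding W_def using sum_diff_pred[of "\<lambda>j. \<Omega> (X j - y)"] by simp
  then show ?thesis using Om_per[of "- y"] by (simp add: X_N X_0)
qed

lemma W_le1: "j \<in> {1..N} \<Longrightarrow> W j y \<le> 1"
  using member_le_sum[of j "{1..N}" "\<lambda>j. W j y"] W_pos sum_W[of y] by (auto intro: less_imp_le)

text \<open>Summation by parts on the periodic grid.\<close>

lemma sum_shift:
  fixes q Z :: "nat \<Rightarrow> real"
  assumes "Z 0 = Z N"
  shows "(\<Sum>j\<in>{1..N}. q j * Z (j - 1)) = (\<Sum>j\<in>{1..N}. q (right j) * Z j)"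
proof -
  have "(\<Sum>j\<in>{1..N}. q j * Z (j - 1)) = (\<Sum>j\<in>{1..N}. q (right j) * Z (right j - 1))"
    by (rule sum_right[symmetric])
  also have "\<dots> = (\<Sum>j\<in>{1..N}. q (right j) * Z j)"
    using assms by (intro sum.cong) (auto simp: right_def)
  finally show ?thesis .
qed

text \<open>The Kruzkov entropy flux of \<open>f\<close>.\<close>

definition q :: "real \<Rightarrow> real \<Rightarrow> real \<Rightarrow> real" where
  "q x u k = sgn (u - k) * (f x u - f x k)"

lemma q_maxmin: "q x u k = f x (max k u) - f x (min k u)"
  by (auto simp: q_def sgn_if max_def min_def)

lemma q_lip: "\<bar>q x u k - q x u k'\<bar> \<le> 2 * L * \<bar>k - k'\<bar>"
proof -
  have a: "\<bar>f x (max k u) - f x (max k' u)\<bar> \<le> 2 * L * \<bar>max k u - max k' u\<bar>" by (rule f_lip)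
  have b: "\<bar>f x (min k u) - f x (min k' u)\<bar> \<le> 2 * L * \<bar>min k u - min k' u\<bar>" by (rule f_lip)
  have "\<bar>max k u - max k' u\<bar> + \<bar>min k u - min k' u\<bar> = \<bar>k - k'\<bar>" by (auto simp: max_def min_def)
  then have "2 * L * \<bar>max k u - max k' u\<bar> + 2 * L * \<bar>min k u - min k' u\<bar> = 2 * L * \<bar>k - k'\<bar>"
    by (simp flip: distrib_left)
  then show ?thesis unfolding q_maxmin by (intro abs_diff_le[OF a b]) simp
qed

text \<open>The function \<open>x \<mapsto> f x u - f x k\<close> is periodic with Lipschitz constant proportional to
  \<open>\<bar>u - k\<bar>\<close>. It is this factor that turns the explicit dependence of the flux on \<open>x\<close> into a term
  controlled by \<open>Phi\<close>.\<close>

lemma q_x: assumes "x \<in> {0..1}" "y \<in> {0..1}"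
  shows "\<bar>q x u k - q y u k\<bar> \<le> 2 * L * \<bar>u - k\<bar> * s (x - y)"
proof -
  have "\<bar>(f x u - f x k) - (f y u - f y k)\<bar> \<le> (L * (2 * \<bar>u - k\<bar>)) * \<bar>sin (pi * (x - y))\<bar>"
  proof (rule periodic_lipschitz[of "\<lambda>x. f x u - f x k", OF _ _ assms])
    show "f (x + 1) u - f (x + 1) k = f x u - f x k" for x by (simp add: f_per)
    show "\<bar>f x u - f x k - (f y u - f y k)\<bar> \<le> L * (2 * \<bar>u - k\<bar>) * \<bar>x - y\<bar>" for x y
      using F_xlip[of x u u y k k] by (simp add: F_cons algebra_simps)
  qed
  moreover have "\<bar>q x u k - q y u k\<bar> \<le> \<bar>(f x u - f x k) - (f y u - f y k)\<bar>"
    by (auto simp: q_def sgn_if)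
  ultimately show ?thesis by (simp add: s_def mult_ac)
qed

lemma eflux_q: assumes "j \<in> {1..N}"
  shows "\<bar>eflux v (\<lambda>_. u) j - q (X j) u (v j)\<bar> \<le> 2 * L * \<bar>v (right j) - v j\<bar>"
proof -
  have pk: "per N (\<lambda>_. u) i = u" for i by (simp add: per_def)
  let ?b = "v j" and ?c = "v (right j)"
  have a: "\<bar>F (X j) (max ?b u) (max ?c u) - F (X j) (max ?b u) (max ?b u)\<bar> \<le> L * \<bar>max ?c u - max ?b u\<bar>"
    using F_lip[of "X j" "max ?b u" "max ?c u" "max ?b u" "max ?b u"] by simp
  have b: "\<bar>F (X j) (min ?b u) (min ?c u) - F (X j) (min ?b u) (min ?b u)\<bar> \<le> L * \<bar>min ?c u - min ?b u\<bar>"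
    using F_lip[of "X j" "min ?b u" "min ?c u" "min ?b u" "min ?b u"] by simp
  have c: "L * \<bar>max ?c u - max ?b u\<bar> \<le> L * \<bar>?c - ?b\<bar>" "L * \<bar>min ?c u - min ?b u\<bar> \<le> L * \<bar>?c - ?b\<bar>"
    using L1 by (auto intro!: mult_left_mono simp: max_def min_def)
  have "eflux v (\<lambda>_. u) j = F (X j) (max ?b u) (max ?c u) - F (X j) (min ?b u) (min ?c u)"
    unfolding eflux_def eflux_at_def pk using per_in[OF assms] per_right[OF assms] by simp
  moreover have "L * \<bar>max ?c u - max ?b u\<bar> + L * \<bar>min ?c u - min ?b u\<bar> \<le> 2 * L * \<bar>?c - ?b\<bar>"
    using add_mono[OF c] by simp
  ultimately show ?thesis unfolding q_maxmin using abs_diff_le[OF a b] by (simp only: F_cons)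
qed

text \<open>The integrand of the entropy inequality for the constants \<open>a j\<close> and the test functions
  \<open>W j\<close>, without the time derivative; \<open>P\<close> stands for the value of the nonlocal source.\<close>

definition r :: "(nat \<Rightarrow> real) \<Rightarrow> real \<Rightarrow> real \<Rightarrow> real \<Rightarrow> real" where
  "r a u y P = (\<Sum>j\<in>{1..N}. q y u (a j) * w' j y - sgn (u - a j) * fx y (a j) * W j y + sgn (u - a j) * P * W j y)"

text \<open>The terms whose sign cannot be matched in one time step. Only the sign depends on \<open>a\<close>.\<close>

definition z :: "(nat \<Rightarrow> real) \<Rightarrow> real \<Rightarrow> real \<Rightarrow> real \<Rightarrow> real" where
  "z a u y P = (\<Sum>j\<in>{1..N}. sgn (a j - u) * (P - fx y u) * W j y)"

definition flux_err where
  "flux_err a b u y = (\<Sum>j\<in>{1..N}. (4 * L * \<bar>a (right j) - a j\<bar> + 2 * L * \<bar>b j - a j\<bar> + 2 * L * \<bar>u - a j\<bar> * s (X j - y))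
           * (G\<^sup>2 * (h / \<epsilon>) * \<omega> (X j - y)))"

text \<open>Summation by parts moves all differences onto the weights. The discrete derivative
  \<open>(W (j+1) - W j) / \<Delta>x\<close> and the exact derivative \<open>w'\<close> then have opposite signs and cancel up to
  \<open>O(\<Delta>x / \<epsilon>)\<close> times the jumps of \<open>a\<close>; evaluating \<open>f\<close> at \<open>y\<close> instead of \<open>X j\<close> leaves the term
  with \<open>\<bar>u - a j\<bar>\<close>.\<close>

lemma flux_part:
  fixes a b :: "nat \<Rightarrow> real"
  assumes y: "y \<in> {0..1}" and \<theta>: "0 \<le> \<theta>" "\<theta> \<le> 1"
  shows "- (1 / h) * (\<Sum>j\<in>{1..N}. (eflux a (\<lambda>_. u) j - eflux a (\<lambda>_. u) (j - 1)) * W j y)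
      + (1 - \<theta>) * (\<Sum>j\<in>{1..N}. q y u (a j) * w' j y) + \<theta> * (\<Sum>j\<in>{1..N}. q y u (b j) * w' j y)
    \<le> flux_err a b u y"
proof -
  let ?Q = "\<lambda>j. eflux a (\<lambda>_. u) j"
  let ?D = "\<lambda>j. (W (Suc j) y - W j y) / h"
  let ?K = "\<lambda>j. G\<^sup>2 * (h / \<epsilon>) * \<omega> (X j - y)"
  have K0: "?K j \<ge> 0" for j using om_pos[of "X j - y"] h_pos eps_pos by (simp add: zero_le_mult_iff)
  have "(\<Sum>j\<in>{1..N}. (?Q j - ?Q (j - 1)) * W j y) = (\<Sum>j\<in>{1..N}. ?Q j * W j y) - (\<Sum>j\<in>{1..N}. W j y * ?Q (j - 1))"
    unfolding sum_subtractf[symmetric] by (intro sum.cong refl) (simp add: algebra_simps)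
  also have "(\<Sum>j\<in>{1..N}. W j y * ?Q (j - 1)) = (\<Sum>j\<in>{1..N}. W (right j) y * ?Q j)"
    by (rule sum_shift) (simp add: eflux_N)
  also have "\<dots> = (\<Sum>j\<in>{1..N}. W (Suc j) y * ?Q j)" by (intro sum.cong) (auto simp: W_right)
  finally have e1: "- (1 / h) * (\<Sum>j\<in>{1..N}. (?Q j - ?Q (j - 1)) * W j y) = (\<Sum>j\<in>{1..N}. ?Q j * ?D j)"
  proof -
    assume e: "(\<Sum>j\<in>{1..N}. (?Q j - ?Q (j - 1)) * W j y) = (\<Sum>j\<in>{1..N}. ?Q j * W j y) - (\<Sum>j\<in>{1..N}. W (Suc j) y * ?Q j)"
    show ?thesis unfolding e sum_subtractf[symmetric] sum_distrib_left
      by (intro sum.cong refl) (simp add: algebra_simps diff_divide_distrib)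
  qed
  have e2: "(\<Sum>j\<in>{1..N}. q y u (a j) * ?D j) + (\<Sum>j\<in>{1..N}. q y u (a j) * w' j y)
     = (\<Sum>j\<in>{1..N}. (q y u (a (right j)) - q y u (a j)) * (\<omega> (X j - y) - W (Suc j) y / h))"
  proof -
    have "(\<Sum>j\<in>{1..N}. q y u (a j) * \<omega> (X (j - 1) - y)) = (\<Sum>j\<in>{1..N}. q y u (a (right j)) * \<omega> (X j - y))"
      by (rule sum_shift[of "\<lambda>j. \<omega> (X j - y)" "\<lambda>j. q y u (a j)"]) (use om_per[of "- y"] in \<open>simp add: X_0 X_N\<close>)
    moreover have "(\<Sum>j\<in>{1..N}. q y u (a j) * (W j y / h)) = (\<Sum>j\<in>{1..N}. q y u (a (right j)) * (W (Suc j) y / h))"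
      using sum_right[of "\<lambda>j. q y u (a j) * (W j y / h)"] by (simp add: W_right)
    ultimately show ?thesis
      by (simp only: w'_def left_diff_distrib right_diff_distrib diff_divide_distrib sum_subtractf)
  qed
  have "(\<Sum>j\<in>{1..N}. ?Q j * ?D j) + (1 - \<theta>) * (\<Sum>j\<in>{1..N}. q y u (a j) * w' j y) + \<theta> * (\<Sum>j\<in>{1..N}. q y u (b j) * w' j y)
    = (\<Sum>j\<in>{1..N}. (?Q j - q (X j) u (a j)) * ?D j) + (\<Sum>j\<in>{1..N}. (q (X j) u (a j) - q y u (a j)) * ?D j)
     + ((\<Sum>j\<in>{1..N}. q y u (a j) * ?D j) + (\<Sum>j\<in>{1..N}. q y u (a j) * w' j y))
     + \<theta> * (\<Sum>j\<in>{1..N}. (q y u (b j) - q y u (a j)) * w' j y)"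
  proof -
    have "A + (1 - t) * D + t * E = (A - B) + (B - C) + (C + D) + t * (E - D)" for A B C D E t :: real
      by (simp add: algebra_simps)
    then show ?thesis unfolding left_diff_distrib sum_subtractf .
  qed
  also have "\<dots> \<le> (\<Sum>j\<in>{1..N}. 2 * L * \<bar>a (right j) - a j\<bar> * ?K j) + (\<Sum>j\<in>{1..N}. 2 * L * \<bar>u - a j\<bar> * s (X j - y) * ?K j)
     + (\<Sum>j\<in>{1..N}. 2 * L * \<bar>a (right j) - a j\<bar> * ?K j) + (\<Sum>j\<in>{1..N}. 2 * L * \<bar>b j - a j\<bar> * ?K j)"
    unfolding e2
  proof (intro add_mono)
    have D: "\<bar>?D j\<bar> \<le> ?K j" if "j \<in> {1..N}" for j using W_diff[of j y] that h_pos by auto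
    have prod: "x * d \<le> A * K" if "\<bar>x\<bar> \<le> A" "\<bar>d\<bar> \<le> K" for x d A K :: real
    proof -
      have "x * d \<le> \<bar>x\<bar> * \<bar>d\<bar>" by (simp add: abs_mult[symmetric])
      also have "\<dots> \<le> A * K" using that by (intro mult_mono) auto
      finally show ?thesis .
    qed
    show "(\<Sum>j\<in>{1..N}. (?Q j - q (X j) u (a j)) * ?D j) \<le> (\<Sum>j\<in>{1..N}. 2 * L * \<bar>a (right j) - a j\<bar> * ?K j)"
      by (intro sum_mono prod eflux_q D)
    show "(\<Sum>j\<in>{1..N}. (q (X j) u (a j) - q y u (a j)) * ?D j) \<le> (\<Sum>j\<in>{1..N}. 2 * L * \<bar>u - a j\<bar> * s (X j - y) * ?K j)"
      by (intro sum_mono prod q_x y D) (auto intro!: X_01[unfolded atLeastAtMost_iff])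
    show "(\<Sum>j\<in>{1..N}. (q y u (a (right j)) - q y u (a j)) * (\<omega> (X j - y) - W (Suc j) y / h))
      \<le> (\<Sum>j\<in>{1..N}. 2 * L * \<bar>a (right j) - a j\<bar> * ?K j)"
      by (intro sum_mono prod q_lip W_Suc_om)
    have "\<theta> * (\<Sum>j\<in>{1..N}. (q y u (b j) - q y u (a j)) * w' j y) \<le> \<theta> * (\<Sum>j\<in>{1..N}. 2 * L * \<bar>b j - a j\<bar> * ?K j)"
      by (intro mult_left_mono sum_mono prod q_lip w'_bound \<theta>) auto
    also have "\<dots> \<le> 1 * (\<Sum>j\<in>{1..N}. 2 * L * \<bar>b j - a j\<bar> * ?K j)"
      using L1 K0 by (intro mult_right_mono \<theta> sum_nonneg mult_nonneg_nonneg) (auto simp: less_imp_le[OF om_pos] less_imp_le[OF h_pos] less_imp_le[OF eps_pos])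
    finally show "\<theta> * (\<Sum>j\<in>{1..N}. (q y u (b j) - q y u (a j)) * w' j y) \<le> (\<Sum>j\<in>{1..N}. 2 * L * \<bar>b j - a j\<bar> * ?K j)" by simp
  qed
  also have "\<dots> = (\<Sum>j\<in>{1..N}. (4 * L * \<bar>a (right j) - a j\<bar> + 2 * L * \<bar>b j - a j\<bar> + 2 * L * \<bar>u - a j\<bar> * s (X j - y)) * ?K j)"
    unfolding sum.distrib[symmetric] by (intro sum.cong refl) (simp add: algebra_simps)
  finally show ?thesis unfolding e1 flux_err_def .
qed

text \<open>All terms are compared with \<open>P - fx y u\<close>, which depends on the point \<open>y\<close> but neither on
  the cell nor on the numerical solution. What does not match is then a pure difference of
  signs.\<close>

lemma source_part:
  assumes j: "j \<in> {1..N}" and y: "y \<in> {0..1}" and \<theta>: "0 \<le> \<theta>" "\<theta> \<le> 1" and u: "\<bar>u\<bar> \<le> B"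
    and L2: "\<And>x y w. \<bar>w\<bar> \<le> B \<Longrightarrow> \<bar>fx x w - fx y w\<bar> \<le> L2 * \<bar>x - y\<bar>" "L2 \<ge> 0"
  shows "sgn (bj - u) * (Pj - (f (X j) u - f (X (j - 1)) u) / h)
     + (1 - \<theta>) * (- sgn (u - aj) * fx y aj + sgn (u - aj) * P) + \<theta> * (- sgn (u - bj) * fx y bj + sgn (u - bj) * P)
   \<le> (1 - \<theta>) * (sgn (bj - u) * (P - fx y u) - sgn (aj - u) * (P - fx y u))
     + (\<bar>Pj - P\<bar> + L2 * (s (X j - y) + h) + L * ((1 - \<theta>) * \<bar>u - aj\<bar> + \<theta> * \<bar>u - bj\<bar>))"
proof -
  have j1: "j \<ge> 1" using j by auto
  define D where "D = (f (X j) u - f (X (j - 1)) u) / h"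
  obtain \<xi> where \<xi>: "min (X (j - 1)) (X j) \<le> \<xi>" "\<xi> \<le> max (X (j - 1)) (X j)"
      "f (X j) u - f (X (j - 1)) u = (X j - X (j - 1)) * fx \<xi> u"
    using MVT_between[of "\<lambda>s. f s u" "\<lambda>s. fx s u" "X (j - 1)" "X j"] f_dx by metis
  have Xj: "X j - X (j - 1) = h" using X_pred[OF j1] by simp
  have D\<xi>: "D = fx \<xi> u" using \<xi>(3) Xj h_pos by (simp add: D_def)
  have \<xi>h: "\<bar>\<xi> - X j\<bar> \<le> h" using \<xi>(1,2) Xj h_pos by (auto simp: min_def max_def split: if_splits)
  have fxper: "fx (x + 1) u = fx x u" for x
  proof -
    have "((\<lambda>s. f (s + 1) u) has_real_derivative fx (x + 1) u) (at x)"
      by (rule DERIV_cong[OF DERIV_chain2[OF f_dx DERIV_add[OF DERIV_ident DERIV_const]]]) simp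
    then have "((\<lambda>s. f s u) has_real_derivative fx (x + 1) u) (at x)" by (simp add: f_per)
    then show ?thesis using f_dx DERIV_unique by blast
  qed
  have "\<bar>fx \<xi> u - fx (X j) u\<bar> \<le> L2 * h"
    using order_trans[OF L2(1)[OF u] mult_left_mono[OF \<xi>h L2(2)]] .
  moreover have "\<bar>fx (X j) u - fx y u\<bar> \<le> L2 * s (X j - y)" unfolding s_def
    using periodic_lipschitz[of "\<lambda>x. fx x u" L2, OF fxper L2(1)[OF u] X_01 y] j by auto
  ultimately have Dy: "\<bar>D - fx y u\<bar> \<le> L2 * (s (X j - y) + h)" unfolding D\<xi> by (simp add: distrib_left)
  have flip: "sgn (u - x) = - sgn (x - u)" for x by (simp add: sgn_if)
  have sb: "\<bar>sgn x * t\<bar> \<le> \<bar>t\<bar>" for x t :: real by (auto simp: sgn_if)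
  have 1: "sgn (bj - u) * (Pj - P) \<le> \<bar>Pj - P\<bar>" using sb[of "bj - u" "Pj - P"] by linarith
  have 2: "sgn (bj - u) * (fx y u - D) \<le> L2 * (s (X j - y) + h)" using sb[of "bj - u" "fx y u - D"] Dy by linarith
  have 3: "sgn (aj - u) * (fx y aj - fx y u) \<le> L * \<bar>u - aj\<bar>"
    using sb[of "aj - u" "fx y aj - fx y u"] fx_lip[of y aj u] by (simp add: abs_minus_commute)
  have 4: "sgn (bj - u) * (fx y bj - fx y u) \<le> L * \<bar>u - bj\<bar>"
    using sb[of "bj - u" "fx y bj - fx y u"] fx_lip[of y bj u] by (simp add: abs_minus_commute)
  have 5: "(1 - \<theta>) * (sgn (aj - u) * (fx y aj - fx y u)) + \<theta> * (sgn (bj - u) * (fx y bj - fx y u))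
     \<le> (1 - \<theta>) * (L * \<bar>u - aj\<bar>) + \<theta> * (L * \<bar>u - bj\<bar>)"
    using 3 4 \<theta> by (intro add_mono mult_left_mono) auto
  have "sgn (bj - u) * (Pj - D)
     + (1 - \<theta>) * (- sgn (u - aj) * fx y aj + sgn (u - aj) * P) + \<theta> * (- sgn (u - bj) * fx y bj + sgn (u - bj) * P)
    = (1 - \<theta>) * (sgn (bj - u) * (P - fx y u) - sgn (aj - u) * (P - fx y u))
     + sgn (bj - u) * (Pj - P) + sgn (bj - u) * (fx y u - D)
     + ((1 - \<theta>) * (sgn (aj - u) * (fx y aj - fx y u)) + \<theta> * (sgn (bj - u) * (fx y bj - fx y u)))"
    unfolding flip by (simp add: algebra_simps)
  also have "\<dots> \<le> (1 - \<theta>) * (sgn (bj - u) * (P - fx y u) - sgn (aj - u) * (P - fx y u))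
     + \<bar>Pj - P\<bar> + L2 * (s (X j - y) + h) + ((1 - \<theta>) * (L * \<bar>u - aj\<bar>) + \<theta> * (L * \<bar>u - bj\<bar>))"
    using 1 2 5 by linarith
  finally show ?thesis unfolding D_def by (simp add: algebra_simps)
qed

definition phi :: "(nat \<Rightarrow> real) \<Rightarrow> real \<Rightarrow> real \<Rightarrow> real" where
  "phi a u y = (\<Sum>j\<in>{1..N}. \<bar>u - a j\<bar> * W j y)"

definition source_err where
  "source_err L2 \<theta> a b u y P = (\<Sum>j\<in>{1..N}. (\<bar>P_disc N a j - P\<bar> + L2 * (s (X j - y) + h)
     + L * ((1 - \<theta>) * \<bar>u - a j\<bar> + \<theta> * \<bar>u - b j\<bar>)) * W j y)"

lemma pointwise_step:
  assumes y: "y \<in> {0..1}" and \<theta>: "0 \<le> \<theta>" "\<theta> \<le> 1" and u: "\<bar>u\<bar> \<le> B"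
    and L2: "\<And>x y w. \<bar>w\<bar> \<le> B \<Longrightarrow> \<bar>fx x w - fx y w\<bar> \<le> L2 * \<bar>x - y\<bar>" "L2 \<ge> 0"
    and b: "\<And>j. j \<in> {1..N} \<Longrightarrow> b j = step a j"
  shows "(phi b u y - phi a u y) / \<tau>
      + (1 - \<theta>) * r a u y P + \<theta> * r b u y P
    \<le> (1 - \<theta>) * (z b u y P - z a u y P)
      + source_err L2 \<theta> a b u y P
      + flux_err a b u y"
proof -
  let ?Q = "\<lambda>j. eflux a (\<lambda>_. u) j"
  let ?S = "\<lambda>j. sgn (b j - u) * (P_disc N a j - (f (X j) u - f (X (j - 1)) u) / h)"
  have W0: "W j y \<ge> 0" if "j \<in> {1..N}" for j using W_pos[of j y] that by (simp add: less_imp_le)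
  have lt: "lam T N M = \<tau> / h" by (simp add: lam_def)
  have A: "(\<bar>u - b j\<bar> - \<bar>u - a j\<bar>) / \<tau> \<le> - (1 / h) * (?Q j - ?Q (j - 1)) + ?S j" if j: "j \<in> {1..N}" for j
  proof -
    have "\<bar>u - b j\<bar> - \<bar>u - a j\<bar> \<le> - lam T N M * (?Q j - ?Q (j - 1)) 
       + sgn (b j - u) * (\<tau> * P_disc N a j - lam T N M * (f (X j) u - f (X (j - 1)) u))"
      using cell_entropy[OF j, of a u] b[OF j] by (simp add: abs_minus_commute)
    also have "\<dots> = \<tau> * (- (1 / h) * (?Q j - ?Q (j - 1)) + ?S j)"
      unfolding lt using h_pos by (simp add: field_simps)
    finally show ?thesis using tau_pos by (simp add: pos_divide_le_eq mult.commute)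
  qed
  have "(phi b u y - phi a u y) / \<tau>
     = (\<Sum>j\<in>{1..N}. (\<bar>u - b j\<bar> - \<bar>u - a j\<bar>) / \<tau> * W j y)"
    unfolding phi_def sum_subtractf[symmetric] sum_divide_distrib by (simp add: left_diff_distrib)
  also have "\<dots> \<le> (\<Sum>j\<in>{1..N}. (- (1 / h) * (?Q j - ?Q (j - 1)) + ?S j) * W j y)"
    by (intro sum_mono mult_right_mono A W0)
  also have "\<dots> = - (1 / h) * (\<Sum>j\<in>{1..N}. (?Q j - ?Q (j - 1)) * W j y) + (\<Sum>j\<in>{1..N}. ?S j * W j y)"
    by (simp only: distrib_right sum.distrib sum_distrib_left mult.assoc)
  finally have B: "(phi b u y - phi a u y) / \<tau>
    \<le> - (1 / h) * (\<Sum>j\<in>{1..N}. (?Q j - ?Q (j - 1)) * W j y) + (\<Sum>j\<in>{1..N}. ?S j * W j y)" .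
  have rs: "r c u y P = (\<Sum>j\<in>{1..N}. q y u (c j) * w' j y) + (\<Sum>j\<in>{1..N}. (- sgn (u - c j) * fx y (c j) + sgn (u - c j) * P) * W j y)" for c
    unfolding r_def sum.distrib[symmetric] by (intro sum.cong refl) (simp add: algebra_simps)
  have C: "(\<Sum>j\<in>{1..N}. ?S j * W j y) + (1 - \<theta>) * (\<Sum>j\<in>{1..N}. (- sgn (u - a j) * fx y (a j) + sgn (u - a j) * P) * W j y)
      + \<theta> * (\<Sum>j\<in>{1..N}. (- sgn (u - b j) * fx y (b j) + sgn (u - b j) * P) * W j y)
    \<le> (1 - \<theta>) * (z b u y P - z a u y P)
      + source_err L2 \<theta> a b u y P"
    (is "?lhs \<le> ?rhs")
  proof -
    have "?lhs = (\<Sum>j\<in>{1..N}. (?S j + (1 - \<theta>) * (- sgn (u - a j) * fx y (a j) + sgn (u - a j) * P)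
       + \<theta> * (- sgn (u - b j) * fx y (b j) + sgn (u - b j) * P)) * W j y)"
      unfolding sum_distrib_left sum.distrib[symmetric] by (intro sum.cong refl) (simp add: algebra_simps)
    also have "\<dots> \<le> (\<Sum>j\<in>{1..N}. ((1 - \<theta>) * (sgn (b j - u) * (P - fx y u) - sgn (a j - u) * (P - fx y u))
     + (\<bar>P_disc N a j - P\<bar> + L2 * (s (X j - y) + h) + L * ((1 - \<theta>) * \<bar>u - a j\<bar> + \<theta> * \<bar>u - b j\<bar>))) * W j y)"
      by (intro sum_mono mult_right_mono W0 source_part[OF _ y \<theta> u L2])
    also have "\<dots> = ?rhs"
      unfolding z_def source_err_def sum_subtractf[symmetric] sum_distrib_left sum.distrib[symmetric]
      by (intro sum.cong refl) (simp add: algebra_simps)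
    finally show ?thesis .
  qed
  have "(1 - \<theta>) * r a u y P + \<theta> * r b u y P = 
     ((1 - \<theta>) * (\<Sum>j\<in>{1..N}. q y u (a j) * w' j y) + \<theta> * (\<Sum>j\<in>{1..N}. q y u (b j) * w' j y))
     + ((1 - \<theta>) * (\<Sum>j\<in>{1..N}. (- sgn (u - a j) * fx y (a j) + sgn (u - a j) * P) * W j y)
      + \<theta> * (\<Sum>j\<in>{1..N}. (- sgn (u - b j) * fx y (b j) + sgn (u - b j) * P) * W j y))"
    unfolding rs by (simp only: distrib_left add_ac)
  then show ?thesis using B C flux_part[OF y \<theta>, of a u b] by linarith
qed

end

section \<open>The nonlocal source term\<close>

abbreviation I01 :: "(real \<Rightarrow> real) \<Rightarrow> real" where "I01 g \<equiv> (LINT y:{0..1}|lborel. g y)"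

lemma I01_integrable: "bm {0..1} g \<Longrightarrow> set_integrable lborel {0..1::real} g"
  by (rule bm_integrable_Icc)

lemma I01_add: "bm {0..1} f \<Longrightarrow> bm {0..1} g \<Longrightarrow> I01 (\<lambda>y. f y + g y) = I01 f + I01 g"
  by (intro set_integral_add I01_integrable)

lemma I01_diff: "bm {0..1} f \<Longrightarrow> bm {0..1} g \<Longrightarrow> I01 (\<lambda>y. f y - g y) = I01 f - I01 g"
  by (intro set_integral_diff I01_integrable)

lemma I01_sum: "(\<And>j. j \<in> J \<Longrightarrow> bm {0..1} (f j)) \<Longrightarrow> I01 (\<lambda>y. \<Sum>j\<in>J. f j y) = (\<Sum>j\<in>J. I01 (f j))"
  by (intro set_integral_sum' I01_integrable)

lemma I01_const: "I01 (\<lambda>y. c) = c"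
  by (simp add: set_lebesgue_integral_def)

lemma I01_mono: "bm {0..1} f \<Longrightarrow> bm {0..1} g \<Longrightarrow> (\<And>y. y \<in> {0..1} \<Longrightarrow> f y \<le> g y) \<Longrightarrow> I01 f \<le> I01 g"
  by (intro set_integral_mono I01_integrable)

lemma I01_abs: "bm {0..1} f \<Longrightarrow> \<bar>I01 f\<bar> \<le> I01 (\<lambda>y. \<bar>f y\<bar>)"
  using set_integral_norm_bound[OF I01_integrable, of f] by simp

lemma I01_bound:
  assumes "bm {0..1} f" "\<And>y. y \<in> {0..1} \<Longrightarrow> \<bar>f y\<bar> \<le> C"
  shows "\<bar>I01 f\<bar> \<le> C"
  using order_trans[OF I01_abs[OF assms(1)] I01_mono[OF bm_abs[OF assms(1)] bm_const[of _ C] assms(2)]]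
  by (simp add: I01_const)

lemma bm_subinterval: "bm {0..1} g \<Longrightarrow> 0 \<le> a \<Longrightarrow> b \<le> 1 \<Longrightarrow> set_integrable lborel {a..b::real} g"
  by (rule set_integrable_subset[OF I01_integrable]) auto

lemma partial_integral_lipschitz:
  assumes g: "bm {0..1} g" "\<And>y. y \<in> {0..1} \<Longrightarrow> \<bar>g y\<bar> \<le> B" and pq: "p \<in> {0..1}" "q \<in> {0..1}"
  shows "\<bar>(LINT y:{0..p}|lborel. g y) - (LINT y:{0..q}|lborel. g y)\<bar> \<le> B * \<bar>p - q\<bar>"
proof -
  have *: "\<bar>(LINT y:{0..q}|lborel. g y) - (LINT y:{0..p}|lborel. g y)\<bar> \<le> B * (q - p)"
    if pq: "p \<in> {0..1}" "q \<in> {0..1}" "p \<le> q" for p q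
  proof -
    have i: "set_integrable lborel {p<..q} g" by (rule set_integrable_subset[OF I01_integrable[OF g(1)]]) (use pq in auto)
    have "(LINT y:{0..p} \<union> {p<..q}|lborel. g y) = (LINT y:{0..p}|lborel. g y) + (LINT y:{p<..q}|lborel. g y)"
      by (rule set_integral_Un) (use pq g i in \<open>auto intro: bm_subinterval\<close>)
    moreover have "{0..p} \<union> {p<..q} = {0..q}" using pq by auto
    moreover have "\<bar>LINT y:{p<..q}|lborel. g y\<bar> \<le> B * (q - p)"
    proof -
      have "\<bar>LINT y:{p<..q}|lborel. g y\<bar> \<le> (LINT y:{p<..q}|lborel. \<bar>g y\<bar>)"
        using set_integral_norm_bound[OF i] by simp
      also have "\<dots> \<le> (LINT y:{p<..q}|lborel. B)"
      proof (rule set_integral_mono)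
        show "set_integrable lborel {p<..q} (\<lambda>y. \<bar>g y\<bar>)" by (rule set_integrable_abs[OF i])
        show "set_integrable lborel {p<..q} (\<lambda>y. B)"
          by (rule bm_integrable[OF bm_const]) (use pq in auto)
      qed (use g pq in auto)
      also have "\<dots> = B * (q - p)" using pq by (simp add: set_lebesgue_integral_def)
      finally show ?thesis .
    qed
    ultimately show ?thesis by simp
  qed
  show ?thesis
  proof (cases "p \<le> q")
    case True then show ?thesis using *[OF pq] by (simp add: abs_minus_commute)
  next
    case False then show ?thesis using *[OF pq(2,1)] by (simp add: abs_minus_commute)
  qed
qed

lemma P_op_measurable2:
  fixes v :: "real \<times> real \<Rightarrow> real"
  assumes [measurable]: "v \<in> borel_measurable borel"
  shows "(\<lambda>p. P_op (\<lambda>y. v (fst p, y)) (snd p)) \<in> borel_measurable borel"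
proof -
  have v[measurable]: "v \<in> borel_measurable (borel \<Otimes>\<^sub>M borel)" by (simp add: borel_prod)
  have 1: "(\<lambda>p. LINT y:{0..snd p}|lborel. v (fst p, y)) \<in> borel_measurable (borel \<Otimes>\<^sub>M borel)"
    unfolding set_lebesgue_integral_def indicator_def atLeastAtMost_iff by measurable
  have 2: "(\<lambda>t. LINT y:{0..1}|lborel. (LINT z:{0..y}|lborel. v (t, z))) \<in> borel_measurable borel"
    unfolding set_lebesgue_integral_def indicator_def atLeastAtMost_iff by measurable
  have "(\<lambda>p. P_op (\<lambda>y. v (fst p, y)) (snd p)) \<in> borel_measurable (borel \<Otimes>\<^sub>M borel)"
    unfolding P_op_def using 1 2 by measurable
  then show ?thesis by (simp add: borel_prod)
qed

lemma bm_partial_integral: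
  assumes w: "w \<in> borel_measurable borel" "\<And>y. \<bar>w y\<bar> \<le> B"
  shows "bm {0..1} (\<lambda>x. LINT y:{0..x}|lborel. w y)" "\<And>x::real. x \<in> {0..1} \<Longrightarrow> \<bar>LINT y:{0..x}|lborel. w y\<bar> \<le> B"
proof -
  have [measurable]: "w \<in> borel_measurable borel" by fact
  have bw: "bm {0..1} w" using w by (auto simp: bm_def)
  show b: "\<bar>LINT y:{0..x}|lborel. w y\<bar> \<le> B" if "x \<in> {0..1}" for x :: real
  proof -
    have "B \<ge> 0" using w(2)[of 0] by linarith
    then have "B * \<bar>x - 0\<bar> \<le> B * 1" using that by (intro mult_left_mono) auto
    moreover have "\<bar>(LINT y:{0..x}|lborel. w y) - (LINT y:{0..0}|lborel. w y)\<bar> \<le> B * \<bar>x - 0\<bar>"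
      by (rule partial_integral_lipschitz[OF bw]) (use w that in auto)
    moreover have "(LINT y:{0..0}|lborel. w y) = 0"
      using AE_lborel_singleton[of "0::real"] unfolding set_lebesgue_integral_def
      by (intro integral_eq_zero_AE) auto
    ultimately show ?thesis by simp
  qed
  have "(\<lambda>x. LINT y:{0..x}|lborel. w y) \<in> borel_measurable borel"
    unfolding set_lebesgue_integral_def indicator_def atLeastAtMost_iff by measurable
  then show "bm {0..1} (\<lambda>x. LINT y:{0..x}|lborel. w y)" using b unfolding bm_def by blast
qed

lemma bm_P_op:
  assumes w: "w \<in> borel_measurable borel" "\<And>y. \<bar>w y\<bar> \<le> B"
  shows "bm {0..1} (P_op w)" "\<And>x. x \<in> {0..1} \<Longrightarrow> \<bar>P_op w x\<bar> \<le> 2 * B"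
proof -
  show "bm {0..1} (P_op w)" unfolding P_op_def[abs_def] by (intro bm_diff bm_const bm_partial_integral[OF w])
  show "\<bar>P_op w x\<bar> \<le> 2 * B" if "x \<in> {0..1}" for x
    using bm_partial_integral(2)[OF w that] I01_bound[OF bm_partial_integral(1)[OF w] bm_partial_integral(2)[OF w]]
    unfolding P_op_def by linarith
qed

context mesh
begin

text \<open>The discrete sums in \<open>P_disc\<close> are integrals of step functions.\<close>

lemma cell_integral:
  fixes c :: "nat \<Rightarrow> real"
  assumes "i \<le> N"
  shows "(LINT y:{0..X i}|lborel. c (cell y)) = h * (\<Sum>j\<in>{1..i}. c j)"
  using assms
proof (induction i)
  case 0
  then show ?case using AE_lborel_singleton[of "0::real"] unfolding set_lebesgue_integral_def
    by (intro trans[OF integral_eq_zero_AE]) (auto simp: X_0)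
next
  case (Suc i)
  have Xi: "0 \<le> X i" "X (Suc i) \<le> 1" "X i \<le> X (Suc i)" using X_01[of i] X_01[of "Suc i"] Suc.prems X_mono[of i "Suc i"] by auto
  have iall: "set_integrable lborel {0..1} (\<lambda>y. c (cell y))" by (rule I01_integrable[OF bm_cell])
  have i2: "set_integrable lborel {X i<..X (Suc i)} (\<lambda>y. c (cell y))" by (rule set_integrable_subset[OF iall]) (use Xi in auto)
  have i1: "set_integrable lborel {0..X i} (\<lambda>y. c (cell y))" by (rule set_integrable_subset[OF iall]) (use Xi in auto)
  have "{0..X (Suc i)} = {0..X i} \<union> {X i<..X (Suc i)}" using Xi by auto
  then have "(LINT y:{0..X (Suc i)}|lborel. c (cell y)) = (LINT y:{0..X i} \<union> {X i<..X (Suc i)}|lborel. c (cell y))" by simp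
  also have "\<dots> = (LINT y:{0..X i}|lborel. c (cell y)) + (LINT y:{X i<..X (Suc i)}|lborel. c (cell y))"
    by (rule set_integral_Un) (use i1 i2 in auto)
  also have "(LINT y:{X i<..X (Suc i)}|lborel. c (cell y)) = (LINT y:{X i<..X (Suc i)}|lborel. c (Suc i))"
  proof (rule set_lebesgue_integral_cong_AE)
    show "AE y\<in>{X i<..X (Suc i)} in lborel. c (cell y) = c (Suc i)"
      using AE_lborel_singleton[of "X (Suc i)"]
    proof eventually_elim
      case (elim y)
      then show ?case using cell_eq[of "Suc i" y] Suc.prems by auto
    qed
  qed (auto simp: cell_measurable)
  also have "\<dots> = h * c (Suc i)" using Xi by (simp add: set_lebesgue_integral_def X_Suc)
  finally show ?case using Suc by (simp add: distrib_left)
qed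

text \<open>Both sums in \<open>P_disc\<close> are integrals of step functions up to half a cell. The difference of
  the functions costs their \<open>L\<^sup>1\<close> distance, the difference of the end points \<open>X j\<close> and \<open>y\<close> costs
  \<open>B\<close> times their distance.\<close>

lemma P_disc_close:
  assumes w: "w \<in> borel_measurable borel" "\<And>y. \<bar>w y\<bar> \<le> B"
    and a: "\<And>j. j \<in> {1..N} \<Longrightarrow> \<bar>a j\<bar> \<le> B" and j: "j \<in> {1..N}" and y: "y \<in> {0..1}"
  shows "\<bar>P_disc N a j - P_op w y\<bar> \<le> 2 * I01 (\<lambda>y. \<bar>w y - a (cell y)\<bar>) + B * \<bar>X j - y\<bar> + 3 * B * h"
proof -
  let ?e = "I01 (\<lambda>y. \<bar>w y - a (cell y)\<bar>)"
  let ?S = "\<lambda>j. (\<Sum>i\<in>{1..<j}. a i) + a j / 2"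
  have bw: "bm {0..1} w" using w by (auto simp: bm_def)
  have B0: "B \<ge> 0" using w(2)[of 0] by linarith
  have ac: "\<bar>a (cell y)\<bar> \<le> B" if "y \<in> {0..1}" for y using a cell_bounds(1)[OF that] by blast
  have close: "\<bar>h * ?S j - (LINT z:{0..y}|lborel. w z)\<bar> \<le> ?e + B * \<bar>X j - y\<bar> + B * h"
    if j: "j \<in> {1..N}" and y: "y \<in> {0..1}" for j y
  proof -
    have "{1..j} = insert j {1..<j}" using j by auto
    then have "h * ?S j = (LINT z:{0..X j}|lborel. a (cell z)) - h * (a j / 2)"
      using cell_integral[of j a] j by (simp add: algebra_simps)
    moreover have "\<bar>h * (a j / 2)\<bar> \<le> B * h"
      using mult_left_mono[OF a[OF j], of h] h_pos B0 by (simp add: abs_mult)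
    moreover have "\<bar>(LINT z:{0..X j}|lborel. a (cell z)) - (LINT z:{0..y}|lborel. a (cell z))\<bar> \<le> B * \<bar>X j - y\<bar>"
      by (rule partial_integral_lipschitz[where g = "\<lambda>y. a (cell y)", OF bm_cell ac]) (use y j X_01[of j] in auto)
    moreover have "\<bar>(LINT z:{0..y}|lborel. a (cell z)) - (LINT z:{0..y}|lborel. w z)\<bar> \<le> ?e"
    proof -
      have i: "set_integrable lborel {0..y} (\<lambda>z. a (cell z))" "set_integrable lborel {0..y} w"
        using y by (auto intro!: bm_subinterval bw bm_cell)
      have b: "bm {0..1} (\<lambda>z. a (cell z) - w z)" by (intro bm_diff bm_cell bw)
      have "\<bar>(LINT z:{0..y}|lborel. a (cell z)) - (LINT z:{0..y}|lborel. w z)\<bar> = \<bar>LINT z:{0..y}|lborel. a (cell z) - w z\<bar>"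
        using set_integral_diff(2)[OF i] by simp
      also have "\<dots> \<le> (LINT z:{0..y}|lborel. \<bar>a (cell z) - w z\<bar>)"
        using set_integral_norm_bound[OF set_integral_diff(1)[OF i]] by simp
      also have "\<dots> \<le> (LINT z:{0..1}|lborel. \<bar>a (cell z) - w z\<bar>)"
        using bm_subinterval[OF bm_abs[OF b], of 0 y] I01_integrable[OF bm_abs[OF b]] y
        unfolding set_lebesgue_integral_def set_integrable_def
        by (intro integral_mono) (auto simp: indicator_def)
      also have "\<dots> = ?e" by (simp add: abs_minus_commute)
      finally show ?thesis .
    qed
    ultimately show ?thesis by linarith
  qed
  have "\<bar>h\<^sup>2 * (\<Sum>l\<in>{1..N}. ?S l) - I01 (\<lambda>y. LINT z:{0..y}|lborel. w z)\<bar> \<le> ?e + B * h + B * h"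
  proof -
    have b: "bm {0..1} (\<lambda>y. h * ?S (cell y))" by (rule bm_cell)
    have b2: "bm {0..1} (\<lambda>y. LINT z:{0..y}|lborel. w z)" by (rule bm_partial_integral(1)[OF w])
    have "h\<^sup>2 * (\<Sum>l\<in>{1..N}. ?S l) = I01 (\<lambda>y. h * ?S (cell y))"
      using cell_integral[of N "\<lambda>j. h * ?S j"] by (simp add: X_N power2_eq_square sum_distrib_left mult.assoc)
    then have "\<bar>h\<^sup>2 * (\<Sum>l\<in>{1..N}. ?S l) - I01 (\<lambda>y. LINT z:{0..y}|lborel. w z)\<bar>
       = \<bar>I01 (\<lambda>y. h * ?S (cell y) - (LINT z:{0..y}|lborel. w z))\<bar>"
      using I01_diff[OF b b2] by simp
    also have "\<dots> \<le> ?e + B * h + B * h"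
    proof (rule I01_bound[OF bm_diff[OF b b2]])
      fix y :: real assume y: "y \<in> {0..1}"
      have "X (cell y) - X (cell y - 1) = h" using X_pred[of "cell y"] cell_bounds(1)[OF y] by simp
      then have "\<bar>X (cell y) - y\<bar> \<le> h" using cell_bounds[OF y] by linarith
      then have "B * \<bar>X (cell y) - y\<bar> \<le> B * h" using B0 by (intro mult_left_mono)
      then show "\<bar>h * ?S (cell y) - (LINT z:{0..y}|lborel. w z)\<bar> \<le> ?e + B * h + B * h"
        using close[OF cell_bounds(1)[OF y] y] by linarith
    qed
    finally show ?thesis .
  qed
  then show ?thesis using close[OF j y] unfolding P_disc_def P_op_def by (auto simp: algebra_simps)
qed

end

section \<open>The integrated comparison of one step\<close>

text \<open>The rate at which the comparison functional may grow, and the rate at which consistency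
  errors of order \<open>\<epsilon>\<close> are produced. Here \<open>B\<close> bounds the values, \<open>V\<close> the total variation and \<open>D\<close>
  the \<open>L\<^sup>1\<close> speed of the scheme; \<open>L2\<close> is a Lipschitz constant of \<open>fx\<close> in \<open>x\<close>, and \<open>G\<close> the
  constant of the kernel.\<close>

definition growth_const :: "real \<Rightarrow> real \<Rightarrow> real" where
  "growth_const L G = L + 2 + 2 * L * G ^ 4"

definition error_const :: "real \<Rightarrow> real \<Rightarrow> real \<Rightarrow> real \<Rightarrow> real \<Rightarrow> real \<Rightarrow> real \<Rightarrow> real" where
  "error_const L G cf B L2 V D = (2 + 2 * L * G ^ 4) * (G * (D * cf) + 4 * V * G\<^sup>2) + 4 * B + L2 * (1 + G ^ 3)
     + 4 * B * G\<^sup>2 + G\<^sup>2 * (4 * L * V + 2 * L * (D * cf)) + 8 * L * G ^ 3 * V"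

context kernel_mesh
begin

lemma bm_om: "bm {0..1} (\<lambda>y. \<omega> (c - y))"
  by (intro bm_continuous continuous_on_compose2[OF om_cont] continuous_intros) auto

lemma bm_s: "bm {0..1} (\<lambda>y. s (c - y))"
  unfolding s_def by (intro bm_continuous continuous_intros) auto

lemma bm_W: "bm {0..1} (W j)"
  unfolding W_def[abs_def]
  by (intro bm_continuous continuous_intros continuous_on_compose2[OF Om_cont]) auto

lemma bm_w': "bm {0..1} (w' j)"
  unfolding w'_def[abs_def] by (intro bm_diff bm_om)

lemma bm_id: "bm {0..1::real} (\<lambda>y. y)"
  by (intro bm_continuous continuous_intros) auto

lemma I01_om: "I01 (\<lambda>y. \<omega> (c - y)) = 1"
proof -
  have "I01 (\<lambda>y. \<omega> (c - y)) = I01 \<omega>" by (rule periodic_integral[OF om_cont om_per])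
  also have "\<dots> = \<Omega> 1 - \<Omega> 0" by (rule set_integral_antiderivative[OF d_Om om_cont]) simp
  finally show ?thesis using Om_per[of 0] by simp
qed

text \<open>A Riemann sum of \<open>\<rho>\<close> over one period; values in one cell are comparable up to the factor
  \<open>G\<close>.\<close>

lemma sum_rho: "(\<Sum>j\<in>{1..N}. h * \<rho> (X j - y)) \<le> G\<^sup>2"
proof -
  obtain A where A: "\<And>x. (A has_real_derivative \<rho> x) (at x)"
    using continuous_has_antiderivative[OF rho_cont] by auto
  have "h * \<rho> (X j - y) \<le> G * (A (X j - y) - A (X (j - 1) - y))" if j: "j \<in> {1..N}" for j
  proof -
    obtain \<xi> where \<xi>: "min (X (j - 1) - y) (X j - y) \<le> \<xi>" "\<xi> \<le> max (X (j - 1) - y) (X j - y)"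
      "A (X j - y) - A (X (j - 1) - y) = ((X j - y) - (X (j - 1) - y)) * \<rho> \<xi>"
      using MVT_between[of A \<rho> "X (j - 1) - y" "X j - y"] A by metis
    have Xj: "X j - X (j - 1) = h" using X_pred[of j] j by simp
    have "\<rho> (X j - y) \<le> G * \<rho> \<xi>" using \<xi>(1,2) Xj h_pos by (intro rho_near) auto
    then have "h * \<rho> (X j - y) \<le> h * (G * \<rho> \<xi>)" using h_pos by (intro mult_left_mono) auto
    also have "\<dots> = G * (A (X j - y) - A (X (j - 1) - y))" using \<xi>(3) Xj by simp
    finally show ?thesis .
  qed
  then have "(\<Sum>j\<in>{1..N}. h * \<rho> (X j - y)) \<le> (\<Sum>j\<in>{1..N}. G * (A (X j - y) - A (X (j - 1) - y)))"
    by (rule sum_mono)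
  also have "\<dots> = G * (A (X N - y) - A (X 0 - y))"
    using sum_diff_pred[of "\<lambda>j. A (X j - y)"] by (simp only: sum_distrib_left[symmetric])
  also have "A (X N - y) - A (X 0 - y) = I01 \<rho>"
  proof -
    have "I01 (\<lambda>z. \<rho> ((1 - y) - z)) = (- A ((1 - y) - 1)) - (- A ((1 - y) - 0))"
    proof (rule set_integral_antiderivative)
      show "((\<lambda>z. - A (1 - y - z)) has_real_derivative \<rho> (1 - y - x)) (at x)" for x
        by (rule DERIV_cong[OF DERIV_minus[OF DERIV_chain2[OF A DERIV_diff[OF DERIV_const DERIV_ident]]]]) simp
      show "continuous_on UNIV (\<lambda>z. \<rho> (1 - y - z))"
        by (intro continuous_on_compose2[OF rho_cont] continuous_intros) auto
    qed simp
    then show ?thesis using periodic_integral[OF rho_cont rho_per, of "1 - y"] by (simp add: X_N X_0)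
  qed
  also have "G * I01 \<rho> \<le> G * G" using rho_int G1 by (intro mult_left_mono) auto
  finally show ?thesis by (simp add: power2_eq_square)
qed

text \<open>The total variation of the step function \<open>c\<close> as seen through the kernel from the point
  \<open>y\<close>, including a first moment.\<close>

definition TVk :: "(nat \<Rightarrow> real) \<Rightarrow> real \<Rightarrow> real" where
  "TVk c y = (\<Sum>j\<in>{1..N}. h * (\<omega> (X j - y) * (1 + s (X j - y) / \<epsilon>)) * \<bar>c (cell y) - c j\<bar>)"

lemma bm_TVk: "bm {0..1} (TVk c)"
  unfolding TVk_def[abs_def]
  by (intro bm_sum bm_mult bm_const bm_om bm_add bm_divide bm_s bm_abs bm_diff bm_cell)

lemma TVk_integral: "I01 (TVk c) \<le> (\<Sum>i\<in>{1..<N}. \<bar>c (Suc i) - c i\<bar>) * (4 * \<epsilon> * G)"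
proof -
  let ?k = "\<lambda>z. \<omega> z * (1 + s z / \<epsilon>)"
  have kc: "continuous_on UNIV ?k" unfolding s_def using om_cont eps_pos by (intro continuous_intros) auto
  have "I01 (TVk c) \<le> (\<Sum>i\<in>{1..<N}. \<bar>c (Suc i) - c i\<bar>) * (2 * (LINT z:{0..1}|lborel. ?k z * (min z (1 - z) + h)))"
    unfolding TVk_def[abs_def]
  proof (rule translation_estimate[OF kc])
    show "?k (- z) = ?k z" for z by (simp add: om_even s_def)
    show "?k z \<ge> 0" for z using om_pos[of z] s_nonneg[of z] eps_pos by simp
  qed
  also have "\<dots> \<le> (\<Sum>i\<in>{1..<N}. \<bar>c (Suc i) - c i\<bar>) * (2 * (2 * \<epsilon> * G))"
  proof (intro mult_left_mono sum_nonneg)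
    have rb: "bm {0..1} \<rho>" by (rule bm_continuous[OF rho_cont]) simp
    have "(LINT z:{0..1}|lborel. ?k z * (min z (1 - z) + h)) \<le> I01 (\<lambda>z. 2 * \<epsilon> * \<rho> z)"
    proof (rule I01_mono)
      show "bm {0..1} (\<lambda>z. ?k z * (min z (1 - z) + h))"
        by (intro bm_continuous continuous_intros kc) auto
      show "bm {0..1} (\<lambda>z. 2 * \<epsilon> * \<rho> z)" by (intro bm_cmult rb)
      fix z :: real assume z: "z \<in> {0..1}"
      have k0: "?k z \<ge> 0" using om_pos[of z] s_nonneg[of z] eps_pos by simp
      have "2 * min z (1 - z) \<le> s z" unfolding s_def by (rule min_le_sin_pi) (use z in auto)
      moreover have "min z (1 - z) \<ge> 0" using z by auto
      moreover have "m + h \<le> t + \<epsilon>" if "2 * m \<le> t" "0 \<le> m" for m t using that h_le_eps by linarith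
      ultimately have "min z (1 - z) + h \<le> s z + \<epsilon>" by blast
      also have "\<dots> = \<epsilon> * (1 + s z / \<epsilon>)" using eps_pos by (simp add: distrib_left)
      finally have "?k z * (min z (1 - z) + h) \<le> ?k z * (\<epsilon> * (1 + s z / \<epsilon>))" using k0 by (rule mult_left_mono)
      also have "\<dots> = \<epsilon> * (\<omega> z * (1 + s z / \<epsilon>)\<^sup>2)" by (simp add: power2_eq_square mult_ac)
      also have "\<dots> \<le> \<epsilon> * (2 * \<rho> z)" using eps_pos by (intro mult_left_mono kernel_dominated) auto
      finally show "?k z * (min z (1 - z) + h) \<le> 2 * \<epsilon> * \<rho> z" by simp
    qed
    also have "\<dots> = 2 * \<epsilon> * I01 \<rho>" by simp
    also have "\<dots> \<le> 2 * \<epsilon> * G" using rho_int eps_pos by (intro mult_left_mono) auto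
    finally show "(LINT z:{0..1}|lborel. ?k z * (min z (1 - z) + h)) \<le> 2 * \<epsilon> * G" .
  qed auto
  finally show ?thesis by (simp add: mult_ac)
qed

lemma sum_path_le_TV: "(\<Sum>i\<in>{1..<N}. \<bar>c (Suc i) - c i\<bar>) \<le> TV c"
proof -
  have "(\<Sum>i\<in>{1..<N}. \<bar>c (Suc i) - c i\<bar>) = (\<Sum>i\<in>{1..<N}. \<bar>c (right i) - c i\<bar>)"
    by (intro sum.cong) (auto simp: right_def)
  also have "\<dots> \<le> TV c" unfolding TV_def by (intro sum_mono2) auto
  finally show ?thesis .
qed

lemma TVk_TV: "TV c \<le> V \<Longrightarrow> I01 (TVk c) \<le> 4 * V * \<epsilon> * G"
proof -
  assume V: "TV c \<le> V"
  have "I01 (TVk c) \<le> (\<Sum>i\<in>{1..<N}. \<bar>c (Suc i) - c i\<bar>) * (4 * \<epsilon> * G)" by (rule TVk_integral)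
  also have "\<dots> \<le> V * (4 * \<epsilon> * G)"
    using sum_path_le_TV[of c] V eps_pos G1 by (intro mult_right_mono) auto
  finally show ?thesis by (simp add: mult_ac)
qed

text \<open>The cell positions themselves form a step function of total variation at most one. This
  gives the first moment of the kernel with the ordinary, not the periodic, distance.\<close>

lemma TVk_X: "I01 (TVk X) \<le> 4 * \<epsilon> * G"
proof -
  have "(\<Sum>i\<in>{1..<N}. \<bar>X (Suc i) - X i\<bar>) = real (N - 1) * h" using h_pos by (simp add: X_Suc)
  also have "\<dots> \<le> 1" using N_h h_pos by (smt (verit) diff_le_self mult_right_mono of_nat_mono)
  finally have "(\<Sum>i\<in>{1..<N}. \<bar>X (Suc i) - X i\<bar>) * (4 * \<epsilon> * G) \<le> 1 * (4 * \<epsilon> * G)"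
    using eps_pos G1 by (intro mult_right_mono) auto
  then show ?thesis using TVk_integral[of X] by linarith
qed

lemma W_TVk: "(\<Sum>j\<in>{1..N}. W j y * \<bar>c (cell y) - c j\<bar>) \<le> G * TVk c y"
  unfolding TVk_def sum_distrib_left
proof (rule sum_mono)
  fix j assume j: "j \<in> {1..N}"
  have "W j y \<le> G * (h * \<omega> (X j - y))" using j by (intro W_le) auto
  also have "\<dots> \<le> G * (h * (\<omega> (X j - y) * (1 + s (X j - y) / \<epsilon>)))"
  proof (intro mult_left_mono)
    have "\<omega> (X j - y) * 1 \<le> \<omega> (X j - y) * (1 + s (X j - y) / \<epsilon>)"
      using s_nonneg[of "X j - y"] eps_pos om_pos[of "X j - y"] by (intro mult_left_mono) auto
    then show "\<omega> (X j - y) \<le> \<omega> (X j - y) * (1 + s (X j - y) / \<epsilon>)" by simp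
  qed (use G1 h_pos in auto)
  finally have "W j y * \<bar>c (cell y) - c j\<bar> \<le> G * (h * (\<omega> (X j - y) * (1 + s (X j - y) / \<epsilon>))) * \<bar>c (cell y) - c j\<bar>"
    by (rule mult_right_mono) simp
  then show "W j y * \<bar>c (cell y) - c j\<bar> \<le> G * (h * (\<omega> (X j - y) * (1 + s (X j - y) / \<epsilon>)) * \<bar>c (cell y) - c j\<bar>)"
    by (simp only: mult.assoc)
qed

definition Phi :: "(nat \<Rightarrow> real) \<Rightarrow> (real \<Rightarrow> real) \<Rightarrow> real" where
  "Phi a w = I01 (\<lambda>y. phi a (w y) y)"
definition R :: "(nat \<Rightarrow> real) \<Rightarrow> (real \<Rightarrow> real) \<Rightarrow> real" where
  "R a w = I01 (\<lambda>y. r a (w y) y (P_op w y))"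
definition Z :: "(nat \<Rightarrow> real) \<Rightarrow> (real \<Rightarrow> real) \<Rightarrow> real" where
  "Z a w = I01 (\<lambda>y. z a (w y) y (P_op w y))"

lemma I01_W: "j \<in> {1..N} \<Longrightarrow> I01 (W j) \<le> G * h"
proof -
  assume j: "j \<in> {1..N}"
  have "I01 (W j) \<le> I01 (\<lambda>y. G * (h * \<omega> (X j - y)))"
    using j by (intro I01_mono bm_W bm_mult bm_const bm_om W_le) auto
  also have "\<dots> = G * h" by (simp add: I01_om)
  finally show ?thesis .
qed

lemma W_nonneg: "j \<in> {1..N} \<Longrightarrow> W j y \<ge> 0"
  using W_pos[of j y] by (simp add: less_imp_le)

lemma phi_term_integrable:
  assumes w: "set_integrable lborel {0..1} w" and j: "j \<in> {1..N}"
  shows "set_integrable lborel {0..1} (\<lambda>y. \<bar>w y - c\<bar> * W j y)"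
proof (rule set_integrable_bound)
  show "set_integrable lborel {0..1} (\<lambda>y. \<bar>w y - c\<bar>)"
    by (intro set_integrable_abs set_integral_diff w I01_integrable bm_const)
  then have "(\<lambda>y. indicator {0..1} y *\<^sub>R \<bar>w y - c\<bar>) \<in> borel_measurable lborel"
    unfolding set_integrable_def by (rule borel_measurable_integrable)
  then have "(\<lambda>y. (indicator {0..1} y *\<^sub>R \<bar>w y - c\<bar>) * W j y) \<in> borel_measurable lborel"
    using bm_measurable[OF bm_W] by (intro borel_measurable_times) auto
  then show "set_borel_measurable lborel {0..1} (\<lambda>y. \<bar>w y - c\<bar> * W j y)"
    unfolding set_borel_measurable_def by (simp add: mult_ac)
  show "AE y in lborel. y \<in> {0..1} \<longrightarrow> norm (\<bar>w y - c\<bar> * W j y) \<le> norm \<bar>w y - c\<bar>"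
    using W_nonneg[OF j] W_le1[OF j] by (auto simp: abs_mult intro!: AE_I2 mult_left_le)
qed

lemma phi_integrable:
  "set_integrable lborel {0..1} w \<Longrightarrow> set_integrable lborel {0..1} (\<lambda>y. phi a (w y) y)"
  unfolding phi_def by (intro set_integrable_sum' phi_term_integrable)

text \<open>With a constant vector on one side the sum of weights is one, which turns \<open>phi\<close> into a
  plain distance (\<open>phi_const\<close>). Both comparisons of \<open>Phi\<close> below are instances.\<close>

lemma phi_triangle: "phi a x y \<le> phi b x' y + (\<Sum>j\<in>{1..N}. W j y * (\<bar>x - x'\<bar> + \<bar>a j - b j\<bar>))"
  unfolding phi_def sum.distrib[symmetric]
proof (rule sum_mono)
  fix j assume j: "j \<in> {1..N}"
  have "\<bar>x - a j\<bar> * W j y \<le> (\<bar>x' - b j\<bar> + (\<bar>x - x'\<bar> + \<bar>a j - b j\<bar>)) * W j y"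
    by (intro mult_right_mono W_nonneg[OF j]) linarith
  then show "\<bar>x - a j\<bar> * W j y \<le> \<bar>x' - b j\<bar> * W j y + W j y * (\<bar>x - x'\<bar> + \<bar>a j - b j\<bar>)"
    by (simp add: algebra_simps)
qed

lemma phi_const: "phi (\<lambda>_. c) x y = \<bar>x - c\<bar>"
  using sum_W[of y] by (simp add: phi_def sum_distrib_left[symmetric])

lemma Phi_L1:
  assumes w: "set_integrable lborel {0..1} w"
  shows "I01 (\<lambda>y. \<bar>w y - a (cell y)\<bar>) \<le> Phi a w + G * I01 (TVk a)"
    and "Phi a w \<le> I01 (\<lambda>y. \<bar>w y - a (cell y)\<bar>) + G * I01 (TVk a)"
proof -
  note iP = phi_integrable[OF w, of a]
  have ie: "set_integrable lborel {0..1} (\<lambda>y. \<bar>w y - a (cell y)\<bar>)"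
    by (intro set_integrable_abs set_integral_diff w I01_integrable bm_cell)
  have iT: "set_integrable lborel {0..1} (\<lambda>y. G * TVk a y)" by (intro I01_integrable bm_cmult bm_TVk)
  have "I01 (\<lambda>y. \<bar>w y - a (cell y)\<bar>) \<le> I01 (\<lambda>y. phi a (w y) y + G * TVk a y)"
  proof (rule set_integral_mono[OF ie set_integral_add(1)[OF iP iT]])
    show "\<bar>w y - a (cell y)\<bar> \<le> phi a (w y) y + G * TVk a y" for y
      using phi_triangle[of "\<lambda>_. a (cell y)" "w y" y a "w y"] W_TVk[of y a] by (simp add: phi_const)
  qed
  then show "I01 (\<lambda>y. \<bar>w y - a (cell y)\<bar>) \<le> Phi a w + G * I01 (TVk a)"
    unfolding Phi_def set_integral_add(2)[OF iP iT] by simp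
  have "Phi a w \<le> I01 (\<lambda>y. \<bar>w y - a (cell y)\<bar> + G * TVk a y)" unfolding Phi_def
  proof (rule set_integral_mono[OF iP set_integral_add(1)[OF ie iT]])
    show "phi a (w y) y \<le> \<bar>w y - a (cell y)\<bar> + G * TVk a y" for y
      using phi_triangle[of a "w y" y "\<lambda>_. a (cell y)" "w y"] W_TVk[of y a] by (simp add: phi_const abs_minus_commute)
  qed
  then show "Phi a w \<le> I01 (\<lambda>y. \<bar>w y - a (cell y)\<bar>) + G * I01 (TVk a)"
    unfolding set_integral_add(2)[OF ie iT] by simp
qed

text \<open>With \<open>b\<close> the scheme at another time, this transfers the estimate between time levels.\<close>

lemma Phi_lipschitz:
  assumes w: "set_integrable lborel {0..1} w"
  shows "Phi a w \<le> Phi b w + G * (h * (\<Sum>j\<in>{1..N}. \<bar>a j - b j\<bar>))"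
proof -
  note iP = phi_integrable[OF w]
  have bj: "bm {0..1} (\<lambda>y. \<bar>a j - b j\<bar> * W j y)" for j by (intro bm_cmult bm_W)
  note iS = set_integrable_sum'[OF I01_integrable[OF bj]]
  have "Phi a w \<le> I01 (\<lambda>y. phi b (w y) y + (\<Sum>j\<in>{1..N}. \<bar>a j - b j\<bar> * W j y))"
    unfolding Phi_def
  proof (rule set_integral_mono[OF iP set_integral_add(1)[OF iP iS]])
    show "phi a (w y) y \<le> phi b (w y) y + (\<Sum>j\<in>{1..N}. \<bar>a j - b j\<bar> * W j y)" for y
      using phi_triangle[of a "w y" y b "w y"] by (simp add: mult.commute)
  qed
  also have "\<dots> = Phi b w + (\<Sum>j\<in>{1..N}. \<bar>a j - b j\<bar> * I01 (W j))"
    unfolding Phi_def set_integral_add(2)[OF iP iS] I01_sum[OF bj] by simp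
  also have "(\<Sum>j\<in>{1..N}. \<bar>a j - b j\<bar> * I01 (W j)) \<le> (\<Sum>j\<in>{1..N}. \<bar>a j - b j\<bar> * (G * h))"
    by (intro sum_mono mult_left_mono I01_W) auto
  finally show ?thesis by (simp add: sum_distrib_left mult_ac)
qed

lemma bm_phi: "bm {0..1} w \<Longrightarrow> bm {0..1} (\<lambda>y. phi a (w y) y)"
  unfolding phi_def by (intro bm_sum bm_mult bm_abs bm_diff bm_const bm_W)

lemma bm_f: "bm {0..1} w \<Longrightarrow> bm {0..1} (\<lambda>y. f y (w y))"
  by (rule bm_compose2[OF f_cont bm_id])

lemma bm_fx: "bm {0..1} w \<Longrightarrow> bm {0..1} (\<lambda>y. fx y (w y))"
  by (rule bm_compose2[OF fx_cont bm_id])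

lemma bm_rz:
  assumes w: "w \<in> borel_measurable borel" "\<And>y. \<bar>w y\<bar> \<le> B"
  shows "bm {0..1} (\<lambda>y. r a (w y) y (P_op w y))" "bm {0..1} (\<lambda>y. z a (w y) y (P_op w y))"
proof -
  have bw: "bm {0..1} w" using w by (auto simp: bm_def)
  note bP = bm_P_op(1)[OF w]
  show "bm {0..1} (\<lambda>y. r a (w y) y (P_op w y))" unfolding r_def q_def
    by (intro bm_sum bm_add bm_diff bm_mult bm_sgn bm_const bw bm_W bm_w' bP bm_f bm_fx bm_const)
  show "bm {0..1} (\<lambda>y. z a (w y) y (P_op w y))" unfolding z_def
    by (intro bm_sum bm_add bm_diff bm_mult bm_sgn bm_const bw bm_W bP bm_fx)
qed

lemma Z_bound:
  assumes w: "w \<in> borel_measurable borel" "\<And>y. \<bar>w y\<bar> \<le> B"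
  shows "\<bar>Z a w\<bar> \<le> 2 * B + L * (1 + B)"
  unfolding Z_def
proof (rule I01_bound[OF bm_rz(2)[OF w]])
  fix y :: real assume y: "y \<in> {0..1}"
  note W0 = W_nonneg[of _ y]
  have "\<bar>fx y (w y)\<bar> \<le> L * (1 + B)"
    using order_trans[OF fx_bound[of y "w y"] mult_left_mono[of "1 + \<bar>w y\<bar>" "1 + B" L]] w(2)[of y] L1 by auto
  then have b: "\<bar>P_op w y - fx y (w y)\<bar> \<le> 2 * B + L * (1 + B)" using bm_P_op(2)[OF w y] by linarith
  have "\<bar>z a (w y) y (P_op w y)\<bar> \<le> (\<Sum>j\<in>{1..N}. (2 * B + L * (1 + B)) * W j y)"
    unfolding z_def
  proof (rule order_trans[OF sum_abs sum_mono])
    fix j assume j: "j \<in> {1..N}"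
    have "\<bar>sgn (a j - w y) * (P_op w y - fx y (w y))\<bar> \<le> 2 * B + L * (1 + B)"
      using b by (auto simp: sgn_if abs_minus_commute)
    then have "\<bar>sgn (a j - w y) * (P_op w y - fx y (w y))\<bar> * W j y \<le> (2 * B + L * (1 + B)) * W j y"
      using W0[OF j] by (rule mult_right_mono)
    then show "\<bar>sgn (a j - w y) * (P_op w y - fx y (w y)) * W j y\<bar> \<le> (2 * B + L * (1 + B)) * W j y"
      using W0[OF j] by (simp add: abs_mult)
  qed
  also have "\<dots> = 2 * B + L * (1 + B)" using sum_W[of y] by (simp add: sum_distrib_left[symmetric])
  finally show "\<bar>z a (w y) y (P_op w y)\<bar> \<le> 2 * B + L * (1 + B)" .
qed

text \<open>Each error is written as a function of \<open>y\<close> with a known integral. The nonlocal term is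
  handled through \<open>P_disc_close\<close>, where \<open>e\<close> is a number and the distance of \<open>X j\<close> to \<open>y\<close> is a
  translation of the step function \<open>X\<close>.\<close>

lemma step_rhs_pointwise:
  assumes y: "y \<in> {0..1}" and w: "w \<in> borel_measurable borel" "\<And>y. \<bar>w y\<bar> \<le> B"
    and a: "\<And>j. j \<in> {1..N} \<Longrightarrow> \<bar>a j\<bar> \<le> B" and L2: "L2 \<ge> 0"
  defines "e \<equiv> I01 (\<lambda>y. \<bar>w y - a (cell y)\<bar>)"
  shows "source_err L2 \<theta> a b (w y) y (P_op w y)
      + flux_err a b (w y) y
    \<le> (2 * e + 4 * B * h + L2 * (h + G ^ 3 * \<epsilon>)) + B * G * TVk X y
      + L * (1 - \<theta>) * phi a (w y) y + L * \<theta> * phi b (w y) y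
      + (\<Sum>j\<in>{1..N}. (4 * L * \<bar>a (right j) - a j\<bar> + 2 * L * \<bar>b j - a j\<bar>) * (G\<^sup>2 * \<epsilon>) * \<omega> (X j - y))
      + 2 * L * G\<^sup>2 * (G\<^sup>2 * \<bar>w y - a (cell y)\<bar> + TVk a y)"
proof -
  note W0 = W_nonneg[of _ y]
  have B0: "B \<ge> 0" using w(2)[of 0] by linarith
  have he: "h / \<epsilon> = \<epsilon>" using eps_sq eps_pos by (simp add: field_simps)
  have Xc: "\<bar>X (cell y) - y\<bar> \<le> h"
  proof -
    have "X (cell y) - X (cell y - 1) = h" using X_pred[of "cell y"] cell_bounds(1)[OF y] by simp
    then show ?thesis using cell_bounds[OF y] by linarith
  qed
  have 1: "(\<Sum>j\<in>{1..N}. \<bar>P_disc N a j - P_op w y\<bar> * W j y) \<le> 2 * e + 4 * B * h + B * G * TVk X y"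
  proof -
    have "(\<Sum>j\<in>{1..N}. \<bar>P_disc N a j - P_op w y\<bar> * W j y)
      \<le> (\<Sum>j\<in>{1..N}. (2 * e + 4 * B * h) * W j y + B * (W j y * \<bar>X (cell y) - X j\<bar>))"
    proof (rule sum_mono)
      fix j assume j: "j \<in> {1..N}"
      have "\<bar>P_disc N a j - P_op w y\<bar> \<le> 2 * e + B * \<bar>X j - y\<bar> + 3 * B * h"
        unfolding e_def by (rule P_disc_close[OF w a j y])
      moreover have "B * \<bar>X j - y\<bar> \<le> B * (\<bar>X (cell y) - X j\<bar> + h)" using Xc B0 by (intro mult_left_mono) auto
      ultimately have "\<bar>P_disc N a j - P_op w y\<bar> \<le> (2 * e + 4 * B * h) + B * \<bar>X (cell y) - X j\<bar>"
        by (simp add: distrib_left)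
      then have "\<bar>P_disc N a j - P_op w y\<bar> * W j y \<le> ((2 * e + 4 * B * h) + B * \<bar>X (cell y) - X j\<bar>) * W j y"
        using W0[OF j] by (rule mult_right_mono)
      then show "\<bar>P_disc N a j - P_op w y\<bar> * W j y \<le> (2 * e + 4 * B * h) * W j y + B * (W j y * \<bar>X (cell y) - X j\<bar>)"
        by (simp add: algebra_simps)
    qed
    also have "\<dots> = (2 * e + 4 * B * h) + B * (\<Sum>j\<in>{1..N}. W j y * \<bar>X (cell y) - X j\<bar>)"
      using sum_W[of y] by (simp only: sum.distrib sum_distrib_left[symmetric] mult_1_right)
    also have "\<dots> \<le> (2 * e + 4 * B * h) + B * (G * TVk X y)"
      using W_TVk[of y X] B0 by (intro add_left_mono mult_left_mono) auto
    finally show ?thesis by simp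
  qed
  have 2: "(\<Sum>j\<in>{1..N}. L2 * (s (X j - y) + h) * W j y) \<le> L2 * (h + G ^ 3 * \<epsilon>)"
  proof -
    have "(\<Sum>j\<in>{1..N}. (s (X j - y) + h) * W j y) \<le> (\<Sum>j\<in>{1..N}. G * \<epsilon> * (h * \<rho> (X j - y)) + h * W j y)"
    proof (rule sum_mono)
      fix j assume j: "j \<in> {1..N}"
      have "s (X j - y) * W j y \<le> s (X j - y) * (G * (h * \<omega> (X j - y)))"
        using j s_nonneg by (intro mult_left_mono W_le) auto
      also have "\<dots> = G * \<epsilon> * (h * (\<omega> (X j - y) * (s (X j - y) / \<epsilon>)))" using eps_pos by simp
      also have "\<dots> \<le> G * \<epsilon> * (h * \<rho> (X j - y))"
        using om_s_rho[of "X j - y"] G1 eps_pos h_pos by (intro mult_left_mono) auto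
      finally show "(s (X j - y) + h) * W j y \<le> G * \<epsilon> * (h * \<rho> (X j - y)) + h * W j y"
        by (simp add: distrib_right)
    qed
    also have "\<dots> = G * \<epsilon> * (\<Sum>j\<in>{1..N}. h * \<rho> (X j - y)) + h"
      using sum_W[of y] by (simp only: sum.distrib sum_distrib_left[symmetric] mult_1_right)
    also have "\<dots> \<le> G * \<epsilon> * G\<^sup>2 + h" using sum_rho[of y] G1 eps_pos by (intro add_right_mono mult_left_mono) auto
    finally have "L2 * (\<Sum>j\<in>{1..N}. (s (X j - y) + h) * W j y) \<le> L2 * (G * \<epsilon> * G\<^sup>2 + h)" using L2 by (rule mult_left_mono)
    then show ?thesis by (simp add: sum_distrib_left mult.assoc power2_eq_square power3_eq_cube mult_ac add.commute)
  qed
  have 3: "(\<Sum>j\<in>{1..N}. 2 * L * \<bar>w y - a j\<bar> * s (X j - y) * (G\<^sup>2 * (h / \<epsilon>) * \<omega> (X j - y)))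
     \<le> 2 * L * G\<^sup>2 * (G\<^sup>2 * \<bar>w y - a (cell y)\<bar> + TVk a y)"
  proof -
    have "(\<Sum>j\<in>{1..N}. \<bar>w y - a j\<bar> * (h * (\<omega> (X j - y) * (s (X j - y) / \<epsilon>))))
      \<le> (\<Sum>j\<in>{1..N}. \<bar>w y - a (cell y)\<bar> * (h * \<rho> (X j - y))
         + h * (\<omega> (X j - y) * (1 + s (X j - y) / \<epsilon>)) * \<bar>a (cell y) - a j\<bar>)"
    proof (rule sum_mono)
      fix j assume j: "j \<in> {1..N}"
      let ?m = "h * (\<omega> (X j - y) * (s (X j - y) / \<epsilon>))"
      have o: "\<omega> (X j - y) \<ge> 0" "s (X j - y) / \<epsilon> \<ge> 0" using om_pos[of "X j - y"] s_nonneg[of "X j - y"] eps_pos by auto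
      have m0: "?m \<ge> 0" by (intro mult_nonneg_nonneg o less_imp_le[OF h_pos])
      have m1: "?m \<le> h * \<rho> (X j - y)" using om_s_rho h_pos by (intro mult_left_mono) auto
      have m2: "?m \<le> h * (\<omega> (X j - y) * (1 + s (X j - y) / \<epsilon>))" using o h_pos by (intro mult_left_mono) auto
      have "\<bar>w y - a j\<bar> * ?m \<le> (\<bar>w y - a (cell y)\<bar> + \<bar>a (cell y) - a j\<bar>) * ?m"
        by (intro mult_right_mono m0) linarith
      also have "\<dots> = \<bar>w y - a (cell y)\<bar> * ?m + ?m * \<bar>a (cell y) - a j\<bar>"
        by (simp only: distrib_right mult.commute[of "\<bar>a (cell y) - a j\<bar>"])
      also have "\<dots> \<le> \<bar>w y - a (cell y)\<bar> * (h * \<rho> (X j - y)) + h * (\<omega> (X j - y) * (1 + s (X j - y) / \<epsilon>)) * \<bar>a (cell y) - a j\<bar>"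
        by (intro add_mono mult_left_mono mult_right_mono m1 m2) auto
      finally show "\<bar>w y - a j\<bar> * ?m \<le> \<bar>w y - a (cell y)\<bar> * (h * \<rho> (X j - y)) + h * (\<omega> (X j - y) * (1 + s (X j - y) / \<epsilon>)) * \<bar>a (cell y) - a j\<bar>" .
    qed
    also have "\<dots> = \<bar>w y - a (cell y)\<bar> * (\<Sum>j\<in>{1..N}. h * \<rho> (X j - y)) + TVk a y"
      unfolding TVk_def by (simp only: sum.distrib sum_distrib_left[symmetric])
    also have "\<dots> \<le> \<bar>w y - a (cell y)\<bar> * G\<^sup>2 + TVk a y" by (intro add_right_mono mult_left_mono sum_rho) auto
    finally have "2 * L * G\<^sup>2 * (\<Sum>j\<in>{1..N}. \<bar>w y - a j\<bar> * (h * (\<omega> (X j - y) * (s (X j - y) / \<epsilon>))))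
       \<le> 2 * L * G\<^sup>2 * (\<bar>w y - a (cell y)\<bar> * G\<^sup>2 + TVk a y)" using L1 by (intro mult_left_mono) auto
    moreover have "2 * L * G\<^sup>2 * (\<Sum>j\<in>{1..N}. \<bar>w y - a j\<bar> * (h * (\<omega> (X j - y) * (s (X j - y) / \<epsilon>))))
       = (\<Sum>j\<in>{1..N}. 2 * L * \<bar>w y - a j\<bar> * s (X j - y) * (G\<^sup>2 * (h / \<epsilon>) * \<omega> (X j - y)))"
      unfolding sum_distrib_left by (intro sum.cong refl) simp
    ultimately show ?thesis by (simp add: mult.commute)
  qed
  have l: "source_err L2 \<theta> a b (w y) y (P_op w y)
    = (\<Sum>j\<in>{1..N}. \<bar>P_disc N a j - P_op w y\<bar> * W j y) + (\<Sum>j\<in>{1..N}. L2 * (s (X j - y) + h) * W j y)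
     + L * (1 - \<theta>) * phi a (w y) y + L * \<theta> * phi b (w y) y"
    unfolding source_err_def phi_def sum_distrib_left sum.distrib[symmetric] by (intro sum.cong refl) (simp add: algebra_simps)
  have l2: "flux_err a b (w y) y
    = (\<Sum>j\<in>{1..N}. (4 * L * \<bar>a (right j) - a j\<bar> + 2 * L * \<bar>b j - a j\<bar>) * (G\<^sup>2 * \<epsilon>) * \<omega> (X j - y))
     + (\<Sum>j\<in>{1..N}. 2 * L * \<bar>w y - a j\<bar> * s (X j - y) * (G\<^sup>2 * (h / \<epsilon>) * \<omega> (X j - y)))"
    unfolding flux_err_def sum.distrib[symmetric] he by (intro sum.cong refl) (simp add: algebra_simps)
  show ?thesis unfolding l l2 using 1 2 3 by linarith
qed

text \<open>The parameter \<open>\<theta>\<close> is the position of the time \<open>t\<close> between the two time levels. Since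
  \<open>\<Delta>x / \<epsilon> = \<epsilon>\<close>, every error of \<open>step_rhs_pointwise\<close> is of order \<open>\<epsilon>\<close> or a multiple of the \<open>L\<^sup>1\<close>
  distance \<open>e\<close> of \<open>w\<close> and \<open>a\<close>, which in turn is at most the interpolated functional plus \<open>O(\<epsilon>)\<close>.\<close>

lemma integrated_step:
  assumes \<theta>: "0 \<le> \<theta>" "\<theta> \<le> 1" and w: "w \<in> borel_measurable borel" "\<And>y. \<bar>w y\<bar> \<le> B"
    and L2: "\<And>x y w. \<bar>w\<bar> \<le> B \<Longrightarrow> \<bar>fx x w - fx y w\<bar> \<le> L2 * \<bar>x - y\<bar>" "L2 \<ge> 0"
    and a: "\<And>j. j \<in> {1..N} \<Longrightarrow> \<bar>a j\<bar> \<le> B"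
    and b: "\<And>j. j \<in> {1..N} \<Longrightarrow> b j = step a j"
    and V: "TV a \<le> V" and D: "h * (\<Sum>j\<in>{1..N}. \<bar>b j - a j\<bar>) \<le> D * \<tau>" "D \<ge> 0"
  defines "CG \<equiv> growth_const L G" and "C2 \<equiv> error_const L G cf B L2 V D"
  shows "(Phi b w - Phi a w) / \<tau> + (1 - \<theta>) * R a w + \<theta> * R b w
    \<le> (1 - \<theta>) * (Z b w - Z a w) + CG * ((1 - \<theta>) * Phi a w + \<theta> * Phi b w) + C2 * \<epsilon>"
proof -
  have bw: "bm {0..1} w" using w by (auto simp: bm_def)
  have B0: "B \<ge> 0" using w(2)[of 0] by linarith
  have V0: "V \<ge> 0" using V TV_nonneg[of a] by linarith
  have iw: "set_integrable lborel {0..1} w" by (rule I01_integrable[OF bw])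
  note bmr = bm_rz[OF w]
  define e where "e = I01 (\<lambda>y. \<bar>w y - a (cell y)\<bar>)"
  define c where "c j = (4 * L * \<bar>a (right j) - a j\<bar> + 2 * L * \<bar>b j - a j\<bar>) * (G\<^sup>2 * \<epsilon>)" for j
  define K where "K = 2 * e + 4 * B * h + L2 * (h + G ^ 3 * \<epsilon>)"
  let ?A = "\<lambda>a y. phi a (w y) y"
  let ?r = "\<lambda>a y. r a (w y) y (P_op w y)" and ?z = "\<lambda>a y. z a (w y) y (P_op w y)"
  have be: "bm {0..1} (\<lambda>y. \<bar>w y - a (cell y)\<bar>)" by (intro bm_abs bm_diff bw bm_cell)
  have bc: "bm {0..1} (\<lambda>y. \<Sum>j\<in>{1..N}. c j * \<omega> (X j - y))" by (intro bm_sum bm_cmult bm_om)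
  have bT: "bm {0..1} (TVk X)" "bm {0..1} (TVk a)" by (rule bm_TVk)+
  have bA: "bm {0..1} (?A a)" for a by (rule bm_phi[OF bw])
  have lhs: "I01 (\<lambda>y. (?A b y - ?A a y) / \<tau> + (1 - \<theta>) * ?r a y + \<theta> * ?r b y)
     = (Phi b w - Phi a w) / \<tau> + (1 - \<theta>) * R a w + \<theta> * R b w"
    unfolding Phi_def R_def
    by (simp only: I01_add I01_diff bm_add bm_diff bm_divide bm_cmult bA bmr set_integral_mult_right set_integral_divide_zero)
  have rhs: "I01 (\<lambda>y. (1 - \<theta>) * (?z b y - ?z a y) + (K + B * G * TVk X y + L * (1 - \<theta>) * ?A a y + L * \<theta> * ?A b y
      + (\<Sum>j\<in>{1..N}. c j * \<omega> (X j - y)) + 2 * L * G\<^sup>2 * (G\<^sup>2 * \<bar>w y - a (cell y)\<bar> + TVk a y)))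
     = (1 - \<theta>) * (Z b w - Z a w) + (K + B * G * I01 (TVk X) + L * (1 - \<theta>) * Phi a w + L * \<theta> * Phi b w
      + (\<Sum>j\<in>{1..N}. c j) + 2 * L * G\<^sup>2 * (G\<^sup>2 * e + I01 (TVk a)))"
  proof -
    have "I01 (\<lambda>y. \<Sum>j\<in>{1..N}. c j * \<omega> (X j - y)) = (\<Sum>j\<in>{1..N}. c j)"
      by (subst I01_sum) (auto simp: I01_om intro!: bm_cmult bm_om)
    then show ?thesis unfolding Phi_def Z_def e_def
      by (simp only: I01_add I01_diff bm_add bm_diff bm_cmult bm_const bA bmr be bc bT I01_const set_integral_mult_right)
  qed
  have "(Phi b w - Phi a w) / \<tau> + (1 - \<theta>) * R a w + \<theta> * R b w
    \<le> (1 - \<theta>) * (Z b w - Z a w) + (K + B * G * I01 (TVk X) + L * (1 - \<theta>) * Phi a w + L * \<theta> * Phi b w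
      + (\<Sum>j\<in>{1..N}. c j) + 2 * L * G\<^sup>2 * (G\<^sup>2 * e + I01 (TVk a)))"
    unfolding lhs[symmetric] rhs[symmetric]
  proof (rule I01_mono)
    show "bm {0..1} (\<lambda>y. (?A b y - ?A a y) / \<tau> + (1 - \<theta>) * ?r a y + \<theta> * ?r b y)"
      by (intro bm_add bm_diff bm_divide bm_cmult bA bmr)
    show "bm {0..1} (\<lambda>y. (1 - \<theta>) * (?z b y - ?z a y) + (K + B * G * TVk X y + L * (1 - \<theta>) * ?A a y + L * \<theta> * ?A b y
      + (\<Sum>j\<in>{1..N}. c j * \<omega> (X j - y)) + 2 * L * G\<^sup>2 * (G\<^sup>2 * \<bar>w y - a (cell y)\<bar> + TVk a y)))"
      by (intro bm_add bm_diff bm_cmult bm_const bA bmr be bc bT)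
    fix y :: real assume y: "y \<in> {0..1}"
    have "(?A b y - ?A a y) / \<tau> + (1 - \<theta>) * ?r a y + \<theta> * ?r b y \<le> (1 - \<theta>) * (?z b y - ?z a y)
      + source_err L2 \<theta> a b (w y) y (P_op w y)
      + flux_err a b (w y) y"
      by (rule pointwise_step[OF y \<theta> w(2) L2 b])
    moreover have "source_err L2 \<theta> a b (w y) y (P_op w y)
      + flux_err a b (w y) y
      \<le> K + B * G * TVk X y + L * (1 - \<theta>) * ?A a y + L * \<theta> * ?A b y
      + (\<Sum>j\<in>{1..N}. c j * \<omega> (X j - y)) + 2 * L * G\<^sup>2 * (G\<^sup>2 * \<bar>w y - a (cell y)\<bar> + TVk a y)"
      unfolding K_def c_def e_def by (rule step_rhs_pointwise[OF y w a L2(2)])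
    ultimately show "(?A b y - ?A a y) / \<tau> + (1 - \<theta>) * ?r a y + \<theta> * ?r b y \<le> (1 - \<theta>) * (?z b y - ?z a y)
      + (K + B * G * TVk X y + L * (1 - \<theta>) * ?A a y + L * \<theta> * ?A b y
      + (\<Sum>j\<in>{1..N}. c j * \<omega> (X j - y)) + 2 * L * G\<^sup>2 * (G\<^sup>2 * \<bar>w y - a (cell y)\<bar> + TVk a y))"
      by linarith
  qed
  moreover have "K + B * G * I01 (TVk X) + L * (1 - \<theta>) * Phi a w + L * \<theta> * Phi b w
      + (\<Sum>j\<in>{1..N}. c j) + 2 * L * G\<^sup>2 * (G\<^sup>2 * e + I01 (TVk a))
    \<le> CG * ((1 - \<theta>) * Phi a w + \<theta> * Phi b w) + C2 * \<epsilon>"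
  proof -
    define p where "p = (1 - \<theta>) * Phi a w + \<theta> * Phi b w"
    have th: "h \<le> \<epsilon>" "\<tau> \<le> cf * h" using h_le_eps dt_le by auto
    have Dt: "D * \<tau> \<le> D * (cf * \<epsilon>)"
    proof (intro mult_left_mono D(2))
      have "cf * h \<le> cf * \<epsilon>" using h_le_eps cf_pos by (intro mult_left_mono) auto
      then show "\<tau> \<le> cf * \<epsilon>" using dt_le by linarith
    qed
    have ep: "e \<le> p + (G * (D * cf) + 4 * V * G\<^sup>2) * \<epsilon>"
    proof -
      have "e \<le> Phi a w + G * I01 (TVk a)" unfolding e_def by (rule Phi_L1[OF iw])
      also have "G * I01 (TVk a) \<le> G * (4 * V * \<epsilon> * G)" using TVk_TV[OF V] G1 by (intro mult_left_mono) auto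
      finally have 1: "e \<le> Phi a w + 4 * V * G\<^sup>2 * \<epsilon>" by (simp add: power2_eq_square mult_ac)
      have "Phi a w \<le> Phi b w + G * (h * (\<Sum>j\<in>{1..N}. \<bar>a j - b j\<bar>))" by (rule Phi_lipschitz[OF iw])
      also have "(h * (\<Sum>j\<in>{1..N}. \<bar>a j - b j\<bar>)) \<le> D * (cf * \<epsilon>)" using D Dt by (simp add: abs_minus_commute)
      finally have 2: "Phi a w \<le> Phi b w + G * (D * (cf * \<epsilon>))" using G1 by (simp add: mult_left_mono)
      have "\<theta> * Phi a w \<le> \<theta> * (Phi b w + G * (D * (cf * \<epsilon>)))" using 2 \<theta> by (intro mult_left_mono) auto
      moreover have "\<theta> * (G * (D * (cf * \<epsilon>))) \<le> 1 * (G * (D * (cf * \<epsilon>)))"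
        using \<theta> G1 D cf_pos eps_pos by (intro mult_right_mono) auto
      ultimately have "Phi a w \<le> p + G * (D * (cf * \<epsilon>))" unfolding p_def by (simp add: algebra_simps)
      then show ?thesis using 1 by (simp add: algebra_simps)
    qed
    have cs: "(\<Sum>j\<in>{1..N}. c j) \<le> G\<^sup>2 * (4 * L * V + 2 * L * (D * cf)) * \<epsilon>"
    proof -
      have "h * (\<Sum>j\<in>{1..N}. \<bar>b j - a j\<bar>) \<le> h * (D * cf)"
        using order_trans[OF D(1) mult_left_mono[OF th(2) D(2)]] by (simp add: mult_ac)
      then have bb: "(\<Sum>j\<in>{1..N}. \<bar>b j - a j\<bar>) \<le> D * cf" using h_pos by simp
      have "(\<Sum>j\<in>{1..N}. c j) = (4 * L * TV a + 2 * L * (\<Sum>j\<in>{1..N}. \<bar>b j - a j\<bar>)) * (G\<^sup>2 * \<epsilon>)"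
        unfolding c_def TV_def by (simp only: sum_distrib_right[symmetric] sum.distrib sum_distrib_left[symmetric])
      also have "\<dots> \<le> (4 * L * V + 2 * L * (D * cf)) * (G\<^sup>2 * \<epsilon>)"
        using V bb L1 eps_pos by (intro mult_right_mono add_mono mult_left_mono) auto
      finally show ?thesis by (simp add: mult_ac)
    qed
    have K: "K \<le> 2 * e + 4 * B * \<epsilon> + L2 * (1 + G ^ 3) * \<epsilon>"
    proof -
      have "4 * B * h \<le> 4 * B * \<epsilon>" using th B0 by (intro mult_left_mono) auto
      moreover have "L2 * (h + G ^ 3 * \<epsilon>) \<le> L2 * (\<epsilon> + G ^ 3 * \<epsilon>)" using th L2 by (intro mult_left_mono) auto
      ultimately show ?thesis unfolding K_def by (simp add: algebra_simps)
    qed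
    have tx: "B * G * I01 (TVk X) \<le> 4 * B * G\<^sup>2 * \<epsilon>"
      using mult_left_mono[OF TVk_X, of "B * G"] B0 G1 by (simp add: power2_eq_square mult_ac)
    have ta: "2 * L * G\<^sup>2 * (G\<^sup>2 * e + I01 (TVk a)) \<le> 2 * L * G ^ 4 * e + 8 * L * G ^ 3 * V * \<epsilon>"
    proof -
      have "2 * L * G\<^sup>2 * I01 (TVk a) \<le> 2 * L * G\<^sup>2 * (4 * V * \<epsilon> * G)"
        using TVk_TV[OF V] L1 by (intro mult_left_mono) auto
      then show ?thesis by (simp add: distrib_left power2_eq_square power3_eq_cube power4_eq_xxxx mult_ac)
    qed
    have ee: "(2 + 2 * L * G ^ 4) * e \<le> (2 + 2 * L * G ^ 4) * (p + (G * (D * cf) + 4 * V * G\<^sup>2) * \<epsilon>)"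
      using ep L1 G1 by (intro mult_left_mono) auto
    have pp: "L * (1 - \<theta>) * Phi a w + L * \<theta> * Phi b w = L * p" unfolding p_def by (simp add: algebra_simps)
    have "K + B * G * I01 (TVk X) + L * (1 - \<theta>) * Phi a w + L * \<theta> * Phi b w
      + (\<Sum>j\<in>{1..N}. c j) + 2 * L * G\<^sup>2 * (G\<^sup>2 * e + I01 (TVk a))
      \<le> (2 + 2 * L * G ^ 4) * e + 4 * B * \<epsilon> + L2 * (1 + G ^ 3) * \<epsilon> + 4 * B * G\<^sup>2 * \<epsilon> + L * p
       + G\<^sup>2 * (4 * L * V + 2 * L * (D * cf)) * \<epsilon> + 8 * L * G ^ 3 * V * \<epsilon>"
      using K tx ta cs pp by (simp add: distrib_right)
    also have "\<dots> \<le> (2 + 2 * L * G ^ 4) * (p + (G * (D * cf) + 4 * V * G\<^sup>2) * \<epsilon>) + 4 * B * \<epsilon> + L2 * (1 + G ^ 3) * \<epsilon> + 4 * B * G\<^sup>2 * \<epsilon> + L * p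
       + G\<^sup>2 * (4 * L * V + 2 * L * (D * cf)) * \<epsilon> + 8 * L * G ^ 3 * V * \<epsilon>"
      using ee by simp
    also have "\<dots> = CG * p + C2 * \<epsilon>" unfolding CG_def C2_def growth_const_def error_const_def by (simp only: distrib_left distrib_right mult.assoc add.assoc add_ac)
    finally show ?thesis unfolding p_def .
  qed
  ultimately show ?thesis by linarith
qed

end

section \<open>Hat functions in time as limits of smooth functions\<close>

text \<open>A smooth convex approximation of the absolute value, with derivative bounded by one.
  Convexity makes the second differences in \<open>softhat\<close> nonnegative, hence admissible as test
  functions.\<close>

definition softabs :: "real \<Rightarrow> real \<Rightarrow> real" where "softabs d x = sqrt (x\<^sup>2 + d\<^sup>2)"

lemma softabs_pos: "d > 0 \<Longrightarrow> x\<^sup>2 + d\<^sup>2 > (0::real)"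
  by (simp add: add_nonneg_pos)

lemma softabs_smooth: assumes "d > 0" shows "Ck1 k (softabs d)"
proof -
  have "Ck1 k (\<lambda>x. sqrt ((1 * x + 0) * (1 * x + 0) + d\<^sup>2))"
    using softabs_pos[OF assms] by (intro Ck1_sqrt Ck1_add Ck1_mult Ck1_affine Ck1_const) (simp add: power2_eq_square)
  then show ?thesis by (simp add: softabs_def[abs_def] power2_eq_square)
qed

lemma softabs_deriv: "d > 0 \<Longrightarrow> (softabs d has_real_derivative x / softabs d x) (at x)"
  unfolding softabs_def[abs_def] using softabs_pos[of d x]
  by (auto intro!: derivative_eq_intros simp: divide_simps)

lemma softabs_deriv_bound: "d > 0 \<Longrightarrow> \<bar>x / softabs d x\<bar> \<le> 1"
proof -
  assume d: "d > 0"
  have "\<bar>x\<bar> \<le> softabs d x" unfolding softabs_def by (rule real_le_rsqrt) simp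
  then show ?thesis using d softabs_pos[of d x] by (simp add: softabs_def divide_le_eq)
qed

text \<open>The value is the Euclidean norm of \<open>(x, d)\<close>, so this is the triangle inequality.\<close>

lemma softabs_convex: "2 * softabs d x \<le> softabs d (x - e) + softabs d (x + e)"
proof -
  have n: "softabs d x = norm (x, d)" for x by (simp add: softabs_def norm_prod_def)
  have "2 * norm (x, d) = norm (2 *\<^sub>R (x, d))" by (simp only: norm_scaleR abs_numeral)
  also have "2 *\<^sub>R (x, d) = (x - e, d) + (x + e, d)" by simp
  also have "norm \<dots> \<le> norm (x - e, d) + norm (x + e, d)" by (rule norm_triangle_ineq)
  finally show ?thesis by (simp add: n)
qed

lemma softabs_upper: "0 < d \<Longrightarrow> d \<le> 1 \<Longrightarrow> softabs d x \<le> \<bar>x\<bar> + 1"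
  unfolding softabs_def by (rule order_trans[OF sqrt_sum_squares_le_sum_abs]) simp

lemma softabs_limit:
  assumes "dd \<longlonglongrightarrow> 0"
  shows "(\<lambda>n. softabs (dd n) x) \<longlonglongrightarrow> \<bar>x\<bar>" "(\<And>n. dd n > 0) \<Longrightarrow> (\<lambda>n. x / softabs (dd n) x) \<longlonglongrightarrow> sgn x"
proof -
  have "(\<lambda>n. sqrt (x\<^sup>2 + (dd n)\<^sup>2)) \<longlonglongrightarrow> sqrt (x\<^sup>2 + 0\<^sup>2)" using assms by (intro tendsto_intros)
  then show 1: "(\<lambda>n. softabs (dd n) x) \<longlonglongrightarrow> \<bar>x\<bar>" by (simp add: softabs_def)
  show "(\<lambda>n. x / softabs (dd n) x) \<longlonglongrightarrow> sgn x"
  proof (cases "x = 0")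
    case False
    then have "(\<lambda>n. x / softabs (dd n) x) \<longlonglongrightarrow> x / \<bar>x\<bar>" using 1 by (intro tendsto_intros) auto
    then show ?thesis by (simp only: real_sgn_eq)
  qed simp
qed

text \<open>The hat with peak \<open>p\<close> and half width \<open>d\<close>, written as a second difference of the absolute
  value; \<open>hat'\<close> is its derivative with the mean value at the three kinks.\<close>

definition hat :: "real \<Rightarrow> real \<Rightarrow> real \<Rightarrow> real" where
  "hat p d t = (\<bar>t - p - d\<bar> + \<bar>t - p + d\<bar> - 2 * \<bar>t - p\<bar>) / (2 * d)"
definition hat' :: "real \<Rightarrow> real \<Rightarrow> real \<Rightarrow> real" where
  "hat' p d t = (sgn (t - p - d) + sgn (t - p + d) - 2 * sgn (t - p)) / (2 * d)"

definition softhat :: "real \<Rightarrow> real \<Rightarrow> real \<Rightarrow> real \<Rightarrow> real" where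
  "softhat \<delta> p d t = (softabs \<delta> (t - p - d) + softabs \<delta> (t - p + d) - 2 * softabs \<delta> (t - p)) / (2 * d)"
definition softhat' :: "real \<Rightarrow> real \<Rightarrow> real \<Rightarrow> real \<Rightarrow> real" where
  "softhat' \<delta> p d t = ((t - p - d) / softabs \<delta> (t - p - d) + (t - p + d) / softabs \<delta> (t - p + d)
     - 2 * ((t - p) / softabs \<delta> (t - p))) / (2 * d)"

lemma softhat_nonneg: "d > 0 \<Longrightarrow> softhat \<delta> p d t \<ge> 0"
  using softabs_convex[of \<delta> "t - p" d] by (simp add: softhat_def)

lemma softhat_deriv:
  assumes "\<delta> > 0" shows "(softhat \<delta> p d has_real_derivative softhat' \<delta> p d t) (at t)"
proof -
  have "((\<lambda>t. softabs \<delta> (t - c)) has_real_derivative (t - c) / softabs \<delta> (t - c)) (at t)" for c t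
    by (rule DERIV_cong[OF DERIV_chain2[OF softabs_deriv[OF assms] DERIV_diff[OF DERIV_ident DERIV_const]]]) simp
  from DERIV_cdivide[OF DERIV_diff[OF DERIV_add[OF this[of "p + d"] this[of "p - d"]] DERIV_cmult[OF this[of p]]], of 2 "2 * d" t]
  show ?thesis unfolding softhat_def[abs_def] softhat'_def by (simp add: algebra_simps)
qed

lemma softhat_smooth: assumes "\<delta> > 0" shows "Ck1 k (softhat \<delta> p d)"
proof -
  have 1: "Ck1 k (\<lambda>t. softabs \<delta> (1 * t + c))" for c by (intro Ck1_affine_arg softabs_smooth assms)
  have "Ck1 k (\<lambda>t. (1 / (2 * d)) * (softabs \<delta> (1 * t + (- p - d)) + softabs \<delta> (1 * t + (- p + d)) - 2 * softabs \<delta> (1 * t + (- p))))"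
    by (intro Ck1_cmult Ck1_add Ck1_diff 1)
  also have "(\<lambda>t. (1 / (2 * d)) * (softabs \<delta> (1 * t + (- p - d)) + softabs \<delta> (1 * t + (- p + d)) - 2 * softabs \<delta> (1 * t + (- p)))) = softhat \<delta> p d"
  proof
    fix t
    have "1 * t + (- p - d) = t - p - d" "1 * t + (- p + d) = t - p + d" "1 * t + (- p) = t - p" by simp_all
    then show "(1 / (2 * d)) * (softabs \<delta> (1 * t + (- p - d)) + softabs \<delta> (1 * t + (- p + d)) - 2 * softabs \<delta> (1 * t + (- p))) = softhat \<delta> p d t"
      by (simp only: softhat_def) simp
  qed
  finally show ?thesis .
qed

lemma softhat'_bound:
  assumes "\<delta> > 0" "d > 0" shows "\<bar>softhat' \<delta> p d t\<bar> \<le> 2 / d"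
proof -
  have "\<bar>(t - p - d) / softabs \<delta> (t - p - d) + (t - p + d) / softabs \<delta> (t - p + d) - 2 * ((t - p) / softabs \<delta> (t - p))\<bar> \<le> 4"
    using softabs_deriv_bound[OF assms(1), of "t - p - d"] softabs_deriv_bound[OF assms(1), of "t - p + d"]
      softabs_deriv_bound[OF assms(1), of "t - p"] by linarith
  then have "\<bar>(t - p - d) / softabs \<delta> (t - p - d) + (t - p + d) / softabs \<delta> (t - p + d) - 2 * ((t - p) / softabs \<delta> (t - p))\<bar> / (2 * d) \<le> 4 / (2 * d)"
    using assms(2) by (intro divide_right_mono) auto
  then show ?thesis using assms(2) by (simp add: softhat'_def abs_divide)
qed

lemma softhat_bound:
  assumes "\<delta> > 0" "\<delta> \<le> 1" "d > 0" "\<bar>t\<bar> \<le> S" shows "\<bar>softhat \<delta> p d t\<bar> \<le> (S + \<bar>p\<bar> + d + 1) / d"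
proof -
  have s0: "softabs \<delta> x \<ge> 0" for x by (simp add: softabs_def)
  have "softhat \<delta> p d t \<le> (2 * (S + \<bar>p\<bar> + d + 1)) / (2 * d)" unfolding softhat_def
  proof (rule divide_right_mono)
    have "\<bar>t - p - d\<bar> \<le> S + \<bar>p\<bar> + d" "\<bar>t - p + d\<bar> \<le> S + \<bar>p\<bar> + d" using assms by linarith+
    then have "softabs \<delta> (t - p - d) \<le> (S + \<bar>p\<bar> + d) + 1" "softabs \<delta> (t - p + d) \<le> (S + \<bar>p\<bar> + d) + 1"
      using order_trans[OF softabs_upper[OF assms(1,2)] add_right_mono] by blast+
    moreover have "x + y - 2 * z \<le> 2 * (A + 1)" if "x \<le> A + 1" "y \<le> A + 1" "0 \<le> z" for x y z A :: real
      using that by argo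
    ultimately show "softabs \<delta> (t - p - d) + softabs \<delta> (t - p + d) - 2 * softabs \<delta> (t - p) \<le> 2 * (S + \<bar>p\<bar> + d + 1)"
      using s0 by blast
  qed (use assms in simp)
  then have "softhat \<delta> p d t \<le> (S + \<bar>p\<bar> + d + 1) / d" by (simp only: mult_divide_mult_cancel_left_if) simp
  then show ?thesis using softhat_nonneg[OF assms(3), of \<delta> p t] by simp
qed

text \<open>The hats are bounded limits of smooth nonnegative functions whose derivatives converge at
  every point, so dominated convergence applies.\<close>

lemma hat_inequality:
  assumes T: "T \<ge> 0" and d: "d > 0" and c: "c \<ge> 0" and A: "bm {0..T} A" and B: "bm {0..T} B"
    and ineq: "\<And>h h'. (\<And>k. Ck1 k h) \<Longrightarrow> (\<And>t. (h has_real_derivative h' t) (at t)) \<Longrightarrow> (\<And>t. h t \<ge> 0) \<Longrightarrow>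
       (LINT t:{0..T}|lborel. h' t * A t + h t * B t) \<ge> h T * AT - h 0 * A0"
  shows "(LINT t:{0..T}|lborel. exp (- c * t) * ((hat' p d t - c * hat p d t) * A t + hat p d t * B t))
     \<ge> exp (- c * T) * hat p d T * AT - hat p d 0 * A0"
proof -
  define dd where "dd n = 1 / real (Suc n)" for n
  have dd: "dd n > 0" "dd n \<le> 1" for n by (auto simp: dd_def)
  have dd0: "dd \<longlonglongrightarrow> 0" unfolding dd_def by (rule lim_1_over_n[THEN LIMSEQ_Suc])
  define h where "h n t = exp (- c * t) * softhat (dd n) p d t" for n t
  define g where "g n t = exp (- c * t) * ((softhat' (dd n) p d t - c * softhat (dd n) p d t) * A t + softhat (dd n) p d t * B t)" for n t
  obtain CA CB where CA: "\<forall>t\<in>{0..T}. \<bar>A t\<bar> \<le> CA" and CB: "\<forall>t\<in>{0..T}. \<bar>B t\<bar> \<le> CB" using A B by (auto simp: bm_def)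
  have [measurable]: "A \<in> borel_measurable borel" "B \<in> borel_measurable borel" using A B by (auto simp: bm_def)
  have CA0: "CA \<ge> 0" "CB \<ge> 0" using CA CB T order_trans[OF abs_ge_zero] by (meson atLeastAtMost_iff order_refl)+
  have ineqn: "(LINT t:{0..T}|lborel. g n t) \<ge> h n T * AT - h n 0 * A0" for n
  proof -
    have "Ck1 k (h n)" for k
    proof -
      have "Ck1 k (\<lambda>t. exp ((- c) * t + 0) * softhat (dd n) p d t)"
        by (intro Ck1_mult Ck1_exp Ck1_affine softhat_smooth dd)
      then show ?thesis by (simp add: h_def[abs_def])
    qed
    moreover have "(h n has_real_derivative exp (- c * t) * (softhat' (dd n) p d t - c * softhat (dd n) p d t)) (at t)" for t
    proof -
      have e: "((\<lambda>t. exp (- c * t)) has_real_derivative exp (- c * t) * (- c)) (at t)"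
        by (auto intro!: derivative_eq_intros)
      show ?thesis unfolding h_def[abs_def]
        by (rule DERIV_cong[OF DERIV_mult[OF e softhat_deriv[OF dd(1)]]]) (simp add: algebra_simps)
    qed
    moreover have "h n t \<ge> 0" for t using softhat_nonneg[OF d] by (simp add: h_def)
    ultimately have "(LINT t:{0..T}|lborel. exp (- c * t) * (softhat' (dd n) p d t - c * softhat (dd n) p d t) * A t + h n t * B t)
      \<ge> h n T * AT - h n 0 * A0" by (rule ineq)
    moreover have "exp (- c * t) * (softhat' (dd n) p d t - c * softhat (dd n) p d t) * A t + h n t * B t = g n t" for t
      by (simp add: g_def h_def algebra_simps)
    ultimately show ?thesis by simp
  qed
  have l1: "(\<lambda>n. softhat (dd n) p d t) \<longlonglongrightarrow> hat p d t" for t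
    unfolding softhat_def hat_def using d by (intro tendsto_intros softabs_limit(1)[OF dd0]) auto
  have l2: "(\<lambda>n. softhat' (dd n) p d t) \<longlonglongrightarrow> hat' p d t" for t
    unfolding softhat'_def hat'_def using d by (intro tendsto_intros softabs_limit(2)[OF dd0] dd) auto
  have lg: "(\<lambda>n. g n t) \<longlonglongrightarrow> exp (- c * t) * ((hat' p d t - c * hat p d t) * A t + hat p d t * B t)" for t
    unfolding g_def by (intro tendsto_intros l1 l2)
  define S where "S = (T + \<bar>p\<bar> + d + 1) / d"
  have S0: "S \<ge> 0" using T d by (simp add: S_def)
  define C where "C = (2 / d + c * S) * CA + S * CB"
  have gb: "\<bar>g n t\<bar> \<le> C" if t: "t \<in> {0..T}" for n t
  proof -
    have e: "0 \<le> exp (- c * t)" "exp (- c * t) \<le> 1" using c t by (auto simp: mult_nonpos_nonneg)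
    have s: "\<bar>softhat (dd n) p d t\<bar> \<le> S" unfolding S_def by (rule softhat_bound[OF dd d]) (use t in auto)
    have s': "\<bar>softhat' (dd n) p d t\<bar> \<le> 2 / d" by (rule softhat'_bound[OF dd(1) d])
    have "\<bar>c * softhat (dd n) p d t\<bar> \<le> c * S" using s c by (simp add: abs_mult mult_left_mono)
    then have "\<bar>softhat' (dd n) p d t - c * softhat (dd n) p d t\<bar> \<le> 2 / d + c * S" using s' by linarith
    then have "\<bar>(softhat' (dd n) p d t - c * softhat (dd n) p d t) * A t\<bar> \<le> (2 / d + c * S) * CA"
      unfolding abs_mult using CA t c d S0 by (intro mult_mono) auto
    moreover have "\<bar>softhat (dd n) p d t * B t\<bar> \<le> S * CB" unfolding abs_mult using s CB t S0 by (intro mult_mono) auto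
    ultimately have "\<bar>(softhat' (dd n) p d t - c * softhat (dd n) p d t) * A t + softhat (dd n) p d t * B t\<bar> \<le> C"
      unfolding C_def by linarith
    then have "exp (- c * t) * \<bar>(softhat' (dd n) p d t - c * softhat (dd n) p d t) * A t + softhat (dd n) p d t * B t\<bar> \<le> 1 * C"
      using e by (intro mult_mono) auto
    then show ?thesis by (simp add: g_def abs_mult)
  qed
  have m1: "softhat (dd n) p d \<in> borel_measurable borel" for n
    using Ck1_cont[OF softhat_smooth[OF dd(1)]] by (rule borel_measurable_continuous_onI)
  have m2: "softhat' (dd n) p d \<in> borel_measurable borel" for n
    unfolding softhat'_def[abs_def] softabs_def by measurable
  have [measurable]: "g n \<in> borel_measurable borel" for n unfolding g_def[abs_def] using m1 m2 by measurable
  have [measurable]: "(\<lambda>t. exp (- c * t) * ((hat' p d t - c * hat p d t) * A t + hat p d t * B t)) \<in> borel_measurable borel"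
    unfolding hat_def hat'_def by measurable
  have lim: "(\<lambda>n. LINT t:{0..T}|lborel. g n t) \<longlonglongrightarrow>
     (LINT t:{0..T}|lborel. exp (- c * t) * ((hat' p d t - c * hat p d t) * A t + hat p d t * B t))"
    unfolding set_lebesgue_integral_def
  proof (rule integral_dominated_convergence[where w = "\<lambda>t. indicator {0..T} t *\<^sub>R C"])
    show "integrable lborel (\<lambda>t. indicator {0..T} t *\<^sub>R C)"
      unfolding set_integrable_def[symmetric]
      by (rule bm_integrable_Icc[OF bm_const])
    show "AE t in lborel. (\<lambda>n. indicator {0..T} t *\<^sub>R g n t) \<longlonglongrightarrow>
      indicator {0..T} t *\<^sub>R (exp (- c * t) * ((hat' p d t - c * hat p d t) * A t + hat p d t * B t))"
      by (intro AE_I2 tendsto_intros lg)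
    show "AE t in lborel. norm (indicator {0..T} t *\<^sub>R g n t) \<le> indicator {0..T} t *\<^sub>R C" for n
      using gb by (intro AE_I2) (auto simp: indicator_def)
    show "(\<lambda>t. indicator {0..T} t *\<^sub>R (exp (- c * t) * ((hat' p d t - c * hat p d t) * A t + hat p d t * B t))) \<in> borel_measurable lborel"
      by measurable
    show "(\<lambda>t. indicator {0..T} t *\<^sub>R g n t) \<in> borel_measurable lborel" for n
      by measurable
  qed
  have "(\<lambda>n. h n T * AT - h n 0 * A0) \<longlonglongrightarrow> exp (- c * T) * hat p d T * AT - exp (- c * 0) * hat p d 0 * A0"
    unfolding h_def by (intro tendsto_intros l1)
  from LIMSEQ_le[OF this lim] ineqn show ?thesis by auto
qed

section \<open>The entropy inequality with separated variables\<close>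

lemma AE_lborel_fst:
  assumes "AE t in (lborel :: real measure). Q t"
  shows "AE p in (lborel :: (real \<times> real) measure). Q (fst p)"
proof -
  obtain n where n: "{t. \<not> Q t} \<subseteq> n" "n \<in> null_sets lborel" using assms by (auto simp: eventually_ae_filter)
  have "emeasure (lborel \<Otimes>\<^sub>M lborel) (n \<times> (UNIV :: real set)) = emeasure lborel n * emeasure lborel (UNIV :: real set)"
    using n by (intro lborel.emeasure_pair_measure_Times) auto
  then have "n \<times> UNIV \<in> null_sets (lborel \<Otimes>\<^sub>M lborel :: (real \<times> real) measure)" using n by (auto simp: null_sets_def)
  then have "n \<times> UNIV \<in> null_sets (lborel :: (real \<times> real) measure)" by (simp only: lborel_prod)
  moreover have "{p \<in> space lborel. \<not> Q (fst p)} \<subseteq> n \<times> UNIV" using n by auto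
  ultimately show ?thesis by (rule AE_I'[rotated, rotated, of _ _ ]) 
qed

lemma P_op_cong_AE:
  assumes [measurable]: "w1 \<in> borel_measurable borel" "w2 \<in> borel_measurable borel"
    and ae: "AE y in lborel. w1 y = w2 y"
  shows "P_op w1 x = P_op w2 x"
proof -
  have "(LINT y:{0..x}|lborel. w1 y) = (LINT y:{0..x}|lborel. w2 y)" for x
    by (rule set_lebesgue_integral_cong_AE) (use ae in auto)
  then show ?thesis unfolding P_op_def by simp
qed

lemma P_op_cong:
  assumes "\<And>y. y \<in> {0..1} \<Longrightarrow> w1 y = w2 y" "x \<in> {0..1}"
  shows "P_op w1 x = P_op w2 x"
proof -
  have 1: "(LINT y:{0..x}|lborel. w1 y) = (LINT y:{0..x}|lborel. w2 y)" if "x \<in> {0..1}" for x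
    by (rule set_lebesgue_integral_cong) (use assms that in auto)
  have "I01 (\<lambda>y. LINT z:{0..y}|lborel. w1 z) = I01 (\<lambda>y. LINT z:{0..y}|lborel. w2 z)"
    by (rule set_lebesgue_integral_cong) (simp, intro allI impI 1)
  then show ?thesis unfolding P_op_def using 1[OF assms(2)] by simp
qed

text \<open>A solution is bounded and measurable only up to null sets of the rectangle. Truncation
  yields a Borel function on the plane with a bound everywhere. The untruncated extension \<open>U\<close> by
  zero agrees with \<open>u\<close> at every point of the rectangle; it carries the measurability in the
  passage from \<open>u\<close> to \<open>v\<close>.\<close>

lemma bounded_representative:
  assumes "Linf_Pi T u"
  obtains U v :: "real \<times> real \<Rightarrow> real" and B where "U \<in> borel_measurable borel" "v \<in> borel_measurable borel" "B \<ge> 0"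
    "\<And>p. \<bar>v p\<bar> \<le> B" "AE p in lborel. U p = v p" "\<And>t x. t \<in> {0..T} \<Longrightarrow> x \<in> {0..1} \<Longrightarrow> U (t, x) = u t x"
proof -
  obtain B where B: "AE (t, x) in lborel. (t, x) \<in> {0..T} \<times> {0..1} \<longrightarrow> \<bar>u t x\<bar> \<le> B"
    using assms by (auto simp: Linf_Pi_def)
  define U where "U p = indicator ({0..T} \<times> {0..1}) p *\<^sub>R (case p of (t, x) \<Rightarrow> u t x)" for p
  define v where "v p = max (- \<bar>B\<bar>) (min \<bar>B\<bar> (U p))" for p
  have U: "U \<in> borel_measurable borel" using assms by (simp add: Linf_Pi_def set_borel_measurable_def U_def[abs_def])
  show ?thesis
  proof (rule that[of U v "\<bar>B\<bar>"])
    show "v \<in> borel_measurable borel" unfolding v_def[abs_def] using U by measurable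
    show "\<bar>v p\<bar> \<le> \<bar>B\<bar>" for p by (auto simp: v_def)
    show "AE p in lborel. U p = v p" using B
      by eventually_elim (auto simp: U_def v_def indicator_def split: prod.splits)
    show "U (t, x) = u t x" if "t \<in> {0..T}" "x \<in> {0..1}" for t x using that by (simp add: U_def)
  qed (use U in auto)
qed

context flux_setting
begin

text \<open>By Fubini the space-time integral becomes an integral over time of spatial integrals \<open>A\<close>
  and \<open>C\<close>. The nonlocal source of \<open>v\<close> agrees with that of \<open>u\<close> for almost every time, because \<open>u\<close>
  and \<open>v\<close> agree almost everywhere on almost every time slice.\<close>

lemma entropy_time_form:
  assumes e: "entropy_ineq T f u k (\<lambda>t x. h t * W x)"
    and hs: "\<And>t. (h has_real_derivative h' t) (at t)" "continuous_on UNIV h" "continuous_on UNIV h'"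
    and Ws: "\<And>x. (W has_real_derivative W' x) (at x)" "continuous_on UNIV W" "continuous_on UNIV W'"
    and U: "U \<in> borel_measurable borel" and v: "v \<in> borel_measurable borel" "\<And>p. \<bar>v p\<bar> \<le> B"
    and Uv: "AE p in lborel. U p = v p" and Uu: "\<And>t x. t \<in> {0..T} \<Longrightarrow> x \<in> {0..1} \<Longrightarrow> U (t, x) = u t x"
  defines "A \<equiv> \<lambda>t. I01 (\<lambda>y. \<bar>v (t, y) - k\<bar> * W y)"
    and "C \<equiv> \<lambda>t. I01 (\<lambda>y. sgn (v (t, y) - k) * (f y (v (t, y)) - f y k) * W' y
         - sgn (v (t, y) - k) * fx y k * W y + sgn (v (t, y) - k) * P_op (\<lambda>y. v (t, y)) y * W y)"
  shows "(LINT t:{0..T}|lborel. h' t * A t + h t * C t)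
     \<ge> h T * I01 (\<lambda>x. \<bar>u T x - k\<bar> * W x) - h 0 * I01 (\<lambda>x. \<bar>u 0 x - k\<bar> * W x)"
    and "bm {0..T} A" "bm {0..T} C"
proof -
  let ?R = "{0..T} \<times> {0..1} :: (real \<times> real) set"
  define PP where "PP U = (\<lambda>p. P_op (\<lambda>y. U (fst p, y)) (snd p))" for U :: "real \<times> real \<Rightarrow> real"
  define g where "g U PU p = \<bar>U p - k\<bar> * (h' (fst p) * W (snd p))
     + sgn (U p - k) * (f (snd p) (U p) - f (snd p) k) * (h (fst p) * W' (snd p))
     - sgn (U p - k) * fx (snd p) k * (h (fst p) * W (snd p))
     + sgn (U p - k) * PU p * (h (fst p) * W (snd p))" for U PU and p :: "real \<times> real"
  have cR: "compact ?R" by (intro compact_Times compact_Icc)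
  have ch: "bm ?R (\<lambda>p. h (fst p))" "bm ?R (\<lambda>p. h' (fst p))" "bm ?R (\<lambda>p. W (snd p))" "bm ?R (\<lambda>p. W' (snd p))" "bm ?R (\<lambda>p. snd p)"
    by (intro bm_continuous cR continuous_on_compose2[OF hs(2)] continuous_on_compose2[OF hs(3)]
        continuous_on_compose2[OF Ws(2)] continuous_on_compose2[OF Ws(3)] continuous_intros; simp)+
  have bv: "bm ?R v" using v by (auto simp: bm_def)
  have PPm: "PP w \<in> borel_measurable borel" if "w \<in> borel_measurable borel" for w
    unfolding PP_def by (rule P_op_measurable2[OF that])
  have sec: "(\<lambda>y. w (t, y)) \<in> borel_measurable borel" if "w \<in> borel_measurable borel" for w :: "real \<times> real \<Rightarrow> real" and t
    using that by (intro measurable_compose[of "\<lambda>y. (t, y)" borel borel w]) (auto intro!: borel_measurable_Pair)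
  have PPb: "\<bar>PP v p\<bar> \<le> 2 * B" if "p \<in> ?R" for p
    unfolding PP_def using that by (intro bm_P_op(2)[OF sec[OF v(1)] v(2)]) auto
  have bPP: "bm ?R (PP v)" using PPm[OF v(1)] PPb unfolding bm_def by blast
  have bmg: "bm ?R (g v (PP v))" unfolding g_def
    by (intro bm_add bm_diff bm_mult bm_abs bm_sgn bm_const bv bPP ch
        bm_compose2[OF f_cont ch(5) bv] bm_compose2[OF f_cont ch(5) bm_const] bm_compose2[OF fx_cont ch(5) bm_const])
  have gm: "g w (PP w) \<in> borel_measurable borel" if w[measurable]: "w \<in> borel_measurable borel" for w
  proof -
    have [measurable]: "PP w \<in> borel_measurable borel" by (rule PPm[OF w])
    have m: "(\<lambda>p::real\<times>real. h (fst p)) \<in> borel_measurable borel" "(\<lambda>p::real\<times>real. h' (fst p)) \<in> borel_measurable borel"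
      "(\<lambda>p::real\<times>real. W (snd p)) \<in> borel_measurable borel" "(\<lambda>p::real\<times>real. W' (snd p)) \<in> borel_measurable borel"
      by (rule ch[THEN bm_measurable])+
    have fk: "(\<lambda>p::real\<times>real. f (snd p) k) \<in> borel_measurable borel" "(\<lambda>p::real\<times>real. fx (snd p) k) \<in> borel_measurable borel"
      by (rule bm_measurable[OF bm_compose2[OF f_cont ch(5) bm_const]], rule bm_measurable[OF bm_compose2[OF fx_cont ch(5) bm_const]])
    have fw: "(\<lambda>p. f (snd p) (w p)) \<in> borel_measurable borel"
    proof -
      have "(\<lambda>p. (snd p, w p)) \<in> borel_measurable borel" by (intro borel_measurable_Pair bm_measurable[OF ch(5)] w)
      from borel_measurable_continuous_on[OF f_cont this] show ?thesis by simp
    qed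
    have sg: "(\<lambda>p. sgn (w p - k)) \<in> borel_measurable borel" by measurable
    show ?thesis unfolding g_def[abs_def]
      by (intro borel_measurable_add borel_measurable_diff borel_measurable_times m fk fw sg) measurable
  qed
  have eq1: "(LINT p:?R|lborel. (case p of (t, x) \<Rightarrow>
          \<bar>u t x - k\<bar> * deriv (\<lambda>s. h s * W x) t
        + sgn (u t x - k) * (f x (u t x) - f x k) * deriv (\<lambda>y. h t * W y) x
        - sgn (u t x - k) * deriv (\<lambda>y. f y k) x * (h t * W x)
        + sgn (u t x - k) * P_op (u t) x * (h t * W x))) = (LINT p:?R|lborel. g U (PP U) p)"
  proof (rule set_lebesgue_integral_cong)
    show "?R \<in> sets lborel" using cR by (simp add: borel_compact)
    show "\<forall>p. p \<in> ?R \<longrightarrow> (case p of (t, x) \<Rightarrow>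
          \<bar>u t x - k\<bar> * deriv (\<lambda>s. h s * W x) t
        + sgn (u t x - k) * (f x (u t x) - f x k) * deriv (\<lambda>y. h t * W y) x
        - sgn (u t x - k) * deriv (\<lambda>y. f y k) x * (h t * W x)
        + sgn (u t x - k) * P_op (u t) x * (h t * W x)) = g U (PP U) p"
    proof (intro allI impI)
      fix p assume p: "p \<in> ?R"
      obtain t x where tx: "p = (t, x)" by force
      have t: "t \<in> {0..T}" "x \<in> {0..1}" using p tx by auto
      have d1: "deriv (\<lambda>s. h s * W x) t = h' t * W x" using hs(1) by (intro DERIV_imp_deriv DERIV_cmult_right)
      have d2: "deriv (\<lambda>y. h t * W y) x = h t * W' x" using Ws(1) by (intro DERIV_imp_deriv DERIV_cmult)
      have d3: "deriv (\<lambda>y. f y k) x = fx x k" by (intro DERIV_imp_deriv f_dx)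
      have "P_op (u t) x = P_op (\<lambda>y. U (t, y)) x" using t Uu by (intro P_op_cong) auto
      then show "(case p of (t, x) \<Rightarrow>
          \<bar>u t x - k\<bar> * deriv (\<lambda>s. h s * W x) t
        + sgn (u t x - k) * (f x (u t x) - f x k) * deriv (\<lambda>y. h t * W y) x
        - sgn (u t x - k) * deriv (\<lambda>y. f y k) x * (h t * W x)
        + sgn (u t x - k) * P_op (u t) x * (h t * W x)) = g U (PP U) p"
        unfolding tx g_def PP_def by (simp add: d1 d2 d3 Uu[OF t])
    qed
  qed
  have eq2: "(LINT p:?R|lborel. g U (PP U) p) = (LINT p:?R|lborel. g v (PP v) p)"
  proof (rule set_lebesgue_integral_cong_AE)
    have "AE p in (lborel \<Otimes>\<^sub>M lborel :: (real \<times> real) measure). U p = v p"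
      unfolding lborel_prod by (rule Uv)
    from lborel_pair.AE_pair[OF this]
    have "AE t in lborel. AE y in lborel. U (t, y) = v (t, y)" .
    then have "AE t in lborel. \<forall>x. P_op (\<lambda>y. U (t, y)) x = P_op (\<lambda>y. v (t, y)) x"
      by eventually_elim (intro allI P_op_cong_AE sec U v(1); assumption)
    from AE_lborel_fst[OF this] Uv
    show "AE p\<in>?R in lborel. g U (PP U) p = g v (PP v) p"
      by eventually_elim (simp add: g_def PP_def)
  qed (use gm[OF U] gm[OF v(1)] cR in \<open>auto simp: borel_compact\<close>)
  have bsec: "bm {0..1} (\<lambda>y. G (t, y))" if GG: "bm ?R G" "t \<in> {0..T}" for G :: "real \<times> real \<Rightarrow> real" and t
  proof -
    have "G \<in> borel_measurable borel" using GG(1) by (simp add: bm_def)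
    moreover obtain D where "\<forall>p\<in>?R. \<bar>G p\<bar> \<le> D" using GG(1) unfolding bm_def by blast
    then have "\<forall>y\<in>{0..1}. \<bar>G (t, y)\<bar> \<le> D" using GG(2) by auto
    ultimately show ?thesis using sec[of G t] unfolding bm_def by blast
  qed
  have Cm: "bm {0..T} (\<lambda>t. I01 (\<lambda>y. G (t, y)))" if GG: "bm ?R G" for G :: "real \<times> real \<Rightarrow> real"
  proof -
    obtain D where D: "\<forall>p\<in>?R. \<bar>G p\<bar> \<le> D" using GG unfolding bm_def by blast
    have Gm: "G \<in> borel_measurable (borel \<Otimes>\<^sub>M borel)" using GG by (simp add: bm_def borel_prod)
    have [measurable]: "(\<lambda>(t, y). G (t, y)) \<in> borel_measurable (borel \<Otimes>\<^sub>M lborel)" using Gm by simp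
    have m: "(\<lambda>t. I01 (\<lambda>y. G (t, y))) \<in> borel_measurable borel"
      unfolding set_lebesgue_integral_def by measurable
    have "\<bar>I01 (\<lambda>y. G (t, y))\<bar> \<le> D" if t: "t \<in> {0..T}" for t
    proof (rule I01_bound)
      show "bm {0..1} (\<lambda>y. G (t, y))" by (rule bsec[OF GG t])
    qed (use D t in auto)
    then show ?thesis using m unfolding bm_def by blast
  qed
  have G1: "bm ?R (\<lambda>p. \<bar>v p - k\<bar> * W (snd p))"
    by (intro bm_mult bm_abs bm_diff bv bm_const ch)
  have G2: "bm ?R (\<lambda>p. sgn (v p - k) * (f (snd p) (v p) - f (snd p) k) * W' (snd p)
         - sgn (v p - k) * fx (snd p) k * W (snd p) + sgn (v p - k) * PP v p * W (snd p))"
    by (intro bm_add bm_diff bm_mult bm_abs bm_sgn bm_const bv bPP ch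
        bm_compose2[OF f_cont ch(5) bv] bm_compose2[OF f_cont ch(5) bm_const] bm_compose2[OF fx_cont ch(5) bm_const])
  show bA: "bm {0..T} A" using Cm[OF G1] by (simp add: A_def)
  show bC: "bm {0..T} C" using Cm[OF G2] by (simp add: C_def PP_def)
  have "(LINT p:?R|lborel. g v (PP v) p) = (LINT t:{0..T}|lborel. I01 (\<lambda>y. g v (PP v) (t, y)))"
  proof -
    have i: "set_integrable lborel ?R (g v (PP v))"
    proof (rule bm_integrable[OF bmg])
      show "emeasure lborel ?R < \<infinity>" by (rule emeasure_compact_finite[OF cR])
    qed (use cR in \<open>simp add: borel_compact\<close>)
    then have "integrable (lborel \<Otimes>\<^sub>M lborel) (\<lambda>p. indicator ?R p *\<^sub>R g v (PP v) p)"
      by (simp add: set_integrable_def lborel_prod)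
    from lborel_pair.integral_fst'[OF this]
    have "(LINT p:?R|lborel. g v (PP v) p) = (LINT t|lborel. (LINT y|lborel. indicator ?R (t, y) *\<^sub>R g v (PP v) (t, y)))"
      by (simp add: set_lebesgue_integral_def lborel_prod)
    also have "\<dots> = (LINT t:{0..T}|lborel. I01 (\<lambda>y. g v (PP v) (t, y)))"
      unfolding set_lebesgue_integral_def
      by (intro Bochner_Integration.integral_cong refl) (simp add: indicator_times mult.assoc)
    finally show ?thesis .
  qed
  also have "\<dots> = (LINT t:{0..T}|lborel. h' t * A t + h t * C t)"
  proof (rule set_lebesgue_integral_cong)
    show "\<forall>t. t \<in> {0..T} \<longrightarrow> I01 (\<lambda>y. g v (PP v) (t, y)) = h' t * A t + h t * C t"
    proof (intro allI impI)
      fix t assume t: "t \<in> {0..T}"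
      have "I01 (\<lambda>y. g v (PP v) (t, y)) = I01 (\<lambda>y. h' t * (\<bar>v (t, y) - k\<bar> * W y) + h t * (sgn (v (t, y) - k) * (f y (v (t, y)) - f y k) * W' y
         - sgn (v (t, y) - k) * fx y k * W y + sgn (v (t, y) - k) * P_op (\<lambda>y. v (t, y)) y * W y))"
        by (simp add: g_def PP_def algebra_simps)
      also have "\<dots> = h' t * A t + h t * C t" unfolding A_def C_def
        using bsec[OF G1 t] bsec[OF G2 t] by (subst I01_add) (auto intro!: bm_cmult simp: PP_def)
      finally show "I01 (\<lambda>y. g v (PP v) (t, y)) = h' t * A t + h t * C t" .
    qed
  qed simp
  finally have eq3: "(LINT p:?R|lborel. g v (PP v) p) = (LINT t:{0..T}|lborel. h' t * A t + h t * C t)" .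
  have m1: "I01 (\<lambda>x. \<bar>u s x - k\<bar> * (h s * W x)) = h s * I01 (\<lambda>x. \<bar>u s x - k\<bar> * W x)" for s
    by (simp add: mult.left_commute flip: set_integral_mult_right)
  show "(LINT t:{0..T}|lborel. h' t * A t + h t * C t)
     \<ge> h T * I01 (\<lambda>x. \<bar>u T x - k\<bar> * W x) - h 0 * I01 (\<lambda>x. \<bar>u 0 x - k\<bar> * W x)"
    using e unfolding entropy_ineq_def eq1 eq2 eq3 m1 by simp
qed

end

section \<open>Summation over time levels and time shifts\<close>

lemma hat_scale:
  assumes "d > 0"
  shows "hat p d (p + x * d) = (\<bar>x - 1\<bar> + \<bar>x + 1\<bar> - 2 * \<bar>x\<bar>) / 2"
    and "hat' p d (p + x * d) = (sgn (x - 1) + sgn (x + 1) - 2 * sgn x) / (2 * d)"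
proof -
  have e: "p + x * d - p = x * d" "x * d - d = (x - 1) * d" "x * d + d = (x + 1) * d"
    by (auto simp: algebra_simps)
  have "hat p d (p + x * d) = ((\<bar>x - 1\<bar> + \<bar>x + 1\<bar> - 2 * \<bar>x\<bar>) * d) / (2 * d)"
  proof -
    have n: "\<bar>a * d\<bar> = \<bar>a\<bar> * d" for a using assms by (simp only: abs_mult abs_of_pos)
    have "A * d + B * d - 2 * (C * d) = (A + B - 2 * C) * d" for A B C by (simp add: algebra_simps)
    then show ?thesis unfolding hat_def e n by (rule arg_cong[where f = "\<lambda>z. z / (2 * d)"])
  qed
  then show "hat p d (p + x * d) = (\<bar>x - 1\<bar> + \<bar>x + 1\<bar> - 2 * \<bar>x\<bar>) / 2" using assms by simp
  show "hat' p d (p + x * d) = (sgn (x - 1) + sgn (x + 1) - 2 * sgn x) / (2 * d)"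
    unfolding hat'_def e using assms by (simp add: sgn_mult)
qed

lemma hat_between:
  assumes d: "d > 0" and \<theta>: "0 < \<theta>" "\<theta> < 1"
  shows "hat (real n * d) d ((real m + \<theta>) * d) = (if n = m then 1 - \<theta> else if n = Suc m then \<theta> else 0)"
    and "hat' (real n * d) d ((real m + \<theta>) * d) = (if n = m then - 1 / d else if n = Suc m then 1 / d else 0)"
proof -
  define x where "x = real m + \<theta> - real n"
  have t: "(real m + \<theta>) * d = real n * d + x * d" by (simp add: x_def algebra_simps)
  consider "n = m" | "n = Suc m" | "n < m" | "n > Suc m" by linarith
  then have "(\<bar>x - 1\<bar> + \<bar>x + 1\<bar> - 2 * \<bar>x\<bar>) / 2 = (if n = m then 1 - \<theta> else if n = Suc m then \<theta> else 0) \<and>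
    (sgn (x - 1) + sgn (x + 1) - 2 * sgn x) / (2 * d) = (if n = m then - 1 / d else if n = Suc m then 1 / d else 0)"
  proof cases
    case 1
    then have "x = \<theta>" by (simp add: x_def)
    then show ?thesis using 1 \<theta> d by (simp add: field_simps)
  next
    case 2
    then have "x = \<theta> - 1" by (simp add: x_def)
    then show ?thesis using 2 \<theta> d by (simp add: field_simps)
  next
    case 3
    then have "real n + 1 \<le> real m" by linarith
    then have "x > 1" using \<theta> by (simp add: x_def)
    then show ?thesis using 3 d by simp
  next
    case 4
    then have "real n \<ge> real m + 2" by linarith
    then have "x < - 1" using \<theta> by (simp add: x_def)
    then show ?thesis using 4 d by simp
  qed
  then show "hat (real n * d) d ((real m + \<theta>) * d) = (if n = m then 1 - \<theta> else if n = Suc m then \<theta> else 0)"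
    "hat' (real n * d) d ((real m + \<theta>) * d) = (if n = m then - 1 / d else if n = Suc m then 1 / d else 0)"
    unfolding t hat_scale[OF d] by blast+
qed

lemma hat_grid:
  assumes d: "d > 0"
  shows "hat (real n * d) d (real m * d) = (if n = m then 1 else 0)"
proof -
  define x where "x = real m - real n"
  have t: "real m * d = real n * d + x * d" by (simp add: x_def algebra_simps)
  consider "n = m" | "n < m" | "n > m" by linarith
  then have "(\<bar>x - 1\<bar> + \<bar>x + 1\<bar> - 2 * \<bar>x\<bar>) / 2 = (if n = m then 1 else 0)"
  proof cases
    case 2
    then have "x \<ge> 1" unfolding x_def by linarith
    then show ?thesis using 2 by simp
  next
    case 3
    then have "x \<le> - 1" unfolding x_def by linarith
    then show ?thesis using 3 by simp
  qed (simp add: x_def)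
  then show ?thesis unfolding t hat_scale[OF d] .
qed

lemma sum_two:
  fixes g :: "nat \<Rightarrow> real"
  assumes "m \<le> M"
  shows "(\<Sum>n\<in>{0..Suc M}. (if n = m then g n else if n = Suc m then k n else 0)) = g m + k (Suc m)"
proof -
  have "(\<Sum>n\<in>{0..Suc M}. (if n = m then g n else if n = Suc m then k n else 0))
    = (\<Sum>n\<in>{0..Suc M}. (if n = m then g n else 0) + (if n = Suc m then k n else 0))"
    by (intro sum.cong) auto
  also have "\<dots> = g m + k (Suc m)" using assms by (simp add: sum.distrib)
  finally show ?thesis .
qed

text \<open>The entropy solution \<open>u\<close>, its extension \<open>U\<close> and its bounded representative \<open>v\<close>. The end
  times are special: the entropy inequality refers to \<open>u 0\<close> and \<open>u T\<close> themselves, which are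
  integrable.\<close>

locale entropy_mesh = kernel_mesh +
  fixes u :: "real \<Rightarrow> real \<Rightarrow> real" and U v :: "real \<times> real \<Rightarrow> real" and B :: real
  assumes ent: "\<And>k \<phi>. smooth2 \<phi> \<Longrightarrow> (\<And>t x. \<phi> t x \<ge> 0) \<Longrightarrow> (\<And>t x. \<phi> t (x + 1) = \<phi> t x) \<Longrightarrow> entropy_ineq T f u k \<phi>"
    and Um: "U \<in> borel_measurable borel" and vm: "v \<in> borel_measurable borel" and vB: "\<And>p. \<bar>v p\<bar> \<le> B"
    and Uv: "AE p in lborel. U p = v p" and Uu: "\<And>t x. t \<in> {0..T} \<Longrightarrow> x \<in> {0..1} \<Longrightarrow> U (t, x) = u t x"
    and uT: "set_integrable lborel {0..1} (u T)" and u0: "set_integrable lborel {0..1} (u 0)"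
begin

abbreviation sec :: "real \<Rightarrow> real \<Rightarrow> real" where "sec t \<equiv> (\<lambda>y. v (t, y))"

lemma sec_measurable: "sec t \<in> borel_measurable borel"
  using vm by (intro measurable_compose[of "\<lambda>y. (t, y)" borel borel v]) (auto intro!: borel_measurable_Pair)

lemma B_nonneg: "B \<ge> 0" using vB[of "(0, 0)"] by linarith

lemma Phi_sum: 
  assumes "set_integrable lborel {0..1} w"
  shows "Phi a w = (\<Sum>j\<in>{1..N}. I01 (\<lambda>y. \<bar>w y - a j\<bar> * W j y))"
  unfolding Phi_def phi_def by (intro set_integral_sum' phi_term_integrable assms)

lemma bm_sec: "bm {0..1} (sec t)" using sec_measurable vB unfolding bm_def by blast

lemma R_sum: "R a (sec t) = (\<Sum>j\<in>{1..N}. I01 (\<lambda>y. sgn (v (t, y) - a j) * (f y (v (t, y)) - f y (a j)) * w' j y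
         - sgn (v (t, y) - a j) * fx y (a j) * W j y + sgn (v (t, y) - a j) * P_op (sec t) y * W j y))"
  unfolding R_def r_def q_def
  by (intro I01_sum bm_add bm_diff bm_mult bm_sgn bm_const bm_sec bm_W bm_w'
      bm_P_op(1)[OF sec_measurable vB] bm_f bm_fx)

lemma entropy_vec:
  assumes hs: "\<And>k. Ck1 k h'" "\<And>t. (h' has_real_derivative h'' t) (at t)" "\<And>t. h' t \<ge> 0"
  shows "(LINT t:{0..T}|lborel. h'' t * Phi a (sec t) + h' t * R a (sec t)) \<ge> h' T * Phi a (u T) - h' 0 * Phi a (u 0)"
    and "bm {0..T} (\<lambda>t. Phi a (sec t))" and "bm {0..T} (\<lambda>t. R a (sec t))"
proof -
  have hc: "continuous_on UNIV h'" by (rule Ck1_cont[OF hs(1)])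
  have hc': "continuous_on UNIV h''"
  proof -
    obtain g where "\<forall>t. (h' has_real_derivative g t) (at t)" "Ck1 0 g" using hs(1)[of 1] by auto
    moreover from this have "g = h''" using hs(2) DERIV_unique by blast
    ultimately show ?thesis by simp
  qed
  define A where "A j t = I01 (\<lambda>y. \<bar>v (t, y) - a j\<bar> * W j y)" for j t
  define C where "C j t = I01 (\<lambda>y. sgn (v (t, y) - a j) * (f y (v (t, y)) - f y (a j)) * w' j y
         - sgn (v (t, y) - a j) * fx y (a j) * W j y + sgn (v (t, y) - a j) * P_op (\<lambda>y. v (t, y)) y * W j y)" for j t
  have main: "(LINT t:{0..T}|lborel. h'' t * A j t + h' t * C j t)
     \<ge> h' T * I01 (\<lambda>x. \<bar>u T x - a j\<bar> * W j x) - h' 0 * I01 (\<lambda>x. \<bar>u 0 x - a j\<bar> * W j x)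
     \<and> bm {0..T} (A j) \<and> bm {0..T} (C j)" if j: "j \<in> {1..N}" for j
  proof -
    have e: "entropy_ineq T f u (a j) (\<lambda>t x. h' t * W j x)"
    proof (rule ent)
      show "smooth2 (\<lambda>t x. h' t * W j x)" unfolding smooth2_def using Ck_product hs(1) W_smooth by blast
      show "h' t * W j x \<ge> 0" for t x using hs(3)[of t] W_pos[of j x] j by simp
      show "h' t * W j (x + 1) = h' t * W j x" for t x by (simp add: W_per)
    qed
    have Wc: "continuous_on UNIV (W j)" by (rule Ck1_cont[OF W_smooth])
    have w'c: "continuous_on UNIV (w' j)" unfolding w'_def[abs_def]
      by (intro continuous_intros continuous_on_compose2[OF om_cont]) auto
    note x = entropy_time_form[OF e hs(2) hc hc' W_deriv Wc w'c Um vm vB Uv Uu]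
    show ?thesis unfolding A_def[abs_def] C_def[abs_def] using x by blast
  qed
  have A: "Phi a (sec t) = (\<Sum>j\<in>{1..N}. A j t)" for t
    unfolding A_def by (rule Phi_sum[OF I01_integrable[OF bm_sec]])
  have C: "R a (sec t) = (\<Sum>j\<in>{1..N}. C j t)" for t unfolding C_def by (rule R_sum)
  show "bm {0..T} (\<lambda>t. Phi a (sec t))" "bm {0..T} (\<lambda>t. R a (sec t))"
    unfolding A C by (intro bm_sum; use main in blast)+
  have "h' T * Phi a (u T) - h' 0 * Phi a (u 0) = (\<Sum>j\<in>{1..N}. h' T * I01 (\<lambda>x. \<bar>u T x - a j\<bar> * W j x) - h' 0 * I01 (\<lambda>x. \<bar>u 0 x - a j\<bar> * W j x))"
    unfolding Phi_sum[OF uT] Phi_sum[OF u0] by (simp only: sum_subtractf sum_distrib_left)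
  also have "\<dots> \<le> (\<Sum>j\<in>{1..N}. LINT t:{0..T}|lborel. h'' t * A j t + h' t * C j t)"
    by (intro sum_mono) (use main in blast)
  also have "\<dots> = (LINT t:{0..T}|lborel. \<Sum>j\<in>{1..N}. h'' t * A j t + h' t * C j t)"
  proof (rule set_integral_sum'[symmetric])
    fix j assume "j \<in> {1..N}"
    then show "set_integrable lborel {0..T} (\<lambda>t. h'' t * A j t + h' t * C j t)"
      using main[of j] by (intro bm_integrable_Icc bm_add bm_mult bm_continuous[OF hc] bm_continuous[OF hc']) auto
  qed
  also have "\<dots> = (LINT t:{0..T}|lborel. h'' t * Phi a (sec t) + h' t * R a (sec t))"
    unfolding A C by (simp add: sum.distrib sum_distrib_left)
  finally show "(LINT t:{0..T}|lborel. h'' t * Phi a (sec t) + h' t * R a (sec t)) \<ge> h' T * Phi a (u T) - h' 0 * Phi a (u 0)" .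
qed

lemma bm_Phi_R: "bm {0..T} (\<lambda>t. Phi a (sec t))" "bm {0..T} (\<lambda>t. R a (sec t))"
  using entropy_vec(2,3)[of "\<lambda>_. 0" "\<lambda>_. 0" a] by (auto simp: Ck1_const)

text \<open>The time integrand that results from all entropy inequalities with constants \<open>vs n j\<close>,
  when the test function in time is \<open>exp (- c t)\<close> times the hat at \<open>t\<^sup>n\<close>.\<close>

definition hat_sum :: "real \<Rightarrow> (nat \<Rightarrow> nat \<Rightarrow> real) \<Rightarrow> real \<Rightarrow> real" where
  "hat_sum c vs t = (\<Sum>n\<in>{0..Suc M}. exp (- c * t) * ((hat' (real n * \<tau>) \<tau> t - c * hat (real n * \<tau>) \<tau> t) * Phi (vs n) (sec t)
      + hat (real n * \<tau>) \<tau> t * R (vs n) (sec t)))"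

lemma T_grid: "T = real (Suc M) * \<tau>" by (simp add: dt_def add.commute)

lemma bm_hat: "bm {0..T} (hat p d)" "bm {0..T} (hat' p d)"
proof -
  have "continuous_on UNIV (hat p d)" unfolding hat_def[abs_def] by (cases "d = 0") (auto intro!: continuous_intros)
  then show "bm {0..T} (hat p d)" by (rule bm_continuous) simp
  show "bm {0..T} (hat' p d)" unfolding hat'_def[abs_def]
    by (intro bm_divide bm_diff bm_add bm_sgn bm_cmult bm_const bm_continuous continuous_intros compact_Icc)
qed

lemma bm_hat_sum: "bm {0..T} (hat_sum c vs)"
  unfolding hat_sum_def[abs_def]
  by (intro bm_sum bm_mult bm_add bm_diff bm_const bm_hat bm_Phi_R bm_continuous continuous_intros compact_Icc)

lemma hat_sum_integrable: "set_integrable lborel {0..T} (hat_sum c vs)"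
  by (rule bm_integrable_Icc[OF bm_hat_sum])

lemma hat_sum_integral:
  assumes c: "c \<ge> 0"
  shows "(LINT t:{0..T}|lborel. hat_sum c vs t) \<ge> exp (- c * T) * Phi (vs (Suc M)) (u T) - Phi (vs 0) (u 0)"
proof -
  let ?g = "\<lambda>n t. exp (- c * t) * ((hat' (real n * \<tau>) \<tau> t - c * hat (real n * \<tau>) \<tau> t) * Phi (vs n) (sec t)
      + hat (real n * \<tau>) \<tau> t * R (vs n) (sec t))"
  have n: "(LINT t:{0..T}|lborel. ?g n t) \<ge> exp (- c * T) * hat (real n * \<tau>) \<tau> T * Phi (vs n) (u T) - hat (real n * \<tau>) \<tau> 0 * Phi (vs n) (u 0)" for n
    by (rule hat_inequality[OF less_imp_le[OF T_pos] tau_pos c bm_Phi_R]) (rule entropy_vec(1))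
  have i: "set_integrable lborel {0..T} (?g n)" for n
    by (intro bm_integrable_Icc bm_mult bm_add bm_diff bm_const bm_hat bm_Phi_R bm_continuous continuous_intros compact_Icc)
  have "exp (- c * T) * Phi (vs (Suc M)) (u T) - Phi (vs 0) (u 0)
     = (\<Sum>n\<in>{0..Suc M}. exp (- c * T) * hat (real n * \<tau>) \<tau> T * Phi (vs n) (u T) - hat (real n * \<tau>) \<tau> 0 * Phi (vs n) (u 0))"
  proof -
    have a: "hat (real n * \<tau>) \<tau> T = (if n = Suc M then 1 else 0)" for n
      using hat_grid[OF tau_pos, of n "Suc M"] by (simp only: T_grid[symmetric])
    have b: "hat (real n * \<tau>) \<tau> 0 = (if n = 0 then 1 else 0)" for n
      using hat_grid[OF tau_pos, of n 0] by simp
    have "(\<Sum>n\<in>{0..Suc M}. exp (- c * T) * hat (real n * \<tau>) \<tau> T * Phi (vs n) (u T) - hat (real n * \<tau>) \<tau> 0 * Phi (vs n) (u 0))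
      = (\<Sum>n\<in>{0..Suc M}. (if n = Suc M then exp (- c * T) * Phi (vs n) (u T) else 0) - (if n = 0 then Phi (vs n) (u 0) else 0))"
      unfolding a b by (intro sum.cong) auto
    also have "\<dots> = exp (- c * T) * Phi (vs (Suc M)) (u T) - Phi (vs 0) (u 0)"
      by (simp only: sum_subtractf sum.delta finite_atLeastAtMost) simp
    finally show ?thesis by simp
  qed
  also have "\<dots> \<le> (\<Sum>n\<in>{0..Suc M}. LINT t:{0..T}|lborel. ?g n t)" by (intro sum_mono n)
  also have "\<dots> = (LINT t:{0..T}|lborel. hat_sum c vs t)" unfolding hat_sum_def by (rule set_integral_sum'[symmetric, OF i])
  finally show ?thesis .
qed

text \<open>Between two time levels only two hats are present, with values \<open>1 - \<theta>\<close>, \<open>\<theta>\<close> and slopes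
  \<open>\<plusminus> 1 / \<Delta>t\<close>.\<close>

lemma hat_sum_between:
  assumes m: "m \<le> M" and \<theta>: "0 < \<theta>" "\<theta> < 1" and t: "t = (real m + \<theta>) * \<tau>"
  shows "hat_sum c vs t = exp (- c * t) * ((Phi (vs (Suc m)) (sec t) - Phi (vs m) (sec t)) / \<tau> + (1 - \<theta>) * R (vs m) (sec t) + \<theta> * R (vs (Suc m)) (sec t)
     - c * ((1 - \<theta>) * Phi (vs m) (sec t) + \<theta> * Phi (vs (Suc m)) (sec t)))"
proof -
  let ?e = "exp (- c * t)"
  have "hat_sum c vs t = (\<Sum>n\<in>{0..Suc M}. (if n = m then ?e * ((- 1 / \<tau> - c * (1 - \<theta>)) * Phi (vs n) (sec t) + (1 - \<theta>) * R (vs n) (sec t))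
     else if n = Suc m then ?e * ((1 / \<tau> - c * \<theta>) * Phi (vs n) (sec t) + \<theta> * R (vs n) (sec t)) else 0))"
    unfolding hat_sum_def
  proof (rule sum.cong[OF refl])
    fix n
    have "hat (real n * \<tau>) \<tau> t = (if n = m then 1 - \<theta> else if n = Suc m then \<theta> else 0)"
      "hat' (real n * \<tau>) \<tau> t = (if n = m then - 1 / \<tau> else if n = Suc m then 1 / \<tau> else 0)"
      unfolding t by (rule hat_between[OF tau_pos \<theta>])+
    then show "?e * ((hat' (real n * \<tau>) \<tau> t - c * hat (real n * \<tau>) \<tau> t) * Phi (vs n) (sec t) + hat (real n * \<tau>) \<tau> t * R (vs n) (sec t)) =
      (if n = m then ?e * ((- 1 / \<tau> - c * (1 - \<theta>)) * Phi (vs n) (sec t) + (1 - \<theta>) * R (vs n) (sec t))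
       else if n = Suc m then ?e * ((1 / \<tau> - c * \<theta>) * Phi (vs n) (sec t) + \<theta> * R (vs n) (sec t)) else 0)"
      by simp
  qed
  also have "\<dots> = ?e * ((- 1 / \<tau> - c * (1 - \<theta>)) * Phi (vs m) (sec t) + (1 - \<theta>) * R (vs m) (sec t))
     + ?e * ((1 / \<tau> - c * \<theta>) * Phi (vs (Suc m)) (sec t) + \<theta> * R (vs (Suc m)) (sec t))"
    by (rule sum_two[OF m])
  also have "\<dots> = ?e * ((Phi (vs (Suc m)) (sec t) - Phi (vs m) (sec t)) / \<tau> + (1 - \<theta>) * R (vs m) (sec t) + \<theta> * R (vs (Suc m)) (sec t)
     - c * ((1 - \<theta>) * Phi (vs m) (sec t) + \<theta> * Phi (vs (Suc m)) (sec t)))"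
    by (simp add: algebra_simps diff_divide_distrib)
  finally show ?thesis .
qed

text \<open>Summed over the shifts \<open>i < K\<close>, the sign defects telescope to two values of \<open>Z\<close>, whatever
  the number of shifts, whereas the left-hand side is counted \<open>K\<close> times. The scheme is run
  beyond the final time by at most \<open>K\<close> steps, so the bounds on \<open>vs n\<close> are required for
  \<open>n \<le> M + K\<close>.\<close>

lemma kuznetsov_estimate:
  fixes vs :: "nat \<Rightarrow> nat \<Rightarrow> real"
  assumes K: "K \<ge> 1"
    and L2: "\<And>x y w. \<bar>w\<bar> \<le> B \<Longrightarrow> \<bar>fx x w - fx y w\<bar> \<le> L2 * \<bar>x - y\<bar>" "L2 \<ge> 0"
    and vs_step: "\<And>n j. j \<in> {1..N} \<Longrightarrow> vs (Suc n) j = step (vs n) j"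
    and vs_B: "\<And>n j. n \<le> M + K \<Longrightarrow> j \<in> {1..N} \<Longrightarrow> \<bar>vs n j\<bar> \<le> B"
    and vs_V: "\<And>n. n \<le> M + K \<Longrightarrow> TV (vs n) \<le> V"
    and vs_D: "\<And>n. n \<le> M + K \<Longrightarrow> h * (\<Sum>j\<in>{1..N}. \<bar>vs (Suc n) j - vs n j\<bar>) \<le> D * \<tau>" "D \<ge> 0"
  defines "CG \<equiv> growth_const L G" and "C2 \<equiv> error_const L G cf B L2 V D"
  shows "exp (- CG * T) * Phi (vs (Suc M)) (u T) \<le> Phi (vs 0) (u 0) + 2 * G * D * (real K * \<tau>)
      + T * (2 * (2 * B + L * (1 + B)) / real K + C2 * \<epsilon>)"
proof -
  define Zb where "Zb = 2 * B + L * (1 + B)"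
  have Zb0: "Zb \<ge> 0" using B_nonneg L1 by (simp add: Zb_def)
  have V0: "V \<ge> 0" using vs_V[of 0] TV_nonneg[of "vs 0"] by linarith
  have CG0: "CG \<ge> 0" using L1 G1 by (simp add: CG_def growth_const_def)
  have C20: "C2 \<ge> 0" unfolding C2_def error_const_def using L1 G1 V0 B_nonneg L2(2) vs_D(2) cf_pos
    by (intro add_nonneg_nonneg mult_nonneg_nonneg) auto
  \<comment> \<open>a bound on the integrand summed over the shifts: one boundary pair of the telescope, and \<open>K\<close> consistency errors\<close>
  define Q where "Q = 2 * Zb + real K * (C2 * \<epsilon>)"
  have Q0: "Q \<ge> 0" using Zb0 C20 eps_pos by (simp add: Q_def)
  let ?vs = "\<lambda>i n. vs (n + i)"
  have pt: "(\<Sum>i<K. hat_sum CG (?vs i) t) \<le> Q" if t: "t \<in> {0..T}" "t \<notin> (\<lambda>n. real n * \<tau>) ` {0..Suc M}" for t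
  proof -
    define m where "m = nat \<lfloor>t / \<tau>\<rfloor>"
    define \<theta> where "\<theta> = t / \<tau> - real m"
    have t0: "t / \<tau> \<ge> 0" using t tau_pos by simp
    have fl: "real m \<le> t / \<tau>" "t / \<tau> < real m + 1" using t0 unfolding m_def by linarith+
    have te: "t = (real m + \<theta>) * \<tau>" using tau_pos by (simp add: \<theta>_def)
    have "real m * \<tau> \<le> (t / \<tau>) * \<tau>" using fl tau_pos by (intro mult_right_mono) auto
    then have "real m * \<tau> \<le> T" using t tau_pos by simp
    then have "real m * \<tau> \<le> real (Suc M) * \<tau>" using T_grid by linarith
    then have mS: "m \<le> Suc M" using tau_pos by simp
    then have tm: "t \<noteq> real m * \<tau>" using t(2) by auto
    have "\<theta> \<noteq> 0"
    proof
      assume "\<theta> = 0"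
      with te have "t = (real m + 0) * \<tau>" by (simp only:)
      with tm show False by simp
    qed
    moreover have "0 \<le> \<theta>" "\<theta> < 1" using fl unfolding \<theta>_def by linarith+
    ultimately have \<theta>: "0 < \<theta>" "\<theta> < 1" by linarith+
    have "(real m + \<theta>) * \<tau> \<le> real (Suc M) * \<tau>" using t te T_grid by (metis atLeastAtMost_iff)
    then have "real m + \<theta> \<le> real (Suc M)" using tau_pos by simp
    then have mM: "m \<le> M" using \<theta> by linarith
    let ?e = "exp (- CG * t)"
    let ?b = "\<lambda>i. (Phi (vs (Suc m + i)) (sec t) - Phi (vs (m + i)) (sec t)) / \<tau> + (1 - \<theta>) * R (vs (m + i)) (sec t) + \<theta> * R (vs (Suc m + i)) (sec t)
     - CG * ((1 - \<theta>) * Phi (vs (m + i)) (sec t) + \<theta> * Phi (vs (Suc m + i)) (sec t))"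
    have e: "0 \<le> ?e" "?e \<le> 1" using CG0 t by (auto simp: mult_nonpos_nonneg)
    have one: "?b i
     \<le> (1 - \<theta>) * (Z (vs (Suc m + i)) (sec t) - Z (vs (m + i)) (sec t)) + C2 * \<epsilon>" if i: "i < K" for i
    proof -
      have le: "m + i \<le> M + K" using mM i by simp
      have "(Phi (vs (Suc m + i)) (sec t) - Phi (vs (m + i)) (sec t)) / \<tau> + (1 - \<theta>) * R (vs (m + i)) (sec t) + \<theta> * R (vs (Suc m + i)) (sec t)
        \<le> (1 - \<theta>) * (Z (vs (Suc m + i)) (sec t) - Z (vs (m + i)) (sec t))
         + CG * ((1 - \<theta>) * Phi (vs (m + i)) (sec t) + \<theta> * Phi (vs (Suc m + i)) (sec t)) + C2 * \<epsilon>"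
        unfolding CG_def C2_def
        by (rule integrated_step[OF less_imp_le[OF \<theta>(1)] less_imp_le[OF \<theta>(2)] sec_measurable vB L2])
           (use vs_B[OF le] vs_step vs_V[OF le] vs_D(1)[OF le] vs_D(2) in auto)
      then show ?thesis by linarith
    qed
    have "(\<Sum>i<K. hat_sum CG (?vs i) t) = ?e * (\<Sum>i<K. ?b i)"
      unfolding sum_distrib_left by (intro sum.cong refl hat_sum_between[OF mM \<theta> te])
    also have "\<dots> \<le> ?e * (\<Sum>i<K. (1 - \<theta>) * (Z (vs (Suc m + i)) (sec t) - Z (vs (m + i)) (sec t)) + C2 * \<epsilon>)"
      using one by (intro mult_left_mono e sum_mono) auto
    also have "(\<Sum>i<K. (1 - \<theta>) * (Z (vs (Suc m + i)) (sec t) - Z (vs (m + i)) (sec t)) + C2 * \<epsilon>)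
       = (1 - \<theta>) * (Z (vs (m + K)) (sec t) - Z (vs m) (sec t)) + real K * (C2 * \<epsilon>)"
      using sum_lessThan_telescope[of "\<lambda>i. Z (vs (m + i)) (sec t)" K]
      by (simp add: sum.distrib sum_distrib_left[symmetric])
    also have "?e * \<dots> \<le> ?e * Q"
    proof (intro mult_left_mono e)
      have "Z (vs (m + K)) (sec t) - Z (vs m) (sec t) \<le> 2 * Zb"
        using Z_bound[OF sec_measurable vB, of "vs (m + K)" t, folded Zb_def] Z_bound[OF sec_measurable vB, of "vs m" t, folded Zb_def]
        by linarith
      then have "(1 - \<theta>) * (Z (vs (m + K)) (sec t) - Z (vs m) (sec t)) \<le> (1 - \<theta>) * (2 * Zb)" using \<theta> by (intro mult_left_mono) auto
      also have "\<dots> \<le> 1 * (2 * Zb)" using \<theta> Zb0 by (intro mult_right_mono) auto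
      finally show "(1 - \<theta>) * (Z (vs (m + K)) (sec t) - Z (vs m) (sec t)) + real K * (C2 * \<epsilon>) \<le> Q" by (simp add: Q_def)
    qed
    also have "?e * Q \<le> 1 * Q" using e Q0 by (intro mult_right_mono) auto
    finally show ?thesis by simp
  qed
  have "(\<Sum>i<K. LINT t:{0..T}|lborel. hat_sum CG (?vs i) t) = (LINT t:{0..T}|lborel. \<Sum>i<K. hat_sum CG (?vs i) t)"
    by (rule set_integral_sum'[symmetric, OF hat_sum_integrable])
  also have "\<dots> \<le> (LINT t:{0..T}|lborel. Q)"
  proof (rule set_integral_mono_AE)
    show "set_integrable lborel {0..T} (\<lambda>t. \<Sum>i<K. hat_sum CG (?vs i) t)" by (intro set_integrable_sum' hat_sum_integrable)
    show "set_integrable lborel {0..T} (\<lambda>t. Q)"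
      by (rule bm_integrable_Icc[OF bm_const])
    have "(\<lambda>n. real n * \<tau>) ` {0..Suc M} \<in> null_sets lborel" by (intro finite_imp_null_set_lborel) auto
    from AE_not_in[OF this] show "AE t\<in>{0..T} in lborel. (\<Sum>i<K. hat_sum CG (?vs i) t) \<le> Q"
      by eventually_elim (use pt in blast)
  qed
  also have "\<dots> = T * Q" using T_pos by (simp add: set_lebesgue_integral_def)
  finally have up: "(\<Sum>i<K. LINT t:{0..T}|lborel. hat_sum CG (?vs i) t) \<le> T * Q" .
  have shift: "h * (\<Sum>j\<in>{1..N}. \<bar>vs (n + i) j - vs n j\<bar>) \<le> real i * (D * \<tau>)" if "n + i \<le> Suc (M + K)" for n i
    using that
  proof (induction i)
    case (Suc i)
    have "h * (\<Sum>j\<in>{1..N}. \<bar>vs (n + Suc i) j - vs n j\<bar>) \<le> h * (\<Sum>j\<in>{1..N}. \<bar>vs (Suc (n + i)) j - vs (n + i) j\<bar> + \<bar>vs (n + i) j - vs n j\<bar>)"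
      using h_pos by (intro mult_left_mono sum_mono) auto
    also have "\<dots> = h * (\<Sum>j\<in>{1..N}. \<bar>vs (Suc (n + i)) j - vs (n + i) j\<bar>) + h * (\<Sum>j\<in>{1..N}. \<bar>vs (n + i) j - vs n j\<bar>)"
      by (simp only: sum.distrib distrib_left)
    also have "\<dots> \<le> D * \<tau> + real i * (D * \<tau>)" using Suc vs_D(1)[of "n + i"] by (intro add_mono) auto
    finally show ?case by (simp add: algebra_simps)
  qed simp
  have Dt: "D * \<tau> \<ge> 0" using vs_D(2) tau_pos by simp
  have low: "exp (- CG * T) * Phi (vs (Suc M)) (u T) - Phi (vs 0) (u 0) - 2 * G * D * (real K * \<tau>) \<le> (LINT t:{0..T}|lborel. hat_sum CG (?vs i) t)"
    if i: "i < K" for i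
  proof -
    have iK: "real i * (D * \<tau>) \<le> real K * (D * \<tau>)" using i Dt by (intro mult_right_mono) auto
    have a: "Phi (vs (Suc M)) (u T) \<le> Phi (vs (Suc M + i)) (u T) + G * (real K * (D * \<tau>))"
    proof -
      have "Phi (vs (Suc M)) (u T) \<le> Phi (vs (Suc M + i)) (u T) + G * (h * (\<Sum>j\<in>{1..N}. \<bar>vs (Suc M) j - vs (Suc M + i) j\<bar>))"
        by (rule Phi_lipschitz[OF uT])
      also have "h * (\<Sum>j\<in>{1..N}. \<bar>vs (Suc M) j - vs (Suc M + i) j\<bar>) \<le> real K * (D * \<tau>)"
        using shift[of "Suc M" i] i iK by (simp add: abs_minus_commute)
      finally show ?thesis using G1 by (simp add: mult_left_mono)
    qed
    have b: "Phi (vs i) (u 0) \<le> Phi (vs 0) (u 0) + G * (real K * (D * \<tau>))"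
    proof -
      have "Phi (vs i) (u 0) \<le> Phi (vs 0) (u 0) + G * (h * (\<Sum>j\<in>{1..N}. \<bar>vs i j - vs 0 j\<bar>))"
        by (rule Phi_lipschitz[OF u0])
      also have "h * (\<Sum>j\<in>{1..N}. \<bar>vs i j - vs 0 j\<bar>) \<le> real K * (D * \<tau>)"
        using shift[of 0 i] i iK by simp
      finally show ?thesis using G1 by (simp add: mult_left_mono)
    qed
    have e: "0 \<le> exp (- CG * T)" "exp (- CG * T) \<le> 1" using CG0 T_pos by (auto simp: mult_nonpos_nonneg)
    have KD: "G * (real K * (D * \<tau>)) \<ge> 0" using G1 Dt by simp
    have "exp (- CG * T) * Phi (vs (Suc M)) (u T) \<le> exp (- CG * T) * (Phi (vs (Suc M + i)) (u T) + G * (real K * (D * \<tau>)))"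
      using a e by (intro mult_left_mono)
    also have "\<dots> \<le> exp (- CG * T) * Phi (vs (Suc M + i)) (u T) + G * (real K * (D * \<tau>))"
      using mult_right_mono[OF e(2) KD] by (simp add: distrib_left)
    finally have "exp (- CG * T) * Phi (vs (Suc M)) (u T) - Phi (vs 0) (u 0) - 2 * (G * (real K * (D * \<tau>)))
      \<le> exp (- CG * T) * Phi (vs (Suc M + i)) (u T) - Phi (vs i) (u 0)" using b by linarith
    also have "\<dots> \<le> (LINT t:{0..T}|lborel. hat_sum CG (?vs i) t)"
      using hat_sum_integral[OF CG0, of "?vs i"] by simp
    finally show ?thesis by (simp add: mult_ac)
  qed
  have "real K * (exp (- CG * T) * Phi (vs (Suc M)) (u T) - Phi (vs 0) (u 0) - 2 * G * D * (real K * \<tau>))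
     = (\<Sum>i<K. exp (- CG * T) * Phi (vs (Suc M)) (u T) - Phi (vs 0) (u 0) - 2 * G * D * (real K * \<tau>))" by simp
  also have "\<dots> \<le> (\<Sum>i<K. LINT t:{0..T}|lborel. hat_sum CG (?vs i) t)" by (intro sum_mono low) auto
  also have "\<dots> \<le> T * Q" by (rule up)
  also have "T * Q = real K * (T * (2 * Zb / real K + C2 * \<epsilon>))" using K by (simp add: Q_def field_simps)
  finally have "exp (- CG * T) * Phi (vs (Suc M)) (u T) - Phi (vs 0) (u 0) - 2 * G * D * (real K * \<tau>) \<le> T * (2 * Zb / real K + C2 * \<epsilon>)"
    using K by simp
  then show ?thesis unfolding Zb_def by linarith
qed

end

section \<open>Initial data and uniform bounds\<close>

text \<open>The variation on \<open>[0, x]\<close> grows at least by \<open>\<bar>h y - h x\<bar>\<close> from \<open>x\<close> to \<open>y\<close>: append the two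
  points to any partition. So both it and its difference with \<open>h\<close> are monotone. Outside the unit
  interval the functions are continued by constants, which makes them bounded and Borel on the
  whole line.\<close>

lemma jordan_decomposition:
  assumes "bounded_variation 0 1 h"
  shows "\<exists>g1 g2 :: real \<Rightarrow> real. \<exists>C. mono g1 \<and> mono g2 \<and> (\<forall>x. \<bar>g1 x\<bar> \<le> C) \<and> (\<forall>x. \<bar>g2 x\<bar> \<le> C) \<and> (\<forall>x\<in>{0..1}. h x = g1 x - g2 x)"
proof -
  obtain Bv where Bv: "\<And>(p :: nat \<Rightarrow> real) n. (\<forall>i\<le>n. p i \<in> {0..1}) \<and> (\<forall>i<n. p i \<le> p (Suc i)) \<Longrightarrow>
       (\<Sum>i<n. \<bar>h (p (Suc i)) - h (p i)\<bar>) \<le> Bv"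
    using assms unfolding bounded_variation_def by blast
  define A where "A x = {(\<Sum>i<n. \<bar>h (p (Suc i)) - h (p i)\<bar>) | (p :: nat \<Rightarrow> real) n. (\<forall>i\<le>n. p i \<in> {0..x}) \<and> (\<forall>i<n. p i \<le> p (Suc i))}" for x
  define V where "V x = Sup (A x)" for x
  have ub: "s \<le> Bv" if sA: "s \<in> A x" "x \<le> 1" for s x
  proof -
    obtain p n where p: "s = (\<Sum>i<n. \<bar>h (p (Suc i)) - h (p i)\<bar>)" "\<forall>i\<le>n. p i \<in> {0..x}" "\<forall>i<n. p i \<le> p (Suc i)"
      using sA(1) unfolding A_def by blast
    have "\<forall>i\<le>n. p i \<in> {0..1}" using p(2) sA(2) by fastforce
    then show ?thesis using Bv[of n p] p by blast
  qed
  have bdd: "bdd_above (A x)" if "x \<le> 1" for x using ub[OF _ that] by (auto simp: bdd_above_def)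
  have z: "0 \<in> A x" if "0 \<le> x" for x
    unfolding A_def using that by (auto intro!: exI[of _ "\<lambda>_::nat. 0::real"] exI[of _ "0::nat"])
  have grow: "V x + \<bar>h y - h x\<bar> \<le> V y" if xy: "0 \<le> x" "x \<le> y" "y \<le> 1" for x y
  proof -
    have "V x \<le> V y - \<bar>h y - h x\<bar>" unfolding V_def[of x]
    proof (rule cSup_least)
      show "A x \<noteq> {}" using z[OF xy(1)] by auto
      fix s assume "s \<in> A x"
      then obtain p n where p: "s = (\<Sum>i<n. \<bar>h (p (Suc i)) - h (p i)\<bar>)" "\<forall>i\<le>n. p i \<in> {0..x}" "\<forall>i<n. p i \<le> p (Suc i)"
        unfolding A_def by blast
          \<comment> \<open>the partition, continued by the points \<open>x\<close> and \<open>y\<close>\<close>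
  define p' where "p' i = (if i \<le> n then p i else if i = Suc n then x else y)" for i
      have eq: "(\<Sum>i<n. \<bar>h (p' (Suc i)) - h (p' i)\<bar>) = s" unfolding p(1) by (intro sum.cong) (auto simp: p'_def)
      have "(\<Sum>i<Suc (Suc n). \<bar>h (p' (Suc i)) - h (p' i)\<bar>) = s + \<bar>h x - h (p n)\<bar> + \<bar>h y - h x\<bar>"
        unfolding sum.lessThan_Suc eq by (simp add: p'_def)
      moreover have "(\<Sum>i<Suc (Suc n). \<bar>h (p' (Suc i)) - h (p' i)\<bar>) \<in> A y"
      proof -
        have "\<forall>i\<le>Suc (Suc n). p' i \<in> {0..y}" using p(2) xy by (fastforce simp: p'_def)
        moreover have "\<forall>i<Suc (Suc n). p' i \<le> p' (Suc i)"
        proof (intro allI impI)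
          fix i assume i: "i < Suc (Suc n)"
          consider "i < n" | "i = n" | "i = Suc n" using i by linarith
          then show "p' i \<le> p' (Suc i)" by cases (use p xy in \<open>auto simp: p'_def\<close>)
        qed
        ultimately show ?thesis unfolding A_def by blast
      qed
      then have "(\<Sum>i<Suc (Suc n). \<bar>h (p' (Suc i)) - h (p' i)\<bar>) \<le> V y"
        unfolding V_def by (rule cSup_upper) (rule bdd[OF xy(3)])
      ultimately show "s \<le> V y - \<bar>h y - h x\<bar>" by linarith
    qed
    then show ?thesis by linarith
  qed
  define c where "c x = max 0 (min 1 x)" for x :: real
  have c: "0 \<le> c x" "c x \<le> 1" "x \<le> y \<Longrightarrow> c x \<le> c y" "x \<in> {0..1} \<Longrightarrow> c x = x" for x y by (auto simp: c_def)
  define g1 where "g1 x = V (c x)" for x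
  define g2 where "g2 x = V (c x) - h (c x)" for x
  have m: "mono g1" "mono g2"
  proof -
    show "mono g1" unfolding g1_def
      by (rule monoI) (use grow[OF c(1) c(3) c(2)] in \<open>smt (verit)\<close>)
    show "mono g2" unfolding g2_def
      by (rule monoI) (use grow[OF c(1) c(3) c(2)] in \<open>smt (verit)\<close>)
  qed
  have b: "\<bar>g x\<bar> \<le> \<bar>g 0\<bar> + \<bar>g 1\<bar>" if g: "mono g" "\<And>x. g x = g (c x)" for g :: "real \<Rightarrow> real" and x
  proof -
    have "g 0 \<le> g (c x)" "g (c x) \<le> g 1" using monoD[OF g(1)] c(1,2) by auto
    then show ?thesis using g(2)[of x] by linarith
  qed
  have cc: "c (c x) = c x" for x using c(1,2,4) by simp
  show ?thesis
  proof (rule exI[of _ g1], rule exI[of _ g2], rule exI[of _ "(\<bar>g1 0\<bar> + \<bar>g1 1\<bar>) + (\<bar>g2 0\<bar> + \<bar>g2 1\<bar>)"], intro conjI m allI ballI)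
    have "\<bar>g1 x\<bar> \<le> \<bar>g1 0\<bar> + \<bar>g1 1\<bar>" "\<bar>g2 x\<bar> \<le> \<bar>g2 0\<bar> + \<bar>g2 1\<bar>" for x
      using b[OF m(1)] b[OF m(2)] by (auto simp: g1_def g2_def cc)
    then show "\<bar>g1 x\<bar> \<le> (\<bar>g1 0\<bar> + \<bar>g1 1\<bar>) + (\<bar>g2 0\<bar> + \<bar>g2 1\<bar>)" "\<bar>g2 x\<bar> \<le> (\<bar>g1 0\<bar> + \<bar>g1 1\<bar>) + (\<bar>g2 0\<bar> + \<bar>g2 1\<bar>)" for x
      by (smt (verit))+
    show "h x = g1 x - g2 x" if "x \<in> {0..1}" for x using c(4)[OF that] by (simp add: g1_def g2_def)
  qed
qed

lemma open_closed_unit: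
  fixes w :: "real \<Rightarrow> real"
  shows "set_integrable lborel {0<..<1} w \<longleftrightarrow> set_integrable lborel {0..1} w"
    and "(LINT x:{0<..<1}|lborel. w x) = I01 w"
  by (rule set_integrable_discrete_difference[where X = "{0, 1}"], auto)
     (rule set_integral_discrete_difference[where X = "{0, 1}"], auto)

context mesh
begin

definition avg :: "(real \<Rightarrow> real) \<Rightarrow> nat \<Rightarrow> real" where
  "avg g j = (LINT x:{X (j - 1)<..<X j}|lborel. g x) / h"

lemma X_cell: "j \<in> {1..N} \<Longrightarrow> X j - X (j - 1) = h"
  using X_pred[of j] by simp

lemma mono_integrable:
  fixes g :: "real \<Rightarrow> real"
  assumes "mono g" "\<And>x. \<bar>g x\<bar> \<le> C"
  shows "set_integrable lborel {a<..<b} g"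
proof (rule bm_integrable)
  show "bm {a<..<b} g" using assms borel_measurable_mono[of g] unfolding bm_def by blast
  show "emeasure lborel {a<..<b} < \<infinity>" by (cases "a \<le> b") auto
qed auto

lemma avg_mono:
  assumes g: "mono g" "\<And>x. \<bar>g x\<bar> \<le> C" and j: "j \<in> {1..N}"
  shows "g (X (j - 1)) \<le> avg g j" "avg g j \<le> g (X j)"
proof -
  have Xj: "X (j - 1) \<le> X j" using X_cell[OF j] h_pos by simp
  have i: "set_integrable lborel {X (j - 1)<..<X j} g" by (rule mono_integrable[OF g])
  have ic: "set_integrable lborel {X (j - 1)<..<X j} (\<lambda>x. c)" for c :: real
    by (rule bm_integrable[OF bm_const]) (use Xj in auto)
  have c: "(LINT x:{X (j - 1)<..<X j}|lborel. c) = c * h" for c :: real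
    using Xj X_cell[OF j] by (simp add: set_lebesgue_integral_def)
  have "g (X (j - 1)) * h \<le> (LINT x:{X (j - 1)<..<X j}|lborel. g x)"
    unfolding c[symmetric] by (rule set_integral_mono[OF ic i]) (auto intro: monoD[OF g(1)])
  then show "g (X (j - 1)) \<le> avg g j" using h_pos by (simp add: avg_def pos_le_divide_eq)
  have "(LINT x:{X (j - 1)<..<X j}|lborel. g x) \<le> g (X j) * h"
    unfolding c[symmetric] by (rule set_integral_mono[OF i ic]) (auto intro: monoD[OF g(1)])
  then show "avg g j \<le> g (X j)" using h_pos by (simp add: avg_def pos_divide_le_eq)
qed

text \<open>Averages of a monotone function are monotone, so their variation telescopes.\<close>

lemma avg_TV:
  assumes g: "mono g" "\<And>x. \<bar>g x\<bar> \<le> C"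
  shows "(\<Sum>j\<in>{1..<N}. \<bar>avg g (Suc j) - avg g j\<bar>) \<le> 2 * C"
proof -
  have "avg g j \<le> avg g (Suc j)" if "j \<in> {1..<N}" for j
    using avg_mono(2)[OF g, of j] avg_mono(1)[OF g, of "Suc j"] that by simp
  then have "(\<Sum>j\<in>{1..<N}. \<bar>avg g (Suc j) - avg g j\<bar>) = (\<Sum>j\<in>{1..<N}. avg g (Suc j) - avg g j)"
    by (intro sum.cong) auto
  also have "\<dots> = avg g N - avg g 1" using N_pos by (intro sum_Suc_diff') simp
  also have "\<dots> \<le> g (X N) - g (X 0)" using avg_mono(2)[OF g, of N] avg_mono(1)[OF g, of 1] N_pos by simp
  also have "\<dots> \<le> 2 * C" using g(2)[of "X N"] g(2)[of "X 0"] by linarith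
  finally show ?thesis .
qed

text \<open>In each cell the error is at most the increment of \<open>g\<close> over the cell, and the increments
  telescope.\<close>

lemma avg_L1:
  assumes g: "mono g" "\<And>x. \<bar>g x\<bar> \<le> C"
  shows "I01 (\<lambda>y. \<bar>g y - avg g (cell y)\<bar>) \<le> 2 * C * h"
proof -
  have bg: "bm {0..1} g" using g borel_measurable_mono[of g] unfolding bm_def by blast
  have "I01 (\<lambda>y. \<bar>g y - avg g (cell y)\<bar>) \<le> I01 (\<lambda>y. (\<lambda>j. g (X j) - g (X (j - 1))) (cell y))"
  proof (rule I01_mono)
    show "bm {0..1} (\<lambda>y. \<bar>g y - avg g (cell y)\<bar>)" by (intro bm_abs bm_diff bg bm_cell)
    show "bm {0..1} (\<lambda>y. (\<lambda>j. g (X j) - g (X (j - 1))) (cell y))" by (rule bm_cell)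
    fix y :: real assume y: "y \<in> {0..1}"
    have "g (X (cell y - 1)) \<le> g y" "g y \<le> g (X (cell y))" using cell_bounds[OF y] by (auto intro: monoD[OF g(1)])
    then show "\<bar>g y - avg g (cell y)\<bar> \<le> (\<lambda>j. g (X j) - g (X (j - 1))) (cell y)"
      using avg_mono[OF g cell_bounds(1)[OF y]] by simp
  qed
  also have "\<dots> = h * (\<Sum>j\<in>{1..N}. g (X j) - g (X (j - 1)))"
    using cell_integral[of N "\<lambda>j. g (X j) - g (X (j - 1))"] by (simp add: X_N)
  also have "\<dots> = h * (g (X N) - g (X 0))" using sum_diff_pred[of "\<lambda>j. g (X j)"] by simp
  also have "\<dots> \<le> h * (2 * C)" using g(2)[of "X N"] g(2)[of "X 0"] h_pos by (intro mult_left_mono) auto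
  finally show ?thesis by (simp add: mult_ac)
qed

lemma initial_avg:
  assumes u0: "set_integrable lborel {0<..<1} u0" and g: "mono g1" "mono g2" "\<And>x. \<bar>g1 x\<bar> \<le> C" "\<And>x. \<bar>g2 x\<bar> \<le> C"
    and ae: "AE x in lborel. x \<in> {0<..<1} \<longrightarrow> u0 x = g1 x - g2 x" and j: "j \<in> {1..N}"
  shows "fv F u0 T N M 0 j = avg g1 j - avg g2 j"
proof -
  have Xj: "X (j - 1) < X j" using X_cell[OF j] h_pos by simp
  have X01: "0 \<le> X (j - 1)" "X j \<le> 1" using X_01[of j] X_01[of "j - 1"] j by auto
  define w where "w = (\<lambda>x. indicator {0<..<1} x *\<^sub>R u0 x)"
  have wm: "w \<in> borel_measurable lborel" using u0 unfolding set_integrable_def w_def by (rule borel_measurable_integrable)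
  have gm: "(\<lambda>x. g1 x - g2 x) \<in> borel_measurable lborel" using borel_measurable_mono[OF g(1)] borel_measurable_mono[OF g(2)] by simp
  have "(LINT x:{X (j - 1)..<X j}|lborel. u0 x) = (LINT x:{X (j - 1)<..<X j}|lborel. u0 x)"
    by (rule set_integral_discrete_difference[where X = "{X (j - 1)}"]) auto
  also have "\<dots> = (LINT x:{X (j - 1)<..<X j}|lborel. w x)"
    by (rule set_lebesgue_integral_cong) (use X01 in \<open>auto simp: w_def\<close>)
  also have "\<dots> = (LINT x:{X (j - 1)<..<X j}|lborel. g1 x - g2 x)"
  proof (rule set_lebesgue_integral_cong_AE[OF _ wm gm])
    show "AE x\<in>{X (j - 1)<..<X j} in lborel. w x = g1 x - g2 x"
      using ae by eventually_elim (use X01 in \<open>auto simp: w_def\<close>)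
  qed simp
  also have "\<dots> = (LINT x:{X (j - 1)<..<X j}|lborel. g1 x) - (LINT x:{X (j - 1)<..<X j}|lborel. g2 x)"
    by (intro set_integral_diff(2) mono_integrable[OF g(1,3)] mono_integrable[OF g(2,4)])
  finally show ?thesis by (simp add: avg_def diff_divide_distrib)
qed

lemma growth_bound:
  assumes s: "\<And>n j. j \<in> {1..N} \<Longrightarrow> vs (Suc n) j = step (vs n) j"
    and i: "\<And>j. j \<in> {1..N} \<Longrightarrow> \<bar>vs 0 j\<bar> \<le> B0" and j: "j \<in> {1..N}"
  shows "1 + \<bar>vs n j\<bar> \<le> exp (3 * L * (real n * \<tau>)) * (1 + B0)"
  using j
proof (induction n arbitrary: j)
  case 0
  then show ?case using i by simp
next
  case (Suc n)
  define m where "m = exp (3 * L * (real n * \<tau>)) * (1 + B0) - 1"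
  have b: "\<bar>vs n k\<bar> \<le> m" if "k \<in> {1..N}" for k using Suc.IH[OF that] by (simp add: m_def)
  have B0: "B0 \<ge> 0" using i[OF Suc.prems] by linarith
  have "1 + \<bar>vs (Suc n) j\<bar> \<le> (1 + 3 * L * \<tau>) * (1 + m)"
    unfolding s[OF Suc.prems] by (rule step_bound[OF b Suc.prems])
  also have "\<dots> \<le> exp (3 * L * \<tau>) * (1 + m)"
  proof (rule mult_right_mono)
    show "1 + m \<ge> 0" using B0 by (simp add: m_def)
  qed (rule exp_ge_add_one_self)
  also have "\<dots> = exp (3 * L * (real (Suc n) * \<tau>)) * (1 + B0)"
  proof -
    have "exp (3 * L * (real (Suc n) * \<tau>)) = exp (3 * L * \<tau>) * exp (3 * L * (real n * \<tau>))"
      unfolding exp_add[symmetric] by (rule arg_cong[where f = exp]) (simp add: algebra_simps)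
    then show ?thesis by (simp add: m_def)
  qed
  finally show ?case .
qed

text \<open>Iteration of \<open>step_TV\<close>; the discrete Gronwall argument is the induction.\<close>

lemma growth_TV:
  assumes s: "\<And>n j. j \<in> {1..N} \<Longrightarrow> vs (Suc n) j = step (vs n) j"
    and B: "\<And>n j. n \<le> n0 \<Longrightarrow> j \<in> {1..N} \<Longrightarrow> \<bar>vs n j\<bar> \<le> B"
    and L2: "\<And>x y w. \<bar>w\<bar> \<le> B \<Longrightarrow> \<bar>fx x w - fx y w\<bar> \<le> L2 * \<bar>x - y\<bar>" "L2 \<ge> 0"
    and V0: "TV (vs 0) \<le> V0" and n: "n \<le> n0"
  shows "TV (vs n) \<le> exp (2 * L * (real n * \<tau>)) * (V0 + real n * \<tau> * (2 * L2 + 5 * B))"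
  using n
proof (induction n)
  case 0
  then show ?case using V0 by simp
next
  case (Suc n)
  have B0: "B \<ge> 0" using B[of 0 1] N_pos by force
  have V00: "V0 \<ge> 0" using V0 TV_nonneg[of "vs 0"] by linarith
  define \<beta> where "\<beta> = 2 * L2 + 5 * B"
  have \<beta>: "\<tau> * \<beta> \<ge> 0" using B0 L2 tau_pos by (simp add: \<beta>_def)
  define E where "E = exp (2 * L * (real n * \<tau>))"
  have "TV (vs (Suc n)) = TV (step (vs n))"
    unfolding TV_def by (intro sum.cong refl) (simp only: s right_in)
  also have "\<dots> \<le> (1 + 2 * L * \<tau>) * TV (vs n) + \<tau> * \<beta>"
    unfolding \<beta>_def by (rule step_TV[OF B L2]) (use Suc.prems in auto)
  also have "\<dots> \<le> exp (2 * L * \<tau>) * (E * (V0 + real n * \<tau> * \<beta>)) + \<tau> * \<beta>"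
  proof (intro add_right_mono mult_mono)
    show "1 + 2 * L * \<tau> \<le> exp (2 * L * \<tau>)" by (rule exp_ge_add_one_self)
    show "TV (vs n) \<le> E * (V0 + real n * \<tau> * \<beta>)" using Suc by (simp add: E_def \<beta>_def)
  qed (auto simp: TV_nonneg)
  also have "\<tau> * \<beta> \<le> exp (2 * L * \<tau>) * E * (\<tau> * \<beta>)"
  proof -
    have "1 * 1 \<le> exp (2 * L * \<tau>) * E" unfolding E_def using L1 tau_pos by (intro mult_mono) auto
    then show ?thesis using mult_right_mono[OF _ \<beta>, of 1] by simp
  qed
  also have "exp (2 * L * \<tau>) * (E * (V0 + real n * \<tau> * \<beta>)) + exp (2 * L * \<tau>) * E * (\<tau> * \<beta>)
    = (exp (2 * L * \<tau>) * E) * (V0 + real (Suc n) * \<tau> * \<beta>)" by (simp add: algebra_simps)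
  also have "exp (2 * L * \<tau>) * E = exp (2 * L * (real (Suc n) * \<tau>))"
    unfolding E_def exp_add[symmetric] by (rule arg_cong[where f = exp]) (simp add: algebra_simps)
  finally show ?case by (simp add: \<beta>_def)
qed

lemma TV_initial:
  assumes v: "\<And>j. j \<in> {1..N} \<Longrightarrow> v j = avg g1 j - avg g2 j"
    and g: "mono g1" "mono g2" "\<And>x. \<bar>g1 x\<bar> \<le> C" "\<And>x. \<bar>g2 x\<bar> \<le> C"
  shows "TV v \<le> 8 * C" and "j \<in> {1..N} \<Longrightarrow> \<bar>v j\<bar> \<le> 2 * C"
proof -
  have a: "\<bar>avg g1 j\<bar> \<le> C" "\<bar>avg g2 j\<bar> \<le> C" if "j \<in> {1..N}" for j
    using avg_mono[OF g(1,3) that] avg_mono[OF g(2,4) that] g(3)[of "X j"] g(3)[of "X (j - 1)"] g(4)[of "X j"] g(4)[of "X (j - 1)"]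
    by linarith+
  show b: "\<bar>v j\<bar> \<le> 2 * C" if "j \<in> {1..N}" for j using a[OF that] v[OF that] by linarith
  have "{1..N} = insert N {1..<N}" using N_pos by auto
  then have "TV v = \<bar>v (right N) - v N\<bar> + (\<Sum>j\<in>{1..<N}. \<bar>v (right j) - v j\<bar>)" by (simp add: TV_def)
  also have "(\<Sum>j\<in>{1..<N}. \<bar>v (right j) - v j\<bar>) \<le> (\<Sum>j\<in>{1..<N}. \<bar>avg g1 (Suc j) - avg g1 j\<bar> + \<bar>avg g2 (Suc j) - avg g2 j\<bar>)"
  proof (rule sum_mono)
    fix j assume j: "j \<in> {1..<N}"
    have "v (right j) = avg g1 (Suc j) - avg g2 (Suc j)" "v j = avg g1 j - avg g2 j" using j by (auto simp: right_def v)
    then show "\<bar>v (right j) - v j\<bar> \<le> \<bar>avg g1 (Suc j) - avg g1 j\<bar> + \<bar>avg g2 (Suc j) - avg g2 j\<bar>" by linarith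
  qed
  also have "\<dots> \<le> 4 * C" using avg_TV[OF g(1,3)] avg_TV[OF g(2,4)] by (simp add: sum.distrib)
  also have "\<bar>v (right N) - v N\<bar> \<le> 4 * C"
    using b[of "right N"] b[of N] right_in[of N] N_pos by force
  finally show "TV v \<le> 8 * C" by simp
qed

lemma fv_approx_final:
  assumes "x \<in> {0<..<1}"
  shows "fv_approx F u0 T N M T x = fv F u0 T N M (Suc M) (cell x)"
proof -
  have "T / \<tau> = real (Suc M)" using T_pos by (simp add: dt_def)
  then have a: "nat \<lfloor>T / \<tau>\<rfloor> = Suc M" by simp
  have "x / h < real N" using assms N_h h_pos by (simp add: pos_divide_less_eq)
  then have "nat \<lfloor>x / h\<rfloor> + 1 \<le> N" using assms h_pos by (simp add: Suc_le_eq nat_less_iff floor_less_iff)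
  then have "cell x = nat \<lfloor>x / h\<rfloor> + 1" by (simp add: cell_def)
  then show ?thesis unfolding fv_approx_def a by simp
qed

end

context entropy_mesh
begin

text \<open>The constants \<open>B\<close>, \<open>V\<close>, \<open>D\<close> bound the scheme up to the time \<open>T'\<close>, which leaves room for
  the time shifts and does not depend on the mesh.\<close>

lemma error_estimate:
  assumes g: "mono g1" "mono g2" "\<And>x. \<bar>g1 x\<bar> \<le> C0" "\<And>x. \<bar>g2 x\<bar> \<le> C0"
    and iv: "set_integrable lborel {0<..<1} iv" "AE x in lborel. x \<in> {0<..<1} \<longrightarrow> iv x = g1 x - g2 x"
    and ui: "AE x in lborel. x \<in> {0<..<1} \<longrightarrow> u 0 x = iv x"
    and L2: "\<And>x y w. \<bar>w\<bar> \<le> B \<Longrightarrow> \<bar>fx x w - fx y w\<bar> \<le> L2 * \<bar>x - y\<bar>" "L2 \<ge> 0"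
    and T': "T' = T + sqrt cf + cf"
    and Bb: "exp (3 * L * T') * (1 + 2 * C0) \<le> B"
    and V: "V = exp (2 * L * T') * (8 * C0 + T' * (2 * L2 + 5 * B))"
    and D: "D = 2 * L * V + L * (1 + B) + 2 * B"
  defines "CG \<equiv> growth_const L G" and "C2 \<equiv> error_const L G cf B L2 V D"
  shows "L1_norm (\<lambda>x. u T x - fv_approx F iv T N M T x)
    \<le> (exp (CG * T) * ((4 * C0 + 4 * V * G\<^sup>2) + 2 * G * D * (sqrt cf + cf) + T * (2 * (2 * B + L * (1 + B)) * sqrt cf + C2)) + 4 * V * G\<^sup>2) * sqrt h"
proof -
  define vs where "vs = fv F iv T N M"
  \<comment> \<open>this number of shifts balances the errors \<open>1 / K\<close> and \<open>K \<Delta>t\<close>\<close>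
  define K where "K = nat \<lceil>1 / sqrt \<tau>\<rceil>"
  have st: "sqrt \<tau> > 0" using tau_pos by simp
  have "1 / sqrt \<tau> > 0" using st by simp
  then have K: "real K \<ge> 1 / sqrt \<tau>" "real K \<le> 1 / sqrt \<tau> + 1" unfolding K_def by linarith+
  have K1: "K \<ge> 1" using K st by (cases K) auto
  have ste: "sqrt \<tau> \<le> sqrt cf * \<epsilon>"
    using dt_le real_sqrt_le_mono[of \<tau> "cf * h"] by (simp add: real_sqrt_mult \<epsilon>_def)
  have te: "\<tau> \<le> cf * \<epsilon>" using order_trans[OF dt_le mult_left_mono[OF h_le_eps]] cf_pos by simp
  have Ki: "1 / real K \<le> sqrt cf * \<epsilon>"
  proof -
    have "1 / real K \<le> sqrt \<tau>" using K(1) K1 st by (simp add: field_simps)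
    then show ?thesis using ste by linarith
  qed
  have Kt: "real K * \<tau> \<le> (sqrt cf + cf) * \<epsilon>"
  proof -
    have "real K * \<tau> \<le> (1 / sqrt \<tau> + 1) * \<tau>" using K tau_pos by (intro mult_right_mono) auto
    also have "\<dots> = sqrt \<tau> + \<tau>" using tau_pos by (simp add: distrib_right real_div_sqrt)
    finally show ?thesis using ste te by (simp add: distrib_right)
  qed
  have C00: "C0 \<ge> 0" using g(3)[of 0] by linarith
  have nT: "real n * \<tau> \<le> T'" if "n \<le> M + K" for n
  proof -
    have "real n * \<tau> \<le> real (Suc M + K) * \<tau>" using that tau_pos by (intro mult_right_mono) auto
    also have "\<dots> = T + real K * \<tau>" using T_grid by (simp add: algebra_simps)
    also have "\<dots> \<le> T + (sqrt cf + cf) * 1"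
      using Kt mult_left_mono[OF eps_le1, of "sqrt cf + cf"] cf_pos by simp
    finally show ?thesis by (simp add: T')
  qed
  have T'0: "T' \<ge> 0" using T_pos cf_pos by (simp add: T')
  have step: "vs (Suc n) j = step (vs n) j" for n j by (simp add: vs_def)
  have init: "vs 0 j = avg g1 j - avg g2 j" if "j \<in> {1..N}" for j
    unfolding vs_def by (rule initial_avg[OF iv(1) g iv(2) that])
  note in_TV = TV_initial[OF init g]
  have vB: "\<bar>vs n j\<bar> \<le> B" if "n \<le> M + K" "j \<in> {1..N}" for n j
  proof -
    have "1 + \<bar>vs n j\<bar> \<le> exp (3 * L * (real n * \<tau>)) * (1 + 2 * C0)"
      by (rule growth_bound[OF step in_TV(2) that(2)])
    also have "\<dots> \<le> exp (3 * L * T') * (1 + 2 * C0)"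
      using nT[OF that(1)] L1 C00 by (intro mult_right_mono) auto
    finally show ?thesis using Bb by linarith
  qed
  have V0: "8 * C0 + T' * (2 * L2 + 5 * B) \<ge> 0" using C00 T'0 L2 B_nonneg by simp
  have V_nonneg: "V \<ge> 0" unfolding V using V0 by simp
  have vV: "TV (vs n) \<le> V" if n: "n \<le> M + K" for n
  proof -
    have "TV (vs n) \<le> exp (2 * L * (real n * \<tau>)) * (8 * C0 + real n * \<tau> * (2 * L2 + 5 * B))"
      by (rule growth_TV[OF step vB L2 in_TV(1) n])
    also have "\<dots> \<le> V" unfolding V
      using nT[OF n] L1 C00 L2 B_nonneg tau_pos by (intro mult_mono add_mono mult_right_mono) auto
    finally show ?thesis .
  qed
  have D0: "D \<ge> 0" unfolding D using V_nonneg L1 B_nonneg by simp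
  have vD: "h * (\<Sum>j\<in>{1..N}. \<bar>vs (Suc n) j - vs n j\<bar>) \<le> D * \<tau>" if n: "n \<le> M + K" for n
  proof -
    have "h * (\<Sum>j\<in>{1..N}. \<bar>vs (Suc n) j - vs n j\<bar>) \<le> \<tau> * (2 * L * TV (vs n) + L * (1 + B) + 2 * B)"
      unfolding step by (rule step_time[OF vB[OF n]])
    also have "\<dots> \<le> \<tau> * (2 * L * V + L * (1 + B) + 2 * B)"
      using vV[OF n] L1 tau_pos by (intro mult_left_mono add_right_mono) auto
    finally show ?thesis by (simp add: D mult.commute)
  qed
  have kuz: "exp (- CG * T) * Phi (vs (Suc M)) (u T) \<le> Phi (vs 0) (u 0) + 2 * G * D * (real K * \<tau>)
      + T * (2 * (2 * B + L * (1 + B)) / real K + C2 * \<epsilon>)"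
    unfolding CG_def C2_def by (rule kuznetsov_estimate[where vs = vs, OF K1 L2 step vB vV vD D0])
  have init_err: "Phi (vs 0) (u 0) \<le> (4 * C0 + 4 * V * G\<^sup>2) * \<epsilon>"
  proof -
    have bg: "bm {0..1} g1" "bm {0..1} g2" using g borel_measurable_mono unfolding bm_def by blast+
    have i1: "set_integrable lborel {0..1} (\<lambda>y. \<bar>u 0 y - vs 0 (cell y)\<bar>)"
      by (intro set_integrable_abs set_integral_diff u0 I01_integrable bm_cell)
    have b2: "bm {0..1} (\<lambda>y. \<bar>g1 y - avg g1 (cell y)\<bar>)" "bm {0..1} (\<lambda>y. \<bar>g2 y - avg g2 (cell y)\<bar>)"
      by (intro bm_abs bm_diff bg bm_cell)+
    have "I01 (\<lambda>y. \<bar>u 0 y - vs 0 (cell y)\<bar>) \<le> I01 (\<lambda>y. \<bar>g1 y - avg g1 (cell y)\<bar> + \<bar>g2 y - avg g2 (cell y)\<bar>)"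
    proof (rule set_integral_mono_AE[OF i1 I01_integrable[OF bm_add[OF b2]]])
      show "AE y\<in>{0..1} in lborel. \<bar>u 0 y - vs 0 (cell y)\<bar> \<le> \<bar>g1 y - avg g1 (cell y)\<bar> + \<bar>g2 y - avg g2 (cell y)\<bar>"
        using ui iv(2) AE_lborel_singleton[of "0::real"] AE_lborel_singleton[of "1::real"]
      proof eventually_elim
        case (elim y)
        show ?case
        proof
          assume y: "y \<in> {0..1}"
          then have "u 0 y = g1 y - g2 y" using elim by auto
          then show "\<bar>u 0 y - vs 0 (cell y)\<bar> \<le> \<bar>g1 y - avg g1 (cell y)\<bar> + \<bar>g2 y - avg g2 (cell y)\<bar>"
            unfolding init[OF cell_bounds(1)[OF y]] by linarith
        qed
      qed
    qed
    also have "\<dots> \<le> 2 * C0 * h + 2 * C0 * h"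
      unfolding I01_add[OF b2] by (intro add_mono avg_L1 g)
    also have "\<dots> \<le> 4 * C0 * \<epsilon>" using mult_left_mono[OF h_le_eps, of "4 * C0"] C00 by simp
    finally have "I01 (\<lambda>y. \<bar>u 0 y - vs 0 (cell y)\<bar>) \<le> 4 * C0 * \<epsilon>" .
    moreover have "G * I01 (TVk (vs 0)) \<le> G * (4 * V * \<epsilon> * G)" using TVk_TV[OF vV[of 0]] G1 by (intro mult_left_mono) auto
    ultimately show ?thesis using Phi_L1(2)[OF u0, of "vs 0"] by (simp add: power2_eq_square algebra_simps)
  qed
  define Zb where "Zb = 2 * B + L * (1 + B)"
  have Zb0: "Zb \<ge> 0" using B_nonneg L1 by (simp add: Zb_def)
  let ?A = "(4 * C0 + 4 * V * G\<^sup>2) + 2 * G * D * (sqrt cf + cf) + T * (2 * Zb * sqrt cf + C2)"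
  have "exp (- CG * T) * Phi (vs (Suc M)) (u T) \<le> ?A * \<epsilon>"
  proof -
    have 1: "2 * G * D * (real K * \<tau>) \<le> 2 * G * D * ((sqrt cf + cf) * \<epsilon>)" using Kt G1 D0 by (intro mult_left_mono) auto
    have 2: "2 * Zb / real K \<le> 2 * Zb * (sqrt cf * \<epsilon>)" using mult_left_mono[OF Ki, of "2 * Zb"] Zb0 by simp
    have "T * (2 * Zb / real K + C2 * \<epsilon>) \<le> T * (2 * Zb * (sqrt cf * \<epsilon>) + C2 * \<epsilon>)"
      using 2 T_pos by (intro mult_left_mono add_right_mono) auto
    then have "exp (- CG * T) * Phi (vs (Suc M)) (u T) \<le> (4 * C0 + 4 * V * G\<^sup>2) * \<epsilon> + 2 * G * D * ((sqrt cf + cf) * \<epsilon>)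
       + T * (2 * Zb * (sqrt cf * \<epsilon>) + C2 * \<epsilon>)" using kuz init_err 1 unfolding Zb_def by linarith
    also have "\<dots> = ?A * \<epsilon>" by (simp add: algebra_simps)
    finally show ?thesis .
  qed
  then have "exp (CG * T) * (exp (- CG * T) * Phi (vs (Suc M)) (u T)) \<le> exp (CG * T) * (?A * \<epsilon>)"
    by (intro mult_left_mono) auto
  then have Phi: "Phi (vs (Suc M)) (u T) \<le> exp (CG * T) * ?A * \<epsilon>"
    by (simp add: mult.assoc[symmetric] exp_add[symmetric])
  have "L1_norm (\<lambda>x. u T x - fv_approx F iv T N M T x) = (LINT x:{0<..<1}|lborel. \<bar>u T x - vs (Suc M) (cell x)\<bar>)"
    unfolding L1_norm_def vs_def by (rule set_lebesgue_integral_cong) (auto simp: fv_approx_final simp del: fv.simps)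
  also have "\<dots> = I01 (\<lambda>x. \<bar>u T x - vs (Suc M) (cell x)\<bar>)" by (rule open_closed_unit)
  also have "\<dots> \<le> Phi (vs (Suc M)) (u T) + G * I01 (TVk (vs (Suc M)))" by (rule Phi_L1[OF uT])
  also have "\<dots> \<le> exp (CG * T) * ?A * \<epsilon> + G * (4 * V * \<epsilon> * G)"
    using Phi TVk_TV[OF vV[of "Suc M"]] G1 K1 by (intro add_mono mult_left_mono) auto
  also have "\<dots> = (exp (CG * T) * ?A + 4 * V * G\<^sup>2) * \<epsilon>" by (simp add: power2_eq_square algebra_simps)
  finally show ?thesis unfolding Zb_def \<epsilon>_def .
qed

end

section \<open>Structural constants of the flux\<close>

lemma periodic_frac:
  fixes g :: "real \<Rightarrow> real"
  assumes "\<And>x. g (x + 1) = g x"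
  shows "g x = g (frac x)"
proof -
  have n: "g (y + real n) = g y" for y n
  proof (induction n)
    case (Suc n)
    then show ?case using assms[of "y + real n"] by (simp add: add_ac)
  qed simp
  show ?thesis
  proof (cases "\<lfloor>x\<rfloor> \<ge> 0")
    case True
    then show ?thesis using n[of "frac x" "nat \<lfloor>x\<rfloor>"] by (simp add: frac_def)
  next
    case False
    then show ?thesis using n[of x "nat (- \<lfloor>x\<rfloor>)"] by (simp add: frac_def)
  qed
qed

text \<open>Lipschitz continuity in the second variable, uniformly in the first, upgrades separate to
  joint continuity.\<close>

lemma joint_continuous:
  fixes g :: "real \<Rightarrow> real \<Rightarrow> real"
  assumes l: "\<And>x v v'. \<bar>g x v - g x v'\<bar> \<le> L * \<bar>v - v'\<bar>" and c: "\<And>v. continuous_on UNIV (\<lambda>x. g x v)"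
  shows "continuous_on UNIV (\<lambda>p. g (fst p) (snd p))"
proof -
  have "((\<lambda>p. g (fst p) (snd p)) \<longlongrightarrow> g a b) (at (a, b))" for a b
  proof (rule Lim_null[THEN iffD2], rule Lim_null_comparison)
    show "\<forall>\<^sub>F p in at (a, b). norm (g (fst p) (snd p) - g a b) \<le> L * \<bar>snd p - b\<bar> + \<bar>g (fst p) b - g a b\<bar>"
    proof (rule always_eventually, rule allI)
      fix p :: "real \<times> real"
      have "\<bar>g (fst p) (snd p) - g (fst p) b\<bar> \<le> L * \<bar>snd p - b\<bar>" by (rule l)
      then show "norm (g (fst p) (snd p) - g a b) \<le> L * \<bar>snd p - b\<bar> + \<bar>g (fst p) b - g a b\<bar>"
        unfolding real_norm_def by linarith
    qed
    have "continuous_on UNIV (\<lambda>p::real\<times>real. L * \<bar>snd p - b\<bar> + \<bar>g (fst p) b - g a b\<bar>)"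
      by (intro continuous_intros continuous_on_compose2[OF c]) auto
    then have "isCont (\<lambda>p::real\<times>real. L * \<bar>snd p - b\<bar> + \<bar>g (fst p) b - g a b\<bar>) (a, b)"
      by (simp add: continuous_on_eq_continuous_at)
    then show "((\<lambda>p::real\<times>real. L * \<bar>snd p - b\<bar> + \<bar>g (fst p) b - g a b\<bar>) \<longlongrightarrow> 0) (at (a, b))"
      by (simp add: isCont_def)
  qed
  then show ?thesis by (auto simp: continuous_on_eq_continuous_at isCont_def)
qed

text \<open>All bounds on derivatives in \<open>x\<close> are uniform on the line by periodicity. Consistency
  transfers the Lipschitz bounds on \<open>F\<close> and \<open>F\<^sub>x\<close> to \<open>f\<close> and \<open>fx\<close>. A Lipschitz constant of \<open>fx\<close>
  in \<open>x\<close> exists on bounded sets of states only, and the bound on the states depends on \<open>L\<close>;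
  hence it is supplied separately for every \<open>B\<close>.\<close>

lemma flux_setting_exists:
  assumes T: "T > 0" and cf: "cf > 0" and per: "\<And>x v. f (x + 1) v = f x v" and C: "Ck 2 f"
    and nf: "numerical_flux f F" and cfl: "CFL_const F T cf"
  obtains fx L where "flux_setting F f fx L T cf"
    "\<And>B. \<exists>L2\<ge>0. \<forall>x y w. \<bar>w\<bar> \<le> B \<longrightarrow> \<bar>fx x w - fx y w\<bar> \<le> L2 * \<bar>x - y\<bar>"
proof -
  obtain fx f2 where fx: "\<And>x v. ((\<lambda>s. f s v) has_real_derivative fx x v) (at x)" and C1: "Ck 1 fx"
    using C by (auto simp: numeral_2_eq_2)
  obtain fxx f12 where fxx: "\<And>x v. ((\<lambda>s. fx s v) has_real_derivative fxx x v) (at x)" and fxxc: "continuous_on UNIV (\<lambda>(x, v). fxx x v)"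
    using C1 unfolding One_nat_def Ck.simps by blast
  have fper: "F (x + 1) v w = F x v w" and cons: "F x v v = f x v"
    and Fd: "(\<lambda>y. F y v w) differentiable (at x)" for x v w
    using nf unfolding numerical_flux_def by blast+
  obtain La Lb where La: "\<And>x. La-lipschitz_on UNIV (\<lambda>(v, w). F x v w)"
    and Lb: "\<And>x. Lb-lipschitz_on UNIV (\<lambda>(v, w). deriv (\<lambda>y. F y v w) x)"
    using nf unfolding numerical_flux_def by blast
  have La0: "La \<ge> 0" "Lb \<ge> 0" using lipschitz_on_nonneg[OF La] lipschitz_on_nonneg[OF Lb] by auto
  have dp: "dist (v, w) (v', w') \<le> \<bar>v - v'\<bar> + \<bar>w - w'\<bar>" for v w v' w' :: real
    unfolding dist_prod_def by (simp add: dist_real_def) (metis abs_ge_zero abs_idempotent real_sqrt_sum_squares_triangle_ineq sqrt_sum_squares_le_sum_abs power2_abs)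
  have Fl: "\<bar>F x v w - F x v' w'\<bar> \<le> La * (\<bar>v - v'\<bar> + \<bar>w - w'\<bar>)" for x v w v' w'
    using lipschitz_onD[OF La, of "(v, w)" "(v', w')" x] order_trans[OF _ mult_left_mono[OF dp La0(1)]]
    by (auto simp: dist_real_def)
  have dFl: "\<bar>deriv (\<lambda>y. F y v w) x - deriv (\<lambda>y. F y v' w') x\<bar> \<le> Lb * (\<bar>v - v'\<bar> + \<bar>w - w'\<bar>)" for x v w v' w'
    using lipschitz_onD[OF Lb, of "(v, w)" "(v', w')" x] order_trans[OF _ mult_left_mono[OF dp La0(2)]]
    by (auto simp: dist_real_def)
  have Fder: "((\<lambda>y. F y v w) has_real_derivative deriv (\<lambda>y. F y v w) x) (at x)" for v w x
    using Fd by (simp add: DERIV_deriv_iff_real_differentiable)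
  have fxF: "fx x v = deriv (\<lambda>y. F y v v) x" for x v
    using DERIV_imp_deriv[OF fx[of v x]] by (simp add: cons)
  have fxl: "\<bar>fx x v - fx x v'\<bar> \<le> 2 * Lb * \<bar>v - v'\<bar>" for x v v'
    unfolding fxF using dFl[of v v x v' v'] by simp
  have fxper: "fx (x + 1) v = fx x v" for x v
  proof -
    have "((\<lambda>s. f (s + 1) v) has_real_derivative fx (x + 1) v) (at x)"
      by (rule DERIV_cong[OF DERIV_chain2[OF fx DERIV_add[OF DERIV_ident DERIV_const]]]) simp
    then have "((\<lambda>s. f s v) has_real_derivative fx (x + 1) v) (at x)" by (simp add: per)
    then show ?thesis using fx DERIV_unique by blast
  qed
  have fxxper: "fxx (x + 1) v = fxx x v" for x v
  proof -
    have "((\<lambda>s. fx (s + 1) v) has_real_derivative fxx (x + 1) v) (at x)"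
      by (rule DERIV_cong[OF DERIV_chain2[OF fxx DERIV_add[OF DERIV_ident DERIV_const]]]) simp
    then have "((\<lambda>s. fx s v) has_real_derivative fxx (x + 1) v) (at x)" by (simp add: fxper)
    then show ?thesis using fxx DERIV_unique by blast
  qed
  have cfx: "continuous_on UNIV (\<lambda>x. fx x v)" for v
    using fxx by (auto intro!: continuous_at_imp_continuous_on intro: DERIV_isCont)
  have cfv: "continuous_on UNIV (\<lambda>x. f x v)" for v
    using fx by (auto intro!: continuous_at_imp_continuous_on intro: DERIV_isCont)
  have "compact ((\<lambda>x. fx x 0) ` {0..1})"
    by (intro compact_continuous_image continuous_on_subset[OF cfx]) auto
  from compact_imp_bounded[OF this] obtain Cz where "\<forall>z\<in>(\<lambda>x. fx x 0) ` {0..1}. norm z \<le> Cz"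
    unfolding bounded_iff by blast
  then have Cz: "\<bar>fx x 0\<bar> \<le> Cz" if "x \<in> {0..1}" for x using that by force
  have Cz': "\<bar>fx x 0\<bar> \<le> Cz" for x
    using periodic_frac[of "\<lambda>x. fx x 0" x, OF fxper] Cz[of "frac x"] by (simp add: frac_lt_1 less_imp_le)
  define L where "L = 1 + La + 2 * Lb + \<bar>Cz\<bar>"
  have L: "L \<ge> 1" "L \<ge> La" "L \<ge> 2 * Lb" "L \<ge> Lb" "L \<ge> Cz" using La0 by (auto simp: L_def)
  show ?thesis
  proof (rule that[of fx L])
    show "flux_setting F f fx L T cf"
    proof
      show "\<bar>F x v w - F x v' w'\<bar> \<le> L * (\<bar>v - v'\<bar> + \<bar>w - w'\<bar>)" for x v w v' w'
        by (rule order_trans[OF Fl mult_right_mono[OF L(2)]]) auto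
      show "\<bar>F x v w - F y v w - (F x v' w' - F y v' w')\<bar> \<le> L * \<bar>x - y\<bar> * (\<bar>v - v'\<bar> + \<bar>w - w'\<bar>)" for x y v w v' w'
      proof -
        obtain \<xi> where "(F x v w - F x v' w') - (F y v w - F y v' w') = (x - y) * (deriv (\<lambda>y. F y v w) \<xi> - deriv (\<lambda>y. F y v' w') \<xi>)"
          using MVT_between[of "\<lambda>y. F y v w - F y v' w'" "\<lambda>x. deriv (\<lambda>y. F y v w) x - deriv (\<lambda>y. F y v' w') x" y x]
            DERIV_diff[OF Fder Fder] by metis
        then have "\<bar>F x v w - F y v w - (F x v' w' - F y v' w')\<bar> = \<bar>x - y\<bar> * \<bar>deriv (\<lambda>y. F y v w) \<xi> - deriv (\<lambda>y. F y v' w') \<xi>\<bar>"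
          by (simp add: abs_mult[symmetric] algebra_simps)
        also have "\<dots> \<le> \<bar>x - y\<bar> * (L * (\<bar>v - v'\<bar> + \<bar>w - w'\<bar>))"
          by (intro mult_left_mono order_trans[OF dFl mult_right_mono[OF L(4)]]) auto
        finally show ?thesis by (simp add: mult_ac)
      qed
      show "\<bar>fx x v\<bar> \<le> L * (1 + \<bar>v\<bar>)" for x v
      proof -
        have "\<bar>fx x v\<bar> \<le> Cz + 2 * Lb * \<bar>v\<bar>" using fxl[of x v 0] Cz'[of x] by simp
        also have "\<dots> \<le> L + L * \<bar>v\<bar>" using L by (intro add_mono mult_right_mono) auto
        finally show ?thesis by (simp add: distrib_left)
      qed
      show "\<bar>fx x v - fx x v'\<bar> \<le> L * \<bar>v - v'\<bar>" for x v v'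
        by (rule order_trans[OF fxl mult_right_mono[OF L(3)]]) auto
      show "continuous_on UNIV (\<lambda>p. f (fst p) (snd p))"
      proof (rule joint_continuous[OF _ cfv])
        show "\<bar>f x v - f x v'\<bar> \<le> 2 * La * \<bar>v - v'\<bar>" for x v v'
          using Fl[of x v v v' v'] by (simp add: cons)
      qed
      show "continuous_on UNIV (\<lambda>p. fx (fst p) (snd p))" by (rule joint_continuous[OF fxl cfx])
    qed (use L T cf fper cons fx cfl in auto)
    show "\<exists>L2\<ge>0. \<forall>x y w. \<bar>w\<bar> \<le> B \<longrightarrow> \<bar>fx x w - fx y w\<bar> \<le> L2 * \<bar>x - y\<bar>" for B
    proof -
      have "compact ((\<lambda>(x, v). fxx x v) ` ({0..1} \<times> {-B..B}))"
        by (intro compact_continuous_image continuous_on_subset[OF fxxc] compact_Times) auto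
      from compact_imp_bounded[OF this] obtain Cw where "\<forall>p\<in>(\<lambda>(x, v). fxx x v) ` ({0..1} \<times> {-B..B}). norm p \<le> Cw"
        unfolding bounded_iff by blast
      then have Cw: "\<bar>fxx x w\<bar> \<le> Cw" if "x \<in> {0..1}" "w \<in> {-B..B}" for x w using that by force
      have Cw': "\<bar>fxx x w\<bar> \<le> \<bar>Cw\<bar>" if "\<bar>w\<bar> \<le> B" for x w
        using periodic_frac[of "\<lambda>x. fxx x w" x, OF fxxper] Cw[of "frac x" w] that
        by (simp add: frac_lt_1 less_imp_le abs_le_iff)
      have "\<bar>fx x w - fx y w\<bar> \<le> \<bar>Cw\<bar> * \<bar>x - y\<bar>" if w: "\<bar>w\<bar> \<le> B" for x y w
      proof -
        obtain \<xi> where "fx x w - fx y w = (x - y) * fxx \<xi> w"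
          using MVT_between[of "\<lambda>s. fx s w" "\<lambda>s. fxx s w" y x] fxx by metis
        then have "\<bar>fx x w - fx y w\<bar> = \<bar>fxx \<xi> w\<bar> * \<bar>x - y\<bar>" by (simp add: abs_mult mult.commute)
        also have "\<dots> \<le> \<bar>Cw\<bar> * \<bar>x - y\<bar>" by (intro mult_right_mono Cw'[OF w]) auto
        finally show ?thesis .
      qed
      then show ?thesis by (intro exI[of _ "\<bar>Cw\<bar>"]) auto
    qed
  qed
qed

theorem theorem12:
  fixes T cf :: real
    and f :: "real \<Rightarrow> real \<Rightarrow> real"
    and F :: "real \<Rightarrow> real \<Rightarrow> real \<Rightarrow> real"
    and u0 :: "real \<Rightarrow> real"
    and u :: "real \<Rightarrow> real \<Rightarrow> real"
  assumes "T > 0"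
    and "L1_BV u0"
    and "(LINT x:{0<..<1}|lborel. u0 x) = 0"
    and "\<And>K. compact K \<Longrightarrow> bounded ((\<lambda>(x, v). f x v) ` K)"
    and "\<And>x v. f (x + 1) v = f x v"
    and "Ck 2 f"
    and "numerical_flux f F"
    and "cf > 0"
    and "CFL_const F T cf"
    and "entropy_solution T f u0 u"
  shows "\<exists>C. \<forall>N M. N > 0 \<and> M > 0 \<and> dt T M \<le> cf * dx N \<longrightarrow>
           L1_norm (\<lambda>x. u T x - fv_approx F u0 T N M T x) \<le> C * sqrt (dx N)"
proof -
  obtain fx L where fs: "flux_setting F f fx L T cf"
    and fxL: "\<And>B. \<exists>L2\<ge>0. \<forall>x y w. \<bar>w\<bar> \<le> B \<longrightarrow> \<bar>fx x w - fx y w\<bar> \<le> L2 * \<bar>x - y\<bar>"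
    using flux_setting_exists[of T cf f F] assms by metis
  obtain hb where u0i: "set_integrable lborel {0<..<1} u0" and hb: "bounded_variation 0 1 hb"
    and u0h: "AE x in lborel. x \<in> {0<..<1} \<longrightarrow> u0 x = hb x"
    using assms(2) unfolding L1_BV_def by blast
  obtain g1 g2 C0 where g: "mono g1" "mono g2" "\<And>x. \<bar>g1 x\<bar> \<le> C0" "\<And>x. \<bar>g2 x\<bar> \<le> C0"
    and hg: "\<And>x. x \<in> {0..1} \<Longrightarrow> hb x = g1 x - g2 x"
    using jordan_decomposition[OF hb] by blast
  have u0g: "AE x in lborel. x \<in> {0<..<1} \<longrightarrow> u0 x = g1 x - g2 x"
    using u0h by eventually_elim (use hg in auto)
  have es: "C_L1 T u" "Linf_Pi T u" "AE x in lborel. x \<in> {0<..<1} \<longrightarrow> u 0 x = u0 x"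
    "\<And>k \<phi>. smooth2 \<phi> \<Longrightarrow> (\<And>t x. \<phi> t x \<ge> 0) \<Longrightarrow> (\<And>t x. \<phi> t (x + 1) = \<phi> t x) \<Longrightarrow> entropy_ineq T f u k \<phi>"
    using assms(10) unfolding entropy_solution_def by auto
  obtain U v Bu where Uv: "U \<in> borel_measurable borel" "v \<in> borel_measurable borel" "Bu \<ge> 0"
    "\<And>p. \<bar>v p\<bar> \<le> Bu" "AE p in lborel. U p = v p" "\<And>t x. t \<in> {0..T} \<Longrightarrow> x \<in> {0..1} \<Longrightarrow> U (t, x) = u t x"
    by (rule bounded_representative[OF es(2)]) blast
  have ui: "set_integrable lborel {0..1} (u T)" "set_integrable lborel {0..1} (u 0)"
    using es(1) assms(1) unfolding C_L1_def open_closed_unit by auto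
  obtain G where G: "G \<ge> 1" "\<And>N. N > 0 \<Longrightarrow> \<exists>\<Omega> \<omega> \<omega>' \<rho>. kernel_pair N G \<Omega> \<omega> \<omega>' \<rho>"
    using kernel_exists by blast
  \<comment> \<open>\<open>K \<Delta>t \<le> sqrt \<Delta>t + \<Delta>t\<close>, and both are bounded through the CFL condition\<close>
  define T' where "T' = T + sqrt cf + cf"
  define B where "B = Bu + exp (3 * L * T') * (1 + 2 * C0)"
  have C00: "C0 \<ge> 0" using g(3)[of 0] by linarith
  have B: "Bu \<le> B" "exp (3 * L * T') * (1 + 2 * C0) \<le> B" using Uv(3) C00 by (auto simp: B_def)
  obtain L2 where L2: "L2 \<ge> 0" "\<And>x y w. \<bar>w\<bar> \<le> B \<Longrightarrow> \<bar>fx x w - fx y w\<bar> \<le> L2 * \<bar>x - y\<bar>"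
    using fxL[of B] by blast
  define V where "V = exp (2 * L * T') * (8 * C0 + T' * (2 * L2 + 5 * B))"
  define D where "D = 2 * L * V + L * (1 + B) + 2 * B"
  define C where "C = exp (growth_const L G * T) * ((4 * C0 + 4 * V * G\<^sup>2) + 2 * G * D * (sqrt cf + cf)
      + T * (2 * (2 * B + L * (1 + B)) * sqrt cf + error_const L G cf B L2 V D)) + 4 * V * G\<^sup>2"
  show ?thesis
  proof (intro exI[of _ C] allI impI)
    fix N M assume NM: "N > 0 \<and> M > 0 \<and> dt T M \<le> cf * dx N"
    obtain \<Omega> \<omega> \<omega>' \<rho> where kp: "kernel_pair N G \<Omega> \<omega> \<omega>' \<rho>" using G(2) NM by blast
    interpret flux_setting F f fx L T cf by (rule fs)
    interpret entropy_mesh F f fx L T cf N M G \<Omega> \<omega> \<omega>' \<rho> u U v B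
    proof
      show "\<bar>v p\<bar> \<le> B" for p using Uv(4)[of p] B(1) by linarith
    qed (use NM G(1) kp es(4) Uv ui in auto)
    show "L1_norm (\<lambda>x. u T x - fv_approx F u0 T N M T x) \<le> C * sqrt (dx N)"
      unfolding C_def
      by (rule error_estimate[OF g u0i u0g es(3) L2(2,1) T'_def B(2) V_def D_def])
  qed
qed

end
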